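(* Let $k$ be an algebraically closed field of characteristic $0$. Let $v_{n,2}:\mathbb{P}(V)\to\mathbb{P}(\mathrm{Sym}^2 V)$ be a degree $2$ Veronese embedding, where $V$ is a $k$-vector space of dimension $n+1$ with $n\ge 1$. Let $X$ denote the image of $v_{n,2}$ and let $R\subset\mathbb{P}(V)$ be a rational normal curve of degree $n$. Then, identifying $X$ with $\mathbb{P}(V)$ via $v_{n,2}$ and $R$ with $\mathbb{P}^1$, $$\mathcal{N}_{X/\mathbb{P}(\mathrm{Sym}^2 V)}|_R\cong\bigoplus_{i=1}^{\frac{n(n+1)}{2}}\mathcal{O}_{\mathbb{P}^1}(2n+2).$$
   Context: $\mathbb{P}(V)$ denotes the projective space of one-dimensional subspaces of $V$. A degree $2$ Veronese embedding is an embedding $\mathbb{P}(V)\hookrightarrow\mathbb{P}(\mathrm{Sym}^2 V)$ given by the complete linear series $|\mathcal{O}_{\mathbb{P}(V)}(2)|$ (for instance $[L]\mapsto[L^2]$ for one-dimensional subspaces $L \subset V$). $\mathcal{N}_{X/\mathbb{P}(\mathrm{Sym}^2 V)}$ is the normal bundle of $X$ in $\mathbb{P}(\mathrm{Sym}^2 V)$, viewed as a vector bundle on $\mathbb{P}(V)$ through $v_{n,2}$. A rational normal curve of degree $n$ in $\mathbb{P}(V)\cong\mathbb{P}^n$ is the image of an embedding $\mathbb{P}^1\hookrightarrow\mathbb{P}(V)$ given by the complete linear series $|\mathcal{O}_{\mathbb{P}^1}(n)|$, i.e. a curve projectively equivalent to the image of $[Z_0:Z_1]\mapsto[Z_0^n:Z_0^{n-1}Z_1:\cdots:Z_1^n]$.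 *)

theory Defs
  imports "HOL-Analysis.Analysis"
begin

section \<open>Forms and projective spaces\<close>

text \<open>
  Vector spaces over a field \<open>'k\<close> are given by their scalar multiplication, as in
  \<^locale>\<open>vector_space\<close>.
\<close>

definition linear_functional :: "('k::field \<Rightarrow> 'v::ab_group_add \<Rightarrow> 'v) \<Rightarrow> ('v \<Rightarrow> 'k) \<Rightarrow> bool" where
  "linear_functional s l \<longleftrightarrow> Vector_Spaces.linear s (*) l"

text \<open>
  Forms of degree \<open>d\<close> on a vector space, as functions: sums of products of \<open>d\<close> linear functionals.
  Over an infinite field (in particular, an algebraically closed one) a form is determined by its
  values, so that for a finite-dimensional \<open>V\<close> these are exactly the elements of
  \<open>Sym\<^sup>d V\<^sup>* = H\<^sup>0(\<P>(V), \<O>(d))\<close>.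
\<close>

inductive_set forms :: "('k::field \<Rightarrow> 'v::ab_group_add \<Rightarrow> 'v) \<Rightarrow> nat \<Rightarrow> ('v \<Rightarrow> 'k) set"
  for s :: "'k \<Rightarrow> 'v \<Rightarrow> 'v" and d :: nat where
  product: "(\<And>i. i < d \<Longrightarrow> linear_functional s (l i)) \<Longrightarrow> (\<lambda>v. c * (\<Prod>i<d. l i v)) \<in> forms s d"
| add: "F \<in> forms s d \<Longrightarrow> G \<in> forms s d \<Longrightarrow> (\<lambda>v. F v + G v) \<in> forms s d"

definition proj_points :: "('k::field \<Rightarrow> 'v::ab_group_add \<Rightarrow> 'v) \<Rightarrow> 'v set set" where
  "proj_points s = {L. module.subspace s L \<and> vector_space.dim s L = 1}"

text \<open>
  Varieties are treated classically, as spaces with functions: a Zariski topology and, for each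
  open \<open>U\<close>, the regular functions on \<open>U\<close>. Functions are total on the type of points; their
  values outside \<open>U\<close> are arbitrary and play no role.
\<close>

record ('p, 'k) variety =
  zariski :: "'p topology"
  regular :: "'p set \<Rightarrow> ('p \<Rightarrow> 'k) set"

definition zariski_proj :: "('k::field \<Rightarrow> 'v::ab_group_add \<Rightarrow> 'v) \<Rightarrow> 'v set topology" where
  "zariski_proj s = topology_generated_by
     {{L \<in> proj_points s. \<exists>w\<in>L. F w \<noteq> 0} | F d. F \<in> forms s d}"

definition proj :: "('k::field \<Rightarrow> 'v::ab_group_add \<Rightarrow> 'v) \<Rightarrow> ('v set, 'k) variety" where
  "proj s = \<lparr>
     zariski = zariski_proj s,
     regular = (\<lambda>U. {f. \<forall>p\<in>U. \<exists>U' d. \<exists>F\<in>forms s d. \<exists>G\<in>forms s d.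
        openin (zariski_proj s) U' \<and> p \<in> U' \<and> U' \<subseteq> U \<and>
        (\<forall>L\<in>U'. \<forall>w\<in>L - {0}. G w \<noteq> 0 \<and> f L = F w / G w)})\<rparr>"

definition subvariety :: "('p, 'k) variety \<Rightarrow> 'p set \<Rightarrow> ('p, 'k) variety" where
  "subvariety P X = \<lparr>
     zariski = subtopology (zariski P) X,
     regular = (\<lambda>U. {f. \<forall>p\<in>U. \<exists>V. \<exists>g\<in>regular P V.
        openin (zariski P) V \<and> p \<in> V \<and> (\<forall>q\<in>V \<inter> U. f q = g q)})\<rparr>"

definition plane_scale :: "'k::field \<Rightarrow> 'k \<times> 'k \<Rightarrow> 'k \<times> 'k" where
  "plane_scale c w = (c * fst w, c * snd w)"

abbreviation proj_line :: "(('k::field \<times> 'k) set, 'k) variety" where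
  "proj_line \<equiv> proj plane_scale"


section \<open>Vector bundles\<close>

text \<open>
  A vector bundle is given by its fibres and its regular sections over each open set. Each fibre
  is a linear subspace of a function space \<open>'a \<Rightarrow> 'k\<close>, with pointwise operations.
  As for functions, a section over \<open>U\<close> is a total function, with arbitrary values outside \<open>U\<close>.
\<close>

record ('p, 'a, 'k) vector_bundle =
  base :: "('p, 'k) variety"
  fibre :: "'p \<Rightarrow> ('a \<Rightarrow> 'k) set"
  sections :: "'p set \<Rightarrow> ('p \<Rightarrow> 'a \<Rightarrow> 'k) set"

text \<open>
  An isomorphism is a family of linear isomorphisms of the fibres under which local regular
  sections correspond to local regular sections.
\<close>

definition bundle_iso :: "('p, 'a, 'k::field) vector_bundle \<Rightarrow> ('p, 'b, 'k) vector_bundle \<Rightarrow> bool" where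
  "bundle_iso E F \<longleftrightarrow> base E = base F \<and> (\<exists>\<phi>.
     (\<forall>p\<in>topspace (zariski (base E)).
        bij_betw (\<phi> p) (fibre E p) (fibre F p) \<and>
        (\<forall>x\<in>fibre E p. \<forall>y\<in>fibre E p. \<phi> p (\<lambda>a. x a + y a) = (\<lambda>b. \<phi> p x b + \<phi> p y b)) \<and>
        (\<forall>x\<in>fibre E p. \<forall>c. \<phi> p (\<lambda>a. c * x a) = (\<lambda>b. c * \<phi> p x b))) \<and>
     (\<forall>U \<sigma>. openin (zariski (base E)) U \<and> (\<forall>p\<in>U. \<sigma> p \<in> fibre E p) \<longrightarrow>
        (\<sigma> \<in> sections E U \<longleftrightarrow> (\<lambda>p. \<phi> p (\<sigma> p)) \<in> sections F U)))"

text \<open>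
  The sections of \<open>f\<^sup>*E\<close> are locally the combinations, with regular coefficients, of sections of
  \<open>E\<close> composed with \<open>f\<close>.
\<close>

definition pullback ::
  "('q, 'k) variety \<Rightarrow> ('q \<Rightarrow> 'p) \<Rightarrow> ('p, 'a, 'k::field) vector_bundle \<Rightarrow> ('q, 'a, 'k) vector_bundle" where
  "pullback Y f E = \<lparr>
     base = Y,
     fibre = (\<lambda>q. fibre E (f q)),
     sections = (\<lambda>U. {\<sigma>. \<forall>q\<in>U. \<exists>U' V. \<exists>m::nat. \<exists>g \<tau>.
        openin (zariski Y) U' \<and> q \<in> U' \<and> U' \<subseteq> U \<and>
        openin (zariski (base E)) V \<and> f ` U' \<subseteq> V \<and>
        (\<forall>i<m. g i \<in> regular Y U' \<and> \<tau> i \<in> sections E V) \<and>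
        (\<forall>r\<in>U'. \<sigma> r = (\<lambda>a. \<Sum>i<m. g i r * \<tau> i (f r) a))})\<rparr>"

definition restrict_bundle :: "('p, 'a, 'k::field) vector_bundle \<Rightarrow> 'p set \<Rightarrow> ('p, 'a, 'k) vector_bundle" where
  "restrict_bundle E R = pullback (subvariety (base E) R) (\<lambda>p. p) E"

definition direct_sum ::
  "('p, 'k) variety \<Rightarrow> 'i set \<Rightarrow> ('i \<Rightarrow> ('p, 'a, 'k::field) vector_bundle) \<Rightarrow> ('p, 'i \<times> 'a, 'k) vector_bundle" where
  "direct_sum Y I E = \<lparr>
     base = Y,
     fibre = (\<lambda>p. {x. (\<forall>i\<in>I. (\<lambda>a. x (i, a)) \<in> fibre (E i) p) \<and> (\<forall>i. i \<notin> I \<longrightarrow> (\<forall>a. x (i, a) = 0))}),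
     sections = (\<lambda>U. {\<sigma>. (\<forall>i\<in>I. (\<lambda>p a. \<sigma> p (i, a)) \<in> sections (E i) U) \<and>
        (\<forall>p\<in>U. \<forall>i. i \<notin> I \<longrightarrow> (\<forall>a. \<sigma> p (i, a) = 0))})\<rparr>"

text \<open>
  The line bundle \<open>\<O>(d)\<close> on \<open>\<P>(V)\<close>: its fibre at \<open>L\<close> is \<open>(L\<^sup>*)\<^bsup>\<otimes>d\<^esup>\<close>, that is, the functions on
  \<open>L - {0}\<close> (extended by zero) that are homogeneous of degree \<open>d\<close>. Its sections are locally
  quotients of forms whose degrees differ by \<open>d\<close>.
\<close>

definition twist :: "('k::field \<Rightarrow> 'v::ab_group_add \<Rightarrow> 'v) \<Rightarrow> int \<Rightarrow> ('v set, 'v, 'k) vector_bundle" where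
  "twist s d = (let
      fib = (\<lambda>L. {x. (\<forall>w. w \<notin> L - {0} \<longrightarrow> x w = 0) \<and>
                    (\<forall>w\<in>L - {0}. \<forall>c. c \<noteq> 0 \<longrightarrow> x (s c w) = c powi d * x w)})
    in \<lparr>
     base = proj s,
     fibre = fib,
     sections = (\<lambda>U. {\<sigma>. (\<forall>p\<in>U. \<sigma> p \<in> fib p) \<and>
        (\<forall>p\<in>U. \<exists>U' a b. \<exists>F\<in>forms s a. \<exists>G\<in>forms s b.
           openin (zariski_proj s) U' \<and> p \<in> U' \<and> U' \<subseteq> U \<and> int a - int b = d \<and>
           (\<forall>L\<in>U'. \<forall>w\<in>L - {0}. G w \<noteq> 0 \<and> \<sigma> L w = F w / G w))})\<rparr>)"


section \<open>Normal bundles\<close>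

definition local_functions :: "('p, 'k) variety \<Rightarrow> 'p \<Rightarrow> ('p \<Rightarrow> 'k) set" where
  "local_functions P x = {f. \<exists>V. openin (zariski P) V \<and> x \<in> V \<and> f \<in> regular P V}"

definition local_ideal :: "('p, 'k::field) variety \<Rightarrow> 'p set \<Rightarrow> 'p \<Rightarrow> ('p \<Rightarrow> 'k) set" where
  "local_ideal P X x =
     {f. \<exists>V. openin (zariski P) V \<and> x \<in> V \<and> f \<in> regular P V \<and> (\<forall>y\<in>V \<inter> X. f y = 0)}"

text \<open>
  The normal bundle \<open>(\<I>/\<I>\<^sup>2)\<^sup>\<or> = \<H>om(\<I>, \<O>\<^sub>X)\<close> of a smooth closed subvariety \<open>X\<close> of \<open>P\<close> with ideal
  sheaf \<open>\<I>\<close>. The fibre at \<open>x\<close> is \<open>Hom(\<I>\<^sub>x, k(x))\<close>, the homomorphisms over the local ring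
  \<open>\<O>\<^bsub>P,x\<^esub>\<close> (these automatically vanish on \<open>\<I>\<^sub>x\<^sup>2\<close>), extended by zero to all functions. Elements of the
  stalks are represented by total functions rather than germs. This is harmless: a function
  that is 1 near \<open>x\<close> belongs to \<open>local_functions P x\<close>, so by the last condition the value of
  \<open>\<nu>\<close> depends on the germ only. A regular section is one that maps local sections of \<open>\<I>\<close> to
  regular functions on \<open>X\<close>.
\<close>

definition normal_space :: "('p, 'k::field) variety \<Rightarrow> 'p set \<Rightarrow> 'p \<Rightarrow> (('p \<Rightarrow> 'k) \<Rightarrow> 'k) set" where
  "normal_space P X x = {\<nu>.
     (\<forall>f. f \<notin> local_ideal P X x \<longrightarrow> \<nu> f = 0) \<and>
     (\<forall>f\<in>local_ideal P X x. \<forall>g\<in>local_ideal P X x. \<nu> (\<lambda>y. f y + g y) = \<nu> f + \<nu> g) \<and>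
     (\<forall>g\<in>local_functions P x. \<forall>f\<in>local_ideal P X x. \<nu> (\<lambda>y. g y * f y) = g x * \<nu> f)}"

definition normal_bundle :: "('p, 'k::field) variety \<Rightarrow> 'p set \<Rightarrow> ('p, 'p \<Rightarrow> 'k, 'k) vector_bundle" where
  "normal_bundle P X = \<lparr>
     base = subvariety P X,
     fibre = normal_space P X,
     sections = (\<lambda>U. {\<sigma>. (\<forall>x\<in>U. \<sigma> x \<in> normal_space P X x) \<and>
        (\<forall>V f. openin (zariski P) V \<and> f \<in> regular P V \<and> (\<forall>y\<in>V \<inter> X. f y = 0) \<longrightarrow>
           (\<lambda>x. \<sigma> x f) \<in> regular (subvariety P X) (U \<inter> V))})\<rparr>"


section \<open>Symmetric squares and complete linear series\<close>

text \<open>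
  \<open>S\<close> with the product \<open>m\<close> is the symmetric square of \<open>V\<close>: the universal property of
  \<open>V \<times> V \<rightarrow> Sym\<^sup>2 V\<close>. It is enough to require it for maps into the ground field,
  since the canonical linear map from the symmetric square to \<open>S\<close> is an isomorphism as soon as
  its transpose is.
\<close>

definition symmetric_bilinear ::
  "('k::field \<Rightarrow> 'v::ab_group_add \<Rightarrow> 'v) \<Rightarrow> ('k \<Rightarrow> 'w::ab_group_add \<Rightarrow> 'w) \<Rightarrow> ('v \<Rightarrow> 'v \<Rightarrow> 'w) \<Rightarrow> bool" where
  "symmetric_bilinear sV sW B \<longleftrightarrow>
     (\<forall>u. Vector_Spaces.linear sV sW (B u)) \<and> (\<forall>u v. B u v = B v u)"

definition symmetric_square ::
  "('k::field \<Rightarrow> 'v::ab_group_add \<Rightarrow> 'v) \<Rightarrow> ('k \<Rightarrow> 's::ab_group_add \<Rightarrow> 's) \<Rightarrow> ('v \<Rightarrow> 'v \<Rightarrow> 's) \<Rightarrow> bool" where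
  "symmetric_square sV sS m \<longleftrightarrow> vector_space sV \<and> vector_space sS \<and> symmetric_bilinear sV sS m \<and>
     (\<forall>B. symmetric_bilinear sV (*) B \<longrightarrow> (\<exists>!l. linear_functional sS l \<and> (\<forall>u v. B u v = l (m u v))))"

text \<open>
  The map \<open>f : \<P>(V) \<rightarrow> \<P>(W)\<close> is given by the complete linear series \<open>|\<O>(d)|\<close>: it is
  \<open>[v] \<mapsto> [q v]\<close> for some \<open>q : V \<rightarrow> W\<close> such that pulling back along \<open>q\<close> identifies
  \<open>W\<^sup>* = H\<^sup>0(\<P>(W), \<O>(1))\<close> with \<open>H\<^sup>0(\<P>(V), \<O>(d))\<close>; equivalently, the components of \<open>q\<close> in a
  basis of \<open>W\<close> form a basis of the forms of degree \<open>d\<close>.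
\<close>

definition complete_series_map ::
  "('k::field \<Rightarrow> 'v::ab_group_add \<Rightarrow> 'v) \<Rightarrow> nat \<Rightarrow> ('k \<Rightarrow> 'w::ab_group_add \<Rightarrow> 'w) \<Rightarrow>
   ('v set \<Rightarrow> 'w set) \<Rightarrow> bool" where
  "complete_series_map sV d sW f \<longleftrightarrow> (\<exists>q.
     bij_betw (\<lambda>l. l \<circ> q) {l. linear_functional sW l} (forms sV d) \<and>
     (\<forall>v. v \<noteq> 0 \<longrightarrow> f (module.span sV {v}) = module.span sW {q v}))"

end

theory Submission
  imports Defs
begin

text \<open>
  Conceptually, \<open>\<N> = Sym\<^sup>2 Q \<otimes> \<O>(2)\<close>, where \<open>Q = V / \<O>(-1)\<close>: the affine tangent space of \<open>X\<close> at \<open>[v\<^sup>2]\<close>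
  is \<open>v \<cdot> V\<close>, and \<open>Sym\<^sup>2 V / (v \<cdot> V) = Sym\<^sup>2 (V / v)\<close>. On a rational normal curve \<open>w \<mapsto> r w\<close> the space \<open>V\<close>
  is dual to the forms of degree \<open>n\<close> on the plane, with \<open>r w\<close> the evaluation at \<open>w\<close>. Hence the dual of
  \<open>Q\<close> at \<open>r w\<close> consists of the forms of degree \<open>n\<close> that vanish at \<open>w\<close>, which are the products of
  the linear form \<open>s y - t x\<close> (where \<open>w = (s, t)\<close>) with the forms of degree \<open>n - 1\<close>. A basis of the
  latter therefore trivialises \<open>Q|\<^sub>R\<close> up to a twist by \<open>\<O>(1)\<close>, and
  \<open>Sym\<^sup>2 Q \<otimes> \<O>(2)\<close> becomes a sum of copies of \<open>\<O>(2) \<otimes> \<O>(2n)\<close>, one for each unordered pair of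
  elements of the basis.

  In coordinates, let \<open>c\<^sub>0, \<dots>, c\<^sub>n\<close> be the functionals on \<open>V\<close> with \<open>c\<^sub>j (r (s, t)) = s\<^sup>j t\<^bsup>n-j\<^esup>\<close>, and
  \<open>z\<^sub>j\<^sub>k\<close> the functionals on the symmetric square with \<open>z\<^sub>j\<^sub>k (q v) = c\<^sub>j v \<cdot> c\<^sub>k v\<close>. On the chart
  \<open>z\<^sub>o\<^sub>o \<noteq> 0\<close> the ideal of \<open>X\<close> is generated by \<open>z\<^sub>j\<^sub>k / z\<^sub>o\<^sub>o - z\<^sub>o\<^sub>j z\<^sub>o\<^sub>k / z\<^sub>o\<^sub>o\<^sup>2\<close>, so that a normal vector is
  determined by its values on these functions (\<open>normal_vector_eqI\<close>). All values that are symmetric and vanish for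
  \<open>j = o\<close> or \<open>k = o\<close> occur, because directional derivatives provide normal vectors, which moreover form regular sections
  (\<open>deriv_normal_section\<close>, \<open>normal_vector_expansion\<close>). Thus everything about \<open>\<N>\<close> is expressed by
  symmetric matrices of values.

  The isomorphism pairs a normal vector at \<open>r w\<close> with the products of two of the functionals
  \<open>s c\<^sub>i - t c\<^bsub>i+1\<^esub>\<close>, which vanish at \<open>r w\<close>. The pairing does not depend on the chart
  (\<open>pairing_chart_independent\<close>) and is homogeneous in \<open>w\<close> of degree \<open>2n + 2\<close>. It is invertible, with
  an inverse that is regular on each chart of the line, because the recurrence
  \<open>y\<^sub>i = s x\<^sub>i - t x\<^bsub>i+1\<^esub>\<close> can be solved for \<open>x\<close> when \<open>x\<close> vanishes at one end
  (\<open>ann_inverse_left\<close>, \<open>ann_inverse_right\<close>).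
\<close>

section \<open>Forms\<close>

locale projective_space = vector_space s
  for s :: "'k::field_char_0 \<Rightarrow> 'v::ab_group_add \<Rightarrow> 'v"
begin

lemma linear_functional_iff:
  "linear_functional s l \<longleftrightarrow> (\<forall>x y. l (x + y) = l x + l y) \<and> (\<forall>c x. l (s c x) = c * l x)"
proof -
  have "vector_space ((*) :: 'k \<Rightarrow> 'k \<Rightarrow> 'k)"
    by unfold_locales (auto simp: algebra_simps)
  then show ?thesis
    unfolding linear_functional_def Vector_Spaces.linear_iff using vector_space_axioms by auto
qed

lemma linear_functional_zero: "linear_functional s l \<Longrightarrow> l 0 = 0"
  unfolding linear_functional_iff by (metis add_cancel_right_right)

lemma linear_functional_sum:
  "linear_functional s l \<Longrightarrow> l (sum g A) = (\<Sum>i\<in>A. l (g i))"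
  by (induction A rule: infinite_finite_induct)
    (auto simp: linear_functional_zero, auto simp: linear_functional_iff)

lemma linear_functional_combination:
  assumes l: "linear_functional s l"
  shows "l (\<Sum>i\<in>A. s (f i) (g i)) = (\<Sum>i\<in>A. f i * l (g i))"
  by (simp add: linear_functional_sum[OF l] l[unfolded linear_functional_iff])

lemma linear_functional_diff:
  assumes "linear_functional s l"
  shows "l (x - y) = l x - l y"
proof -
  have "l (x - y + y) = l (x - y) + l y"
    using assms unfolding linear_functional_iff by blast
  then show ?thesis by simp
qed

lemma linear_functional_lincomb:
  assumes "\<And>i. i \<in> A \<Longrightarrow> linear_functional s (l i)"
  shows "linear_functional s (\<lambda>v. \<Sum>i\<in>A. c i * l i v)"
proof -
  have "\<And>i. i \<in> A \<Longrightarrow> (\<forall>x y. l i (x + y) = l i x + l i y) \<and> (\<forall>c x. l i (s c x) = c * l i x)"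
    using assms linear_functional_iff by blast
  then show ?thesis
    unfolding linear_functional_iff
    by (auto simp: sum_distrib_left algebra_simps sum.distrib[symmetric] intro!: sum.cong)
qed

lemma exists_functional_nonzero:
  assumes "v \<noteq> 0"
  shows "\<exists>l. linear_functional s l \<and> l v \<noteq> 0"
proof -
  have f: "vector_space ((*) :: 'k \<Rightarrow> 'k \<Rightarrow> 'k)"
    by unfold_locales (auto simp: algebra_simps)
  interpret pr: vector_space_pair s "(*) :: 'k \<Rightarrow> 'k \<Rightarrow> 'k"
    using f vector_space_axioms by (simp add: vector_space_pair_def)
  have "independent {v}" using assms by simp
  from pr.linear_independent_extend[OF this, of "\<lambda>_. 1"] show ?thesis
    unfolding linear_functional_def by auto
qed

lemma form_zero: "(\<lambda>_. 0) \<in> forms s d"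
  using forms.product[where s = s and d = d and l = "\<lambda>_ _. 0" and c = 0]
  by (simp add: linear_functional_iff)

lemma form_const: "(\<lambda>_. c) \<in> forms s 0"
  using forms.product[where s = s and d = 0 and l = "\<lambda>_ _. 0" and c = c] by simp

lemma form_linear: "linear_functional s l \<Longrightarrow> l \<in> forms s 1"
  using forms.product[where s = s and d = 1 and l = "\<lambda>_. l" and c = 1] by simp

lemma form_scale: "F \<in> forms s d \<Longrightarrow> (\<lambda>v. c * F v) \<in> forms s d"
proof (induction F rule: forms.induct)
  case (product l a)
  from forms.product[where s = s and d = d and l = l and c = "c * a", OF product]
  show ?case by (simp add: mult.assoc)
next
  case (add F G)
  from forms.add[OF add(3,4)] show ?case by (simp add: distrib_left)
qed

lemma form_diff: "F \<in> forms s d \<Longrightarrow> G \<in> forms s d \<Longrightarrow> (\<lambda>v. F v - G v) \<in> forms s d"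
  using forms.add[OF _ form_scale[of G d "-1"]] by fastforce

lemma form_sum:
  "(\<And>i. i \<in> A \<Longrightarrow> F i \<in> forms s d) \<Longrightarrow> (\<lambda>v. \<Sum>i\<in>A. F i v) \<in> forms s d"
  by (induction A rule: infinite_finite_induct) (auto intro: form_zero forms.add)

lemma form_mult_product:
  assumes l: "\<And>i. i < a \<Longrightarrow> linear_functional s (l i)"
    and m: "\<And>i. i < b \<Longrightarrow> linear_functional s (m i)"
  shows "(\<lambda>v. (c * (\<Prod>i<a. l i v)) * (c' * (\<Prod>i<b. m i v))) \<in> forms s (a + b)"
proof -
  have "(\<Prod>i<a + b. (if i < a then l i else m (i - a)) v) = (\<Prod>i<a. l i v) * (\<Prod>i<b. m i v)" for v
    by (induction b) auto
  then have eq: "(\<lambda>v. (c * (\<Prod>i<a. l i v)) * (c' * (\<Prod>i<b. m i v)))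
      = (\<lambda>v. (c * c') * (\<Prod>i<a + b. (if i < a then l i else m (i - a)) v))"
    by (auto simp: mult_ac)
  show ?thesis
    unfolding eq by (rule forms.product) (use l m in auto)
qed

lemma form_mult:
  assumes "F \<in> forms s a" "G \<in> forms s b"
  shows "(\<lambda>v. F v * G v) \<in> forms s (a + b)"
  using assms(1)
proof (induction F rule: forms.induct)
  case (product l c)
  from assms(2) show ?case
  proof (induction G rule: forms.induct)
    case (product l' c')
    then show ?case using form_mult_product \<open>\<And>i. i < a \<Longrightarrow> linear_functional s (l i)\<close> by blast
  next
    case (add F G)
    from forms.add[OF add(3,4)] show ?case by (simp add: distrib_left)
  qed
next
  case (add F G')
  from forms.add[OF add(3,4)] show ?case by (simp add: distrib_right)
qed

lemma form_power: "F \<in> forms s a \<Longrightarrow> (\<lambda>v. F v ^ m) \<in> forms s (m * a)"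
proof (induction m)
  case 0 show ?case by (simp add: form_const)
next
  case (Suc m)
  then show ?case using form_mult[of F a "\<lambda>v. F v ^ m" "m * a"] by simp
qed

lemma form_homogeneous: "F \<in> forms s d \<Longrightarrow> F (s c v) = c ^ d * F v"
proof (induction F rule: forms.induct)
  case (product l a)
  have "(\<Prod>i<d. l i (s c v)) = (\<Prod>i<d. c * l i v)"
    using product by (intro prod.cong) (auto simp: linear_functional_iff)
  then show ?case by (simp add: prod.distrib)
qed (simp add: distrib_left)

end

lemma form_compose:
  assumes W: "projective_space sW" and V: "projective_space sV"
    and g: "\<And>l. linear_functional sV l \<Longrightarrow> (\<lambda>w. l (g w)) \<in> forms sW e"
    and F: "F \<in> forms sV d"
  shows "(\<lambda>w. F (g w)) \<in> forms sW (d * e)"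
proof -
  interpret W: projective_space sW by (rule W)
  from F show ?thesis
  proof (induction F rule: forms.induct)
    case (product l c)
    then have "(\<lambda>w. \<Prod>i<d. l i (g w)) \<in> forms sW (d * e)"
    proof (induction d)
      case 0 show ?case by (simp add: W.form_const)
    next
      case (Suc d)
      then have "(\<lambda>w. (\<Prod>i<d. l i (g w)) * l d (g w)) \<in> forms sW (d * e + e)"
        by (intro W.form_mult g) auto
      then show ?case by (simp add: add.commute)
    qed
    then show ?case by (rule W.form_scale)
  next
    case (add F G)
    from forms.add[OF add(3,4)] show ?case .
  qed
qed


section \<open>Directional derivatives of forms\<close>

context projective_space
begin

lemma form_on_line:
  assumes "F \<in> forms s d"
  shows "\<exists>P. \<forall>t. poly P t = F (b + s t a)"
  using assms
proof (induction F rule: forms.induct)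
  case (product l c)
  have "poly (smult c (\<Prod>i<d. [:l i b, l i a:])) t = c * (\<Prod>i<d. l i (b + s t a))" for t
  proof -
    have "(\<Prod>i<d. l i b + t * l i a) = (\<Prod>i<d. l i (b + s t a))"
      using product by (intro prod.cong) (auto simp: linear_functional_iff)
    then show ?thesis by (simp add: poly_prod)
  qed
  then show ?case by blast
next
  case (add F G)
  then obtain P Q where "\<forall>t. poly P t = F (b + s t a)" "\<forall>t. poly Q t = G (b + s t a)" by blast
  then have "\<forall>t. poly (P + Q) t = F (b + s t a) + G (b + s t a)" by simp
  then show ?case by blast
qed

text \<open>
  Over an infinite field the restriction of a form to a line has a well-defined polynomial, so that
  derivatives of forms make sense although forms are only functions.
\<close>

definition on_line :: "('v \<Rightarrow> 'k) \<Rightarrow> 'v \<Rightarrow> 'v \<Rightarrow> 'k poly" where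
  "on_line F a b = (THE P. \<forall>t. poly P t = F (b + s t a))"

definition dderiv :: "('v \<Rightarrow> 'k) \<Rightarrow> 'v \<Rightarrow> 'v \<Rightarrow> 'k" where
  "dderiv F a b = coeff (on_line F a b) 1"

lemma on_line_eqI: "(\<And>t. poly P t = F (b + s t a)) \<Longrightarrow> on_line F a b = P"
  unfolding on_line_def
  by (rule the_equality) (auto simp: poly_eq_poly_eq_iff[symmetric])

lemma poly_on_line: "F \<in> forms s d \<Longrightarrow> poly (on_line F a b) t = F (b + s t a)"
  using form_on_line[of F d b a] on_line_eqI[of _ F b a] by metis

lemma coeff_0_on_line: "F \<in> forms s d \<Longrightarrow> coeff (on_line F a b) 0 = F b"
  using poly_on_line[of F d a b 0] by (simp add: poly_0_coeff_0)

lemma dderiv_add: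
  assumes "F \<in> forms s d" "G \<in> forms s d"
  shows "dderiv (\<lambda>v. F v + G v) a b = dderiv F a b + dderiv G a b"
proof -
  have "on_line (\<lambda>v. F v + G v) a b = on_line F a b + on_line G a b"
    by (rule on_line_eqI) (simp add: poly_on_line[OF assms(1)] poly_on_line[OF assms(2)])
  then show ?thesis by (simp add: dderiv_def)
qed

lemma dderiv_mult:
  assumes "F \<in> forms s d" "G \<in> forms s e"
  shows "dderiv (\<lambda>v. F v * G v) a b = dderiv F a b * G b + F b * dderiv G a b"
proof -
  have "on_line (\<lambda>v. F v * G v) a b = on_line F a b * on_line G a b"
    by (rule on_line_eqI) (simp add: poly_on_line[OF assms(1)] poly_on_line[OF assms(2)])
  then show ?thesis
    by (simp add: dderiv_def coeff_mult coeff_0_on_line[OF assms(1)] coeff_0_on_line[OF assms(2)])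
qed

lemma dderiv_linear: "linear_functional s l \<Longrightarrow> dderiv l a b = l a"
proof -
  assume l: "linear_functional s l"
  have "on_line l a b = [:l b, l a:]"
    by (rule on_line_eqI) (use l in \<open>simp add: linear_functional_iff\<close>)
  then show ?thesis by (simp add: dderiv_def)
qed

lemma dderiv_const: "dderiv (\<lambda>_. c) a b = 0"
proof -
  have "on_line (\<lambda>_. c) a b = [:c:]" by (rule on_line_eqI) simp
  then show ?thesis by (simp add: dderiv_def)
qed

lemma dderiv_diff:
  assumes "F \<in> forms s d" "G \<in> forms s d"
  shows "dderiv (\<lambda>v. F v - G v) a b = dderiv F a b - dderiv G a b"
  using dderiv_add[OF assms(1) form_scale[OF assms(2), of "-1"], of a b]
    dderiv_mult[OF form_const[of "-1"] assms(2), of a b]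
  by (simp add: dderiv_const)

lemma dderiv_prod:
  fixes d :: nat
  shows "(\<And>i. i < d \<Longrightarrow> linear_functional s (m i)) \<Longrightarrow>
    dderiv (\<lambda>v. \<Prod>i<d. m i v) a b = (\<Sum>j<d. m j a * (\<Prod>i\<in>{..<d} - {j}. m i b))"
proof (induction d)
  case 0 then show ?case by (simp add: dderiv_const)
next
  case (Suc d)
  have f: "(\<lambda>v. \<Prod>i<d. m i v) \<in> forms s d"
    using forms.product[where s = s and d = d and l = m and c = 1] Suc(2) by simp
  have "(\<Prod>i\<in>{..<Suc d} - {j}. m i b) = (\<Prod>i\<in>{..<d} - {j}. m i b) * m d b" if "j < d" for j
  proof -
    have "{..<Suc d} - {j} = insert d ({..<d} - {j})" using that by auto
    then show ?thesis by (simp add: mult.commute)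
  qed
  moreover have "{..<Suc d} - {d} = {..<d}" by auto
  moreover have "dderiv (\<lambda>v. (\<Prod>i<d. m i v) * m d v) a b
      = dderiv (\<lambda>v. \<Prod>i<d. m i v) a b * m d b + (\<Prod>i<d. m i b) * m d a"
    using dderiv_mult[OF f form_linear[of "m d"]] dderiv_linear[of "m d"] Suc(2) by simp
  ultimately show ?case using Suc by (simp add: sum_distrib_left mult.assoc mult.left_commute mult.commute)
qed

text \<open>
  Differentiation lowers the degree by one; multiplying by a linear functional restores it. The
  product form of the statement also covers degree \<open>0\<close>, where the derivative vanishes.
\<close>

lemma form_linear_times_dderiv:
  assumes "F \<in> forms s d" "linear_functional s l"
  shows "(\<lambda>b. l b * dderiv F a b) \<in> forms s d"
  using assms(1)
proof (induction F rule: forms.induct)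
  case (product m c)
  have f: "(\<lambda>v. \<Prod>i<d. m i v) \<in> forms s d"
    using forms.product[where s = s and d = d and l = m and c = 1] product by simp
  have eq: "l b * dderiv (\<lambda>v. c * (\<Prod>i<d. m i v)) a b
      = (\<Sum>j<d. (c * m j a) * (\<Prod>i<d. (if i = j then l else m i) b))" for b
  proof -
    have *: "(\<Prod>i<d. (if i = j then l else m i) b) = l b * (\<Prod>i\<in>{..<d} - {j}. m i b)" if "j < d" for j
    proof -
      have "(\<Prod>i<d. (if i = j then l else m i) b)
          = l b * (\<Prod>i\<in>{..<d} - {j}. (if i = j then l else m i) b)"
        using that by (subst prod.remove[of _ j]) auto
      also have "(\<Prod>i\<in>{..<d} - {j}. (if i = j then l else m i) b) = (\<Prod>i\<in>{..<d} - {j}. m i b)"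
        by (intro prod.cong) auto
      finally show ?thesis .
    qed
    have "(\<Sum>j<d. (c * m j a) * (\<Prod>i<d. (if i = j then l else m i) b))
        = (\<Sum>j<d. (c * m j a) * (l b * (\<Prod>i\<in>{..<d} - {j}. m i b)))"
      by (intro sum.cong) (auto simp: *)
    moreover have "dderiv (\<lambda>v. c * (\<Prod>i<d. m i v)) a b = c * dderiv (\<lambda>v. \<Prod>i<d. m i v) a b"
      using dderiv_mult[OF form_const[of c] f] by (simp add: dderiv_const)
    ultimately show ?thesis
      using dderiv_prod[of d m a b] product by (simp add: sum_distrib_left mult_ac)
  qed
  show ?case
    unfolding eq by (intro form_sum forms.product) (use product assms(2) in auto)
next
  case (add F G)
  have eq: "l b * dderiv (\<lambda>v. F v + G v) a b = l b * dderiv F a b + l b * dderiv G a b" for b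
    by (simp add: dderiv_add[OF add(1,2)] distrib_left)
  show ?case unfolding eq using forms.add[OF add(3,4)] .
qed

text \<open>
  Nonempty Zariski open sets are dense: on a line through a point where \<open>H\<close> does not vanish,
  \<open>H\<close> has finitely many zeros, so a form that vanishes outside the zeros of \<open>H\<close> and outside the
  origin restricts to a polynomial with infinitely many zeros.
\<close>

lemma form_vanishes_if_vanishes_on_basic:
  assumes F: "F \<in> forms s d" and H: "H \<in> forms s e" and v: "v \<noteq> 0" "H v \<noteq> 0"
    and van: "\<And>w. w \<noteq> 0 \<Longrightarrow> H w \<noteq> 0 \<Longrightarrow> F w = 0"
  shows "F w = 0"
proof -
  let ?H = "on_line H (w - v) v" and ?F = "on_line F (w - v) v"
  have H0: "?H \<noteq> 0"
    using coeff_0_on_line[OF H, of "w - v" v] v by auto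
  have F0: "?F = 0"
  proof (rule ccontr)
    assume "?F \<noteq> 0"
    have sub: "UNIV \<subseteq> {t. poly (?H * ?F) t = 0} \<union> {t. v + s t (w - v) = 0}"
    proof
      fix t :: 'k
      show "t \<in> {t. poly (?H * ?F) t = 0} \<union> {t. v + s t (w - v) = 0}"
        using van[of "v + s t (w - v)"] by (auto simp: poly_on_line[OF F] poly_on_line[OF H])
    qed
    have fin1: "finite {t. poly (?H * ?F) t = 0}"
      using poly_roots_finite H0 \<open>?F \<noteq> 0\<close> mult_eq_0_iff by blast
    have "t = u" if t: "v + s t (w - v) = 0" and u: "v + s u (w - v) = 0" for t u
    proof -
      have "s (t - u) (w - v) = 0"
        using t u by (metis add_left_cancel cancel_comm_monoid_add_class.diff_cancel scale_left_diff_distrib)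
      moreover have "w - v \<noteq> 0" using t v by auto
      ultimately show ?thesis by simp
    qed
    then have "\<exists>u. {t. v + s t (w - v) = 0} \<subseteq> {u}" by blast
    then have "finite {t. v + s t (w - v) = 0}" by (meson finite.simps finite_subset)
    then have "finite (UNIV :: 'k set)"
      using finite_subset[OF sub] fin1 by blast
    then show False using infinite_UNIV_char_0 by blast
  qed
  have "poly ?F 1 = F (v + (w - v))" using poly_on_line[OF F] by simp
  then show ?thesis using F0 by simp
qed

end

section \<open>The Zariski topology and local quotients of forms\<close>

context projective_space
begin

definition basic :: "('v \<Rightarrow> 'k) \<Rightarrow> 'v set set" where
  "basic F = {L \<in> proj_points s. \<exists>w\<in>L. F w \<noteq> 0}"

lemma span_proj_point: "v \<noteq> 0 \<Longrightarrow> span {v} \<in> proj_points s"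
  unfolding proj_points_def using dim_eq_card_independent[of "{v}"] by simp

lemma proj_pointE:
  assumes "L \<in> proj_points s"
  obtains v where "v \<noteq> 0" "L = span {v}"
proof -
  from assms have L: "subspace L" "dim L = 1" by (auto simp: proj_points_def)
  obtain B where B: "B \<subseteq> L" "independent B" "L \<subseteq> span B" "card B = dim L"
    using basis_exists[of L] by blast
  then obtain v where v: "B = {v}" using L by (auto simp: card_1_singleton_iff)
  have "v \<noteq> 0" using B(2) v by auto
  moreover have "L = span {v}"
    using B(1,3) L(1) v span_minimal by blast
  ultimately show ?thesis using that by blast
qed

lemma nonzero_in_span:
  assumes "w \<in> span {v} - {0}"
  obtains c where "c \<noteq> 0" "w = s c v"
  using assms unfolding span_singleton by (metis DiffE imageE scale_zero_left singletonI)

lemma proj_point_eq_span: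
  assumes "L \<in> proj_points s" "w \<in> L - {0}"
  shows "L = span {w}"
proof -
  from assms(1) obtain v where v: "v \<noteq> 0" "L = span {v}" by (rule proj_pointE)
  with assms(2) obtain c where c: "c \<noteq> 0" "w = s c v" using nonzero_in_span by blast
  have "v = s (inverse c) w" using c by simp
  then have "v \<in> span {w}" by (metis span_base span_scale singletonI)
  moreover have "w \<in> span {v}" using c by (metis span_base span_scale singletonI)
  ultimately show ?thesis
    unfolding v(2) by (intro span_eq[THEN iffD2]) auto
qed

lemma in_span_self: "v \<noteq> 0 \<Longrightarrow> v \<in> span {v} - {0}"
  by (simp add: span_base)

lemma span_in_basic:
  assumes "F \<in> forms s d" "v \<noteq> 0"
  shows "span {v} \<in> basic F \<longleftrightarrow> F v \<noteq> 0"
proof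
  assume "span {v} \<in> basic F"
  then obtain c where "F (s c v) \<noteq> 0" unfolding basic_def span_singleton by auto
  then show "F v \<noteq> 0" using form_homogeneous[OF assms(1)] by auto
next
  assume "F v \<noteq> 0"
  then show "span {v} \<in> basic F"
    unfolding basic_def using span_proj_point[OF assms(2)] span_base by blast
qed

lemma form_nonzero_on_basic:
  assumes "G \<in> forms s d" "L \<in> basic G" "w \<in> L - {0}"
  shows "G w \<noteq> 0"
  using assms span_in_basic[OF assms(1), of w] proj_point_eq_span[of L w] by (auto simp: basic_def)

lemma open_basic: "F \<in> forms s d \<Longrightarrow> openin (zariski_proj s) (basic F)"
  unfolding zariski_proj_def basic_def by (rule topology_generated_by_Basis) blast

lemma topspace_zariski: "topspace (zariski_proj s) = proj_points s"
proof -
  have "{L \<in> proj_points s. \<exists>w\<in>L. (1::'k) \<noteq> 0} = proj_points s"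
    by (auto simp: proj_points_def intro: subspace_0)
  then have "proj_points s \<in> {{L \<in> proj_points s. \<exists>w\<in>L. F w \<noteq> 0} | F d. F \<in> forms s d}"
    using form_const[of 1] by (intro CollectI exI[of _ "\<lambda>_. 1"] exI[of _ 0]) simp
  then have "proj_points s \<subseteq> \<Union>{{L \<in> proj_points s. \<exists>w\<in>L. F w \<noteq> 0} | F d. F \<in> forms s d}"
    by (rule Union_upper)
  moreover have "\<Union>{{L \<in> proj_points s. \<exists>w\<in>L. F w \<noteq> 0} | F d. F \<in> forms s d} \<subseteq> proj_points s"
    by (rule Union_least) blast
  ultimately show ?thesis unfolding zariski_proj_def topology_generated_by_topspace by (rule equalityI[rotated])
qed

lemma open_imp_proj_points: "openin (zariski_proj s) U \<Longrightarrow> p \<in> U \<Longrightarrow> p \<in> proj_points s"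
  using openin_subset topspace_zariski by blast

text \<open>
  The sets \<open>basic F\<close> are closed under finite intersections, since products of forms are forms; hence
  this subbasis is a basis.
\<close>

lemma basic_neighbourhood:
  assumes "openin (zariski_proj s) U" "p \<in> U"
  shows "\<exists>F d. F \<in> forms s d \<and> p \<in> basic F \<and> basic F \<subseteq> U"
proof -
  have "generate_topology_on {{L \<in> proj_points s. \<exists>w\<in>L. F w \<noteq> 0} | F d. F \<in> forms s d} U"
    using assms(1) unfolding zariski_proj_def by (rule openin_topology_generated_by)
  then show ?thesis using assms(2)
  proof induction
    case Empty then show ?case by simp
  next
    case (Int U V)
    then obtain F d G e where F: "F \<in> forms s d" "p \<in> basic F" "basic F \<subseteq> U"
      and G: "G \<in> forms s e" "p \<in> basic G" "basic G \<subseteq> V"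
      by (meson IntE)
    have FG: "(\<lambda>v. F v * G v) \<in> forms s (d + e)" using F G form_mult by blast
    have "L \<in> basic (\<lambda>v. F v * G v) \<longleftrightarrow> L \<in> basic F \<and> L \<in> basic G" for L
    proof (cases "L \<in> proj_points s")
      case True
      then obtain v where v: "v \<noteq> 0" "L = span {v}" by (rule proj_pointE)
      show ?thesis
        unfolding v(2) span_in_basic[OF FG v(1)] span_in_basic[OF F(1) v(1)] span_in_basic[OF G(1) v(1)]
        by simp
    qed (auto simp: basic_def)
    then have "basic (\<lambda>v. F v * G v) \<subseteq> U \<inter> V" "p \<in> basic (\<lambda>v. F v * G v)" using F G by auto
    with FG show ?case by blast
  next
    case (UN K)
    then obtain U where "U \<in> K" "p \<in> U" by blast
    with UN(2)[OF this] show ?case by (meson Union_upper subset_trans)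
  next
    case (Basis U)
    then show ?case unfolding basic_def by blast
  qed
qed

text \<open>
  Regular functions and sections of \<open>\<O>(e)\<close> are handled by the same predicate: near \<open>p\<close>, the
  value of \<open>h L\<close> at every nonzero \<open>w \<in> L\<close> is a quotient of forms whose degrees differ by \<open>e\<close>.
\<close>

definition ratio_at :: "'v set \<Rightarrow> int \<Rightarrow> ('v set \<Rightarrow> 'v \<Rightarrow> 'k) \<Rightarrow> bool" where
  "ratio_at p e h \<longleftrightarrow> (\<exists>U a b. \<exists>F\<in>forms s a. \<exists>G\<in>forms s b. int a - int b = e \<and>
     openin (zariski_proj s) U \<and> p \<in> U \<and>
     (\<forall>L\<in>U. \<forall>w\<in>L - {0}. G w \<noteq> 0 \<and> h L w = F w / G w))"

lemma ratio_atI: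
  assumes "F \<in> forms s a" "G \<in> forms s b" "int a - int b = e" "openin (zariski_proj s) U" "p \<in> U"
    "\<And>L w. L \<in> U \<Longrightarrow> w \<in> L - {0} \<Longrightarrow> G w \<noteq> 0" "\<And>L w. L \<in> U \<Longrightarrow> w \<in> L - {0} \<Longrightarrow> h L w = F w / G w"
  shows "ratio_at p e h"
  unfolding ratio_at_def using assms by blast

lemma ratio_atE:
  assumes "ratio_at p e h"
  obtains U a b F G where "F \<in> forms s a" "G \<in> forms s b" "int a - int b = e"
    "openin (zariski_proj s) U" "p \<in> U"
    "\<And>L w. L \<in> U \<Longrightarrow> w \<in> L - {0} \<Longrightarrow> G w \<noteq> 0" "\<And>L w. L \<in> U \<Longrightarrow> w \<in> L - {0} \<Longrightarrow> h L w = F w / G w"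
  using assms unfolding ratio_at_def by blast

lemma ratio_at_cong:
  assumes "ratio_at p e h" "openin (zariski_proj s) V" "p \<in> V"
    and "\<And>L w. L \<in> V \<Longrightarrow> w \<in> L - {0} \<Longrightarrow> h' L w = h L w"
  shows "ratio_at p e h'"
proof -
  from assms(1) obtain U a b F G where *: "F \<in> forms s a" "G \<in> forms s b" "int a - int b = e"
    "openin (zariski_proj s) U" "p \<in> U"
    "\<And>L w. L \<in> U \<Longrightarrow> w \<in> L - {0} \<Longrightarrow> G w \<noteq> 0" "\<And>L w. L \<in> U \<Longrightarrow> w \<in> L - {0} \<Longrightarrow> h L w = F w / G w"
    by (rule ratio_atE) blast
  show ?thesis
    by (rule ratio_atI[OF *(1-3), of "U \<inter> V"]) (use * assms in auto)
qed

lemma ratio_at_form: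
  assumes "F \<in> forms s d" "p \<in> proj_points s"
  shows "ratio_at p (int d) (\<lambda>_. F)"
proof -
  have "openin (zariski_proj s) (proj_points s)"
    using openin_topspace[of "zariski_proj s"] topspace_zariski by simp
  then show ?thesis
    using ratio_atI[OF assms(1) form_const[of 1], of "int d" "proj_points s" p "\<lambda>_. F"] assms(2) by simp
qed

lemma ratio_at_zero:
  assumes "p \<in> proj_points s"
  shows "ratio_at p e (\<lambda>_ _. 0)"
proof -
  have "openin (zariski_proj s) (proj_points s)"
    using openin_topspace[of "zariski_proj s"] topspace_zariski by simp
  moreover have "p \<in> basic (\<lambda>_. 1)"
    using assms by (auto elim!: proj_pointE simp: span_in_basic[OF form_const])
  moreover obtain v where "v \<noteq> 0" "p = span {v}" using assms by (rule proj_pointE)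
  moreover obtain l where "linear_functional s l" "l v \<noteq> 0"
    using exists_functional_nonzero \<open>v \<noteq> 0\<close> by blast
  ultimately have l: "(\<lambda>w. l w ^ nat (- e)) \<in> forms s (nat (- e))" "p \<in> basic (\<lambda>w. l w ^ nat (- e))"
    using form_power[OF form_linear, of l "nat (- e)"] span_in_basic[of "\<lambda>w. l w ^ nat (- e)" "nat (- e)" v]
    by auto
  note nz = form_nonzero_on_basic[OF l(1)]
  show ?thesis
    by (rule ratio_atI[OF form_zero[of "nat e"] l(1) _ open_basic[OF l(1)] l(2)]) (use nz in auto)
qed

lemma ratio_at_one: "p \<in> proj_points s \<Longrightarrow> ratio_at p 0 (\<lambda>_ _. c)"
  using ratio_at_form[OF form_const[of c]] by simp

lemma ratio_at_mult:
  assumes "ratio_at p d h" "ratio_at p e k"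
  shows "ratio_at p (d + e) (\<lambda>L w. h L w * k L w)"
proof -
  from assms(1) obtain U a b F G where 1: "F \<in> forms s a" "G \<in> forms s b" "int a - int b = d"
    "openin (zariski_proj s) U" "p \<in> U"
    "\<And>L w. L \<in> U \<Longrightarrow> w \<in> L - {0} \<Longrightarrow> G w \<noteq> 0" "\<And>L w. L \<in> U \<Longrightarrow> w \<in> L - {0} \<Longrightarrow> h L w = F w / G w"
    by (rule ratio_atE) blast
  from assms(2) obtain U' a' b' F' G' where 2: "F' \<in> forms s a'" "G' \<in> forms s b'" "int a' - int b' = e"
    "openin (zariski_proj s) U'" "p \<in> U'"
    "\<And>L w. L \<in> U' \<Longrightarrow> w \<in> L - {0} \<Longrightarrow> G' w \<noteq> 0" "\<And>L w. L \<in> U' \<Longrightarrow> w \<in> L - {0} \<Longrightarrow> k L w = F' w / G' w"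
    by (rule ratio_atE) blast
  show ?thesis
    by (rule ratio_atI[OF form_mult[OF 1(1) 2(1)] form_mult[OF 1(2) 2(2)], of _ "U \<inter> U'"])
      (use 1 2 in auto)
qed

lemma ratio_at_add:
  assumes "ratio_at p e h" "ratio_at p e k"
  shows "ratio_at p e (\<lambda>L w. h L w + k L w)"
proof -
  from assms(1) obtain U a b F G where 1: "F \<in> forms s a" "G \<in> forms s b" "int a - int b = e"
    "openin (zariski_proj s) U" "p \<in> U"
    "\<And>L w. L \<in> U \<Longrightarrow> w \<in> L - {0} \<Longrightarrow> G w \<noteq> 0" "\<And>L w. L \<in> U \<Longrightarrow> w \<in> L - {0} \<Longrightarrow> h L w = F w / G w"
    by (rule ratio_atE) blast
  from assms(2) obtain U' a' b' F' G' where 2: "F' \<in> forms s a'" "G' \<in> forms s b'" "int a' - int b' = e"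
    "openin (zariski_proj s) U'" "p \<in> U'"
    "\<And>L w. L \<in> U' \<Longrightarrow> w \<in> L - {0} \<Longrightarrow> G' w \<noteq> 0" "\<And>L w. L \<in> U' \<Longrightarrow> w \<in> L - {0} \<Longrightarrow> k L w = F' w / G' w"
    by (rule ratio_atE) blast
  have deg: "a' + b = a + b'" using 1(3) 2(3) by linarith
  have num: "(\<lambda>w. F w * G' w + F' w * G w) \<in> forms s (a + b')"
    using form_mult[OF 1(1) 2(2)] form_mult[OF 2(1) 1(2)] unfolding deg by (rule forms.add)
  have gz: "G w \<noteq> 0 \<and> G' w \<noteq> 0 \<and> h L w + k L w = (F w * G' w + F' w * G w) / (G w * G' w)"
    if "L \<in> U \<inter> U'" "w \<in> L - {0}" for L w
    using 1(6,7)[of L w] 2(6,7)[of L w] that by (simp add: add_frac_eq mult.commute)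
  show ?thesis
    by (rule ratio_atI[OF num form_mult[OF 1(2) 2(2)], of _ "U \<inter> U'"])
      (use 1(3,4,5) 2(3,4,5) gz in auto)
qed

lemma ratio_at_sum:
  assumes "p \<in> proj_points s" "\<And>i. i \<in> A \<Longrightarrow> ratio_at p e (h i)"
  shows "ratio_at p e (\<lambda>L w. \<Sum>i\<in>A. h i L w)"
  using assms(2)
  by (induction A rule: infinite_finite_induct) (auto simp: ratio_at_zero[OF assms(1)] ratio_at_add)

lemma ratio_at_inverse_form:
  assumes "F \<in> forms s d" "v \<noteq> 0" "F v \<noteq> 0"
  shows "ratio_at (span {v}) (- int d) (\<lambda>_ w. 1 / F w)"
proof (rule ratio_atI[OF form_const[of 1] assms(1) _ open_basic[OF assms(1)]])
  show "span {v} \<in> basic F" using span_in_basic assms by blast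
  show "F w \<noteq> 0" if "L \<in> basic F" "w \<in> L - {0}" for L w
    using form_nonzero_on_basic[OF assms(1) that] .
qed auto

lemma ratio_at_point: "ratio_at p e h \<Longrightarrow> p \<in> proj_points s"
  by (erule ratio_atE) (rule open_imp_proj_points)

lemma ratio_at_minus: "ratio_at p e h \<Longrightarrow> ratio_at p e (\<lambda>L w. - h L w)"
  using ratio_at_mult[OF ratio_at_one[of p "-1"], of e h] ratio_at_point[of p e h] by simp

lemma ratio_at_open:
  assumes "ratio_at p e h"
  shows "\<exists>U. openin (zariski_proj s) U \<and> p \<in> U \<and> (\<forall>q\<in>U. ratio_at q e h)"
proof -
  from assms obtain U a b F G where 1: "F \<in> forms s a" "G \<in> forms s b" "int a - int b = e"
    "openin (zariski_proj s) U" "p \<in> U"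
    "\<And>L w. L \<in> U \<Longrightarrow> w \<in> L - {0} \<Longrightarrow> G w \<noteq> 0" "\<And>L w. L \<in> U \<Longrightarrow> w \<in> L - {0} \<Longrightarrow> h L w = F w / G w"
    by (rule ratio_atE) blast
  have "ratio_at q e h" if "q \<in> U" for q
    by (rule ratio_atI[OF 1(1-4) that 1(6,7)])
  then show ?thesis using 1(4,5) by blast
qed

lemma regular_proj_iff:
  assumes "openin (zariski_proj s) U"
  shows "f \<in> regular (proj s) U \<longleftrightarrow> (\<forall>p\<in>U. ratio_at p 0 (\<lambda>L _. f L))"
proof
  assume *: "f \<in> regular (proj s) U"
  show "\<forall>p\<in>U. ratio_at p 0 (\<lambda>L _. f L)"
  proof
    fix p assume "p \<in> U"
    have "\<forall>p\<in>U. \<exists>U' d. \<exists>F\<in>forms s d. \<exists>G\<in>forms s d. openin (zariski_proj s) U' \<and> p \<in> U' \<and> U' \<subseteq> U \<and>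
        (\<forall>L\<in>U'. \<forall>w\<in>L - {0}. G w \<noteq> 0 \<and> f L = F w / G w)"
      using * unfolding proj_def variety.simps mem_Collect_eq .
    from bspec[OF this \<open>p \<in> U\<close>] obtain U' d F G
      where "F \<in> forms s d" "G \<in> forms s d" "openin (zariski_proj s) U'" "p \<in> U'"
      "\<forall>L\<in>U'. \<forall>w\<in>L - {0}. G w \<noteq> 0 \<and> f L = F w / G w"
      by (elim exE bexE conjE)
    then show "ratio_at p 0 (\<lambda>L _. f L)"
      unfolding ratio_at_def by (intro exI[of _ U'] exI[of _ d] bexI[of _ F] bexI[of _ G]) simp_all
  qed
next
  assume *: "\<forall>p\<in>U. ratio_at p 0 (\<lambda>L _. f L)"
  have "\<exists>U' d. \<exists>F\<in>forms s d. \<exists>G\<in>forms s d. openin (zariski_proj s) U' \<and> p \<in> U' \<and> U' \<subseteq> U \<and>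
        (\<forall>L\<in>U'. \<forall>w\<in>L - {0}. G w \<noteq> 0 \<and> f L = F w / G w)" if "p \<in> U" for p
  proof -
    from * that have "ratio_at p 0 (\<lambda>L _. f L)" by simp
    then obtain U' a b F G where 1: "F \<in> forms s a" "G \<in> forms s b" "int a - int b = 0"
      "openin (zariski_proj s) U'" "p \<in> U'"
      "\<And>L w. L \<in> U' \<Longrightarrow> w \<in> L - {0} \<Longrightarrow> G w \<noteq> 0" "\<And>L w. L \<in> U' \<Longrightarrow> w \<in> L - {0} \<Longrightarrow> f L = F w / G w"
      by (rule ratio_atE) blast
    have "b = a" using 1(3) by simp
    then have G: "G \<in> forms s a" using 1(2) by simp
    have "openin (zariski_proj s) (U' \<inter> U)" using 1(4) assms by blast
    then show ?thesis
      using 1(1,5,6,7) G that by (intro exI[of _ "U' \<inter> U"] exI[of _ a] bexI[of _ F] bexI[of _ G]) auto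
  qed
  then show "f \<in> regular (proj s) U" unfolding proj_def variety.simps mem_Collect_eq by blast
qed

lemma zariski_of_proj [simp]: "zariski (proj s) = zariski_proj s"
  by (simp add: proj_def)

lemma local_functions_iff:
  "f \<in> local_functions (proj s) x \<longleftrightarrow> ratio_at x 0 (\<lambda>L _. f L)"
proof
  assume "f \<in> local_functions (proj s) x"
  then show "ratio_at x 0 (\<lambda>L _. f L)"
    unfolding local_functions_def by (auto simp: regular_proj_iff)
next
  assume "ratio_at x 0 (\<lambda>L _. f L)"
  from ratio_at_open[OF this] show "f \<in> local_functions (proj s) x"
    unfolding local_functions_def by (auto simp: regular_proj_iff)
qed

lemma local_ideal_iff:
  "f \<in> local_ideal (proj s) X x \<longleftrightarrow> ratio_at x 0 (\<lambda>L _. f L) \<and>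
     (\<exists>V. openin (zariski_proj s) V \<and> x \<in> V \<and> (\<forall>y\<in>V \<inter> X. f y = 0))"
proof
  assume "f \<in> local_ideal (proj s) X x"
  then obtain V where V: "openin (zariski_proj s) V" "x \<in> V" "f \<in> regular (proj s) V" "\<forall>y\<in>V \<inter> X. f y = 0"
    unfolding local_ideal_def by auto
  have "ratio_at x 0 (\<lambda>L _. f L)" using V(2,3) regular_proj_iff[OF V(1)] by blast
  then show "ratio_at x 0 (\<lambda>L _. f L) \<and>
     (\<exists>V. openin (zariski_proj s) V \<and> x \<in> V \<and> (\<forall>y\<in>V \<inter> X. f y = 0))"
    using V by blast
next
  assume *: "ratio_at x 0 (\<lambda>L _. f L) \<and>
     (\<exists>V. openin (zariski_proj s) V \<and> x \<in> V \<and> (\<forall>y\<in>V \<inter> X. f y = 0))"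
  then obtain V where V: "openin (zariski_proj s) V" "x \<in> V" "\<forall>y\<in>V \<inter> X. f y = 0" by blast
  from ratio_at_open[OF conjunct1[OF *]] obtain U where U: "openin (zariski_proj s) U" "x \<in> U"
    "\<forall>q\<in>U. ratio_at q 0 (\<lambda>L _. f L)" by blast
  have "openin (zariski_proj s) (U \<inter> V)" using U V by blast
  then have "f \<in> regular (proj s) (U \<inter> V)" using U(3) regular_proj_iff[of "U \<inter> V" f] by blast
  then show "f \<in> local_ideal (proj s) X x"
    unfolding local_ideal_def using \<open>openin (zariski_proj s) (U \<inter> V)\<close> U(2) V(2,3)
    by (auto intro!: exI[of _ "U \<inter> V"])
qed

lemma sections_twist_iff:
  assumes "openin (zariski_proj s) U"
  shows "\<sigma> \<in> sections (twist s d) U \<longleftrightarrow>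
    (\<forall>p\<in>U. \<sigma> p \<in> fibre (twist s d) p) \<and> (\<forall>p\<in>U. ratio_at p d \<sigma>)"
proof -
  have "(\<exists>U' a b. \<exists>F\<in>forms s a. \<exists>G\<in>forms s b.
           openin (zariski_proj s) U' \<and> p \<in> U' \<and> U' \<subseteq> U \<and> int a - int b = d \<and>
           (\<forall>L\<in>U'. \<forall>w\<in>L - {0}. G w \<noteq> 0 \<and> \<sigma> L w = F w / G w)) \<longleftrightarrow> ratio_at p d \<sigma>" (is "?l \<longleftrightarrow> ?r")
    if "p \<in> U" for p
  proof
    show "?l \<Longrightarrow> ?r" unfolding ratio_at_def by blast
    assume ?r
    then obtain U' a b F G where 1: "F \<in> forms s a" "G \<in> forms s b" "int a - int b = d"
      "openin (zariski_proj s) U'" "p \<in> U'"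
      "\<And>L w. L \<in> U' \<Longrightarrow> w \<in> L - {0} \<Longrightarrow> G w \<noteq> 0" "\<And>L w. L \<in> U' \<Longrightarrow> w \<in> L - {0} \<Longrightarrow> \<sigma> L w = F w / G w"
      by (rule ratio_atE) blast
    have "openin (zariski_proj s) (U' \<inter> U)" using 1(4) assms by blast
    then show ?l
      using 1 that
      by (intro exI[of _ "U' \<inter> U"] exI[of _ a] exI[of _ b] bexI[of _ F] bexI[of _ G]) auto
  qed
  then show ?thesis by (simp add: twist_def Let_def)
qed

end

section \<open>Normal vectors from directional derivatives\<close>

context projective_space
begin

text \<open>
  For forms of equal degree the choice of the representative is immaterial, by homogeneity.
\<close>

definition quotient_fn :: "('v \<Rightarrow> 'k) \<Rightarrow> ('v \<Rightarrow> 'k) \<Rightarrow> 'v set \<Rightarrow> 'k" where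
  "quotient_fn F G L = (let w = (SOME w. w \<in> L - {0}) in F w / G w)"

lemma quotient_fn_eq:
  assumes "F \<in> forms s d" "G \<in> forms s d" "L \<in> proj_points s" "w \<in> L - {0}"
  shows "quotient_fn F G L = F w / G w"
proof -
  define w' where "w' = (SOME w. w \<in> L - {0})"
  have "w' \<in> L - {0}" unfolding w'_def using assms(4) by (rule someI)
  then obtain c where "c \<noteq> 0" "w' = s c w"
    using proj_point_eq_span[OF assms(3,4)] nonzero_in_span by metis
  then show ?thesis
    unfolding quotient_fn_def Let_def w'_def[symmetric]
    using form_homogeneous[OF assms(1)] form_homogeneous[OF assms(2)] by simp
qed

lemma ratio_at_quotient_fn:
  assumes "F \<in> forms s d" "G \<in> forms s d" "p \<in> basic G"
  shows "ratio_at p 0 (\<lambda>L _. quotient_fn F G L)"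
proof (rule ratio_atI[OF assms(1,2) _ open_basic[OF assms(2)] assms(3)])
  show "G w \<noteq> 0" if "L \<in> basic G" "w \<in> L - {0}" for L w
    using form_nonzero_on_basic[OF assms(2) that] .
  show "quotient_fn F G L = F w / G w" if "L \<in> basic G" "w \<in> L - {0}" for L w
    using that quotient_fn_eq[OF assms(1,2)] by (auto simp: basic_def)
qed simp

lemma local_ideal_zero_at: "f \<in> local_ideal (proj s) X x \<Longrightarrow> x \<in> X \<Longrightarrow> f x = 0"
  unfolding local_ideal_iff by blast

lemma local_ideal_add:
  assumes "f \<in> local_ideal (proj s) X x" "g \<in> local_ideal (proj s) X x"
  shows "(\<lambda>y. f y + g y) \<in> local_ideal (proj s) X x"
proof -
  from assms obtain V W where "openin (zariski_proj s) V" "x \<in> V" "\<forall>y\<in>V \<inter> X. f y = 0"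
    "openin (zariski_proj s) W" "x \<in> W" "\<forall>y\<in>W \<inter> X. g y = 0"
    unfolding local_ideal_iff by blast
  then have "openin (zariski_proj s) (V \<inter> W) \<and> x \<in> V \<inter> W \<and> (\<forall>y\<in>(V \<inter> W) \<inter> X. f y + g y = 0)"
    by auto
  then show ?thesis
    using ratio_at_add[of x 0 "\<lambda>L _. f L" "\<lambda>L _. g L"] assms unfolding local_ideal_iff by blast
qed

lemma local_ideal_mult:
  assumes "g \<in> local_functions (proj s) x" "f \<in> local_ideal (proj s) X x"
  shows "(\<lambda>y. g y * f y) \<in> local_ideal (proj s) X x"
proof -
  from assms obtain V where "openin (zariski_proj s) V" "x \<in> V" "\<forall>y\<in>V \<inter> X. f y = 0"
    unfolding local_ideal_iff by blast
  then have "openin (zariski_proj s) V \<and> x \<in> V \<and> (\<forall>y\<in>V \<inter> X. g y * f y = 0)"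
    by auto
  then show ?thesis
    using ratio_at_mult[of x 0 "\<lambda>L _. g L" 0 "\<lambda>L _. f L"] assms
    unfolding local_ideal_iff local_functions_iff by auto
qed

lemma local_ideal_zero: "x \<in> proj_points s \<Longrightarrow> (\<lambda>_. 0) \<in> local_ideal (proj s) X x"
  unfolding local_ideal_iff using ratio_at_zero[of x 0] openin_topspace[of "zariski_proj s"]
  by (auto simp: topspace_zariski)

lemma local_ideal_sum:
  assumes "x \<in> proj_points s" "\<And>i. i \<in> A \<Longrightarrow> f i \<in> local_ideal (proj s) X x"
  shows "(\<lambda>y. \<Sum>i\<in>A. f i y) \<in> local_ideal (proj s) X x"
  using assms(2)
  by (induction A rule: infinite_finite_induct) (auto simp: local_ideal_zero[OF assms(1)] local_ideal_add)

lemma normal_space_add: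
  "\<nu> \<in> normal_space P X x \<Longrightarrow> f \<in> local_ideal P X x \<Longrightarrow> g \<in> local_ideal P X x \<Longrightarrow>
    \<nu> (\<lambda>y. f y + g y) = \<nu> f + \<nu> g"
  unfolding normal_space_def by blast

lemma normal_space_mult:
  "\<nu> \<in> normal_space P X x \<Longrightarrow> g \<in> local_functions P x \<Longrightarrow> f \<in> local_ideal P X x \<Longrightarrow>
    \<nu> (\<lambda>y. g y * f y) = g x * \<nu> f"
  unfolding normal_space_def by blast

lemma normal_space_zero:
  assumes "\<nu> \<in> normal_space (proj s) X x" "x \<in> proj_points s"
  shows "\<nu> (\<lambda>_. 0) = 0"
  using normal_space_add[OF assms(1) local_ideal_zero[OF assms(2)] local_ideal_zero[OF assms(2)]] by simp

lemma normal_space_sum: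
  assumes "\<nu> \<in> normal_space (proj s) X x" "x \<in> proj_points s"
    and "\<And>i. i \<in> A \<Longrightarrow> f i \<in> local_ideal (proj s) X x"
  shows "\<nu> (\<lambda>y. \<Sum>i\<in>A. f i y) = (\<Sum>i\<in>A. \<nu> (f i))"
  using assms(3)
proof (induction A rule: infinite_finite_induct)
  case (insert i A)
  then have "\<nu> (\<lambda>y. f i y + (\<Sum>i\<in>A. f i y)) = \<nu> (f i) + \<nu> (\<lambda>y. \<Sum>i\<in>A. f i y)"
    by (intro normal_space_add[OF assms(1)] local_ideal_sum assms(2)) auto
  with insert show ?case by simp
qed (auto simp: normal_space_zero[OF assms(1,2)])

lemma normal_space_lincomb:
  assumes "\<And>i. i \<in> A \<Longrightarrow> \<nu> i \<in> normal_space P X x"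
  shows "(\<lambda>f. \<Sum>i\<in>A. c i * \<nu> i f) \<in> normal_space P X x"
proof -
  have n: "f \<notin> local_ideal P X x \<Longrightarrow> \<nu> i f = 0"
    "f \<in> local_ideal P X x \<Longrightarrow> g \<in> local_ideal P X x \<Longrightarrow> \<nu> i (\<lambda>y. f y + g y) = \<nu> i f + \<nu> i g"
    "h \<in> local_functions P x \<Longrightarrow> f \<in> local_ideal P X x \<Longrightarrow> \<nu> i (\<lambda>y. h y * f y) = h x * \<nu> i f"
    if "i \<in> A" for i f g h
    using assms[OF that] unfolding normal_space_def by blast+
  show ?thesis
    unfolding normal_space_def
    by (auto simp: n sum.distrib[symmetric] algebra_simps sum_distrib_left intro!: sum.cong)
qed

text \<open>
  A normal vector depends on germs only: multiply by the function that is \<open>1\<close> on a neighbourhood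
  on which the two functions agree and \<open>0\<close> elsewhere.
\<close>

lemma normal_space_germ:
  assumes nu: "\<nu> \<in> normal_space (proj s) X x" and f: "f \<in> local_ideal (proj s) X x"
    and g: "g \<in> local_ideal (proj s) X x"
    and U: "openin (zariski_proj s) U" "x \<in> U" "\<And>y. y \<in> U \<Longrightarrow> f y = g y"
  shows "\<nu> f = \<nu> g"
proof -
  define u :: "'v set \<Rightarrow> 'k" where "u y = (if y \<in> U then 1 else 0)" for y
  have "x \<in> proj_points s" using U open_imp_proj_points by blast
  then have chi: "u \<in> local_functions (proj s) x"
    unfolding local_functions_iff
    by (intro ratio_at_cong[OF ratio_at_one[of x 1] U(1,2)]) (auto simp: u_def)
  have "(\<lambda>y. u y * f y) = (\<lambda>y. u y * g y)" using U(3) by (auto simp: u_def)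
  moreover have "u x = 1" using U(2) by (simp add: u_def)
  ultimately show ?thesis
    using normal_space_mult[OF nu chi f] normal_space_mult[OF nu chi g] by simp
qed

text \<open>
  The normal vector at \<open>x\<close> induced by the direction \<open>a\<close>: a function \<open>F / G\<close> of the ideal is sent to
  its derivative along \<open>a\<close> at a representative \<open>b\<close> of \<open>x\<close>, which is \<open>\<partial>\<^sub>a F (b) / G b\<close> because
  \<open>F b = 0\<close>. The factor \<open>l b\<close> makes the result independent of the representative.
\<close>

definition deriv_normal :: "'v set set \<Rightarrow> ('v \<Rightarrow> 'k) \<Rightarrow> 'v \<Rightarrow> 'v set \<Rightarrow> ('v set \<Rightarrow> 'k) \<Rightarrow> 'k" where
  "deriv_normal X l a x f = (if f \<in> local_ideal (proj s) X x then
     (THE y. \<exists>d. \<exists>F\<in>forms s d. \<exists>G\<in>forms s d. \<exists>U. openin (zariski_proj s) U \<and> x \<in> U \<and>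
        (\<forall>L\<in>U. \<forall>w\<in>L - {0}. G w \<noteq> 0 \<and> f L = F w / G w) \<and>
        (\<forall>b\<in>x - {0}. y = l b * dderiv F a b / G b)) else 0)"

text \<open>
  If \<open>F / G = F' / G'\<close> near \<open>x\<close>, then the form \<open>F G' - F' G\<close> vanishes on a nonempty open set, hence
  everywhere, and its derivative at a zero of \<open>F\<close> and \<open>F'\<close> gives the claim.
\<close>

lemma quotient_dderiv_unique:
  assumes F: "F \<in> forms s d" "G \<in> forms s d" "F' \<in> forms s d'" "G' \<in> forms s d'"
    and U: "openin (zariski_proj s) U" "x \<in> U"
    and q: "\<And>L w. L \<in> U \<Longrightarrow> w \<in> L - {0} \<Longrightarrow> G w \<noteq> 0 \<and> f L = F w / G w"
    and U': "openin (zariski_proj s) U'" "x \<in> U'"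
    and q': "\<And>L w. L \<in> U' \<Longrightarrow> w \<in> L - {0} \<Longrightarrow> G' w \<noteq> 0 \<and> f L = F' w / G' w"
    and b: "b \<in> x - {0}" and f0: "f x = 0"
  shows "dderiv F a b / G b = dderiv F' a b / G' b"
proof -
  have "openin (zariski_proj s) (U \<inter> U')" "x \<in> U \<inter> U'" using U U' by auto
  then obtain H e where H: "H \<in> forms s e" "x \<in> basic H" "basic H \<subseteq> U \<inter> U'"
    using basic_neighbourhood by blast
  have f: "(\<lambda>w. F w * G' w) \<in> forms s (d + d')" using form_mult F by blast
  have "(\<lambda>w. F' w * G w) \<in> forms s (d' + d)" using form_mult F by blast
  then have g: "(\<lambda>w. F' w * G w) \<in> forms s (d + d')" by (simp add: add.commute)
  have "(\<lambda>w. F w * G' w - F' w * G w) \<in> forms s (d + d')"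
    by (rule form_diff[OF f g])
  moreover have "F w * G' w - F' w * G w = 0" if "w \<noteq> 0" "H w \<noteq> 0" for w
  proof -
    have "span {w} \<in> U \<inter> U'" using span_in_basic[OF H(1) that(1)] that H(3) by blast
    then show ?thesis
      using q[of "span {w}" w] q'[of "span {w}" w] in_span_self[OF that(1)] by (simp add: field_simps)
  qed
  moreover have "b \<noteq> 0" "H b \<noteq> 0" using b form_nonzero_on_basic[OF H(1,2)] by auto
  ultimately have "F w * G' w - F' w * G w = 0" for w
    using form_vanishes_if_vanishes_on_basic[OF _ H(1)] by blast
  then have "(\<lambda>w. F w * G' w) = (\<lambda>w. F' w * G w)" by simp
  then have "dderiv F a b * G' b + F b * dderiv G' a b = dderiv F' a b * G b + F' b * dderiv G a b"
    using dderiv_mult[OF F(1,4), of a b] dderiv_mult[OF F(3,2), of a b] by simp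
  moreover have "F b = 0" "F' b = 0" "G b \<noteq> 0" "G' b \<noteq> 0"
    using q[OF U(2) b] q'[OF U'(2) b] f0 by auto
  ultimately show ?thesis by (simp add: field_simps)
qed

lemma deriv_normal_eq:
  assumes f: "f \<in> local_ideal (proj s) X x" and x: "x \<in> X" and l: "linear_functional s l"
    and F: "F \<in> forms s d" "G \<in> forms s d" and U: "openin (zariski_proj s) U" "x \<in> U"
    and q: "\<And>L w. L \<in> U \<Longrightarrow> w \<in> L - {0} \<Longrightarrow> G w \<noteq> 0 \<and> f L = F w / G w"
    and b: "b \<in> x - {0}"
  shows "deriv_normal X l a x f = l b * dderiv F a b / G b"
proof -
  have xp: "x \<in> proj_points s" using U open_imp_proj_points by blast
  have "(THE y. \<exists>d. \<exists>F\<in>forms s d. \<exists>G\<in>forms s d. \<exists>U. openin (zariski_proj s) U \<and> x \<in> U \<and>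
        (\<forall>L\<in>U. \<forall>w\<in>L - {0}. G w \<noteq> 0 \<and> f L = F w / G w) \<and>
        (\<forall>b\<in>x - {0}. y = l b * dderiv F a b / G b)) = l b * dderiv F a b / G b"
  proof (rule the_equality)
    have "l b * dderiv F a b / G b = l b' * dderiv F a b' / G b'" if "b' \<in> x - {0}" for b'
      using quotient_fn_eq[OF form_linear_times_dderiv[OF F(1) l] F(2) xp b]
        quotient_fn_eq[OF form_linear_times_dderiv[OF F(1) l] F(2) xp that] by simp
    then show "\<exists>d. \<exists>F'\<in>forms s d. \<exists>G'\<in>forms s d. \<exists>U. openin (zariski_proj s) U \<and> x \<in> U \<and>
        (\<forall>L\<in>U. \<forall>w\<in>L - {0}. G' w \<noteq> 0 \<and> f L = F' w / G' w) \<and>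
        (\<forall>b'\<in>x - {0}. l b * dderiv F a b / G b = l b' * dderiv F' a b' / G' b')"
      using F U q by (intro exI[of _ d] bexI[of _ F] bexI[of _ G] exI[of _ U]) auto
  next
    fix y
    assume "\<exists>d. \<exists>F\<in>forms s d. \<exists>G\<in>forms s d. \<exists>U. openin (zariski_proj s) U \<and> x \<in> U \<and>
        (\<forall>L\<in>U. \<forall>w\<in>L - {0}. G w \<noteq> 0 \<and> f L = F w / G w) \<and>
        (\<forall>b\<in>x - {0}. y = l b * dderiv F a b / G b)"
    then obtain d' F' G' U' where 1: "F' \<in> forms s d'" "G' \<in> forms s d'" "openin (zariski_proj s) U'" "x \<in> U'"
      "\<forall>L\<in>U'. \<forall>w\<in>L - {0}. G' w \<noteq> 0 \<and> f L = F' w / G' w"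
      "\<forall>b\<in>x - {0}. y = l b * dderiv F' a b / G' b" by (elim exE bexE conjE)
    have "dderiv F a b / G b = dderiv F' a b / G' b"
      by (rule quotient_dderiv_unique[where f = f, OF F 1(1,2) U _ 1(3,4) _ b local_ideal_zero_at[OF f x]])
        (use q 1(5) in auto)
    then show "y = l b * dderiv F a b / G b" using 1(6) b by (metis times_divide_eq_right)
  qed
  then show ?thesis using f by (simp add: deriv_normal_def)
qed

lemma local_function_quotient:
  assumes "ratio_at x 0 (\<lambda>L _. f L)"
  obtains d F G U where "F \<in> forms s d" "G \<in> forms s d" "openin (zariski_proj s) U" "x \<in> U"
    "\<And>L w. L \<in> U \<Longrightarrow> w \<in> L - {0} \<Longrightarrow> G w \<noteq> 0 \<and> f L = F w / G w"
proof -
  from assms obtain U a b F G where 1: "F \<in> forms s a" "G \<in> forms s b" "int a - int b = 0"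
      "openin (zariski_proj s) U" "x \<in> U"
      "\<And>L w. L \<in> U \<Longrightarrow> w \<in> L - {0} \<Longrightarrow> G w \<noteq> 0" "\<And>L w. L \<in> U \<Longrightarrow> w \<in> L - {0} \<Longrightarrow> f L = F w / G w"
    by (rule ratio_atE) blast
  moreover have "b = a" using 1(3) by simp
  ultimately show ?thesis using that[of F a G U] by simp
qed

lemma deriv_normal_in_normal_space:
  assumes x: "x \<in> X" "x \<in> proj_points s" and l: "linear_functional s l"
  shows "deriv_normal X l a x \<in> normal_space (proj s) X x"
proof -
  from x(2) obtain b where "b \<noteq> 0" "x = span {b}" by (rule proj_pointE)
  then have b: "b \<in> x - {0}" using in_span_self by blast
  let ?\<nu> = "deriv_normal X l a x"
  have "?\<nu> (\<lambda>y. f y + g y) = ?\<nu> f + ?\<nu> g"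
    if f: "f \<in> local_ideal (proj s) X x" and g: "g \<in> local_ideal (proj s) X x" for f g
  proof -
    have "ratio_at x 0 (\<lambda>L _. f L)" "ratio_at x 0 (\<lambda>L _. g L)" using f g by (auto simp: local_ideal_iff)
    then obtain d F G U e F' G' U' where
      1: "F \<in> forms s d" "G \<in> forms s d" "openin (zariski_proj s) U" "x \<in> U"
        "\<And>L w. L \<in> U \<Longrightarrow> w \<in> L - {0} \<Longrightarrow> G w \<noteq> 0 \<and> f L = F w / G w" and
      2: "F' \<in> forms s e" "G' \<in> forms s e" "openin (zariski_proj s) U'" "x \<in> U'"
        "\<And>L w. L \<in> U' \<Longrightarrow> w \<in> L - {0} \<Longrightarrow> G' w \<noteq> 0 \<and> g L = F' w / G' w"
      by (elim local_function_quotient) blast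
    have FG: "(\<lambda>w. F w * G' w) \<in> forms s (d + e)" using form_mult 1 2 by blast
    have "(\<lambda>w. F' w * G w) \<in> forms s (e + d)" using form_mult 1 2 by blast
    then have FG': "(\<lambda>w. F' w * G w) \<in> forms s (d + e)" by (simp add: add.commute)
    have UU: "openin (zariski_proj s) (U \<inter> U')" "x \<in> U \<inter> U'" using 1 2 by auto
    have rep: "G w * G' w \<noteq> 0 \<and> f L + g L = (F w * G' w + F' w * G w) / (G w * G' w)"
      if "L \<in> U \<inter> U'" "w \<in> L - {0}" for L w
      using 1(5)[of L w] 2(5)[of L w] that by (simp add: add_frac_eq mult.commute)
    have z: "F b = 0" "F' b = 0" "G b \<noteq> 0" "G' b \<noteq> 0"
      using 1(5)[OF 1(4) b] 2(5)[OF 2(4) b] local_ideal_zero_at[OF f x(1)] local_ideal_zero_at[OF g x(1)] by auto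
    have "?\<nu> (\<lambda>y. f y + g y) = l b * dderiv (\<lambda>w. F w * G' w + F' w * G w) a b / (G b * G' b)"
      by (rule deriv_normal_eq[OF local_ideal_add[OF f g] x(1) l forms.add[OF FG FG'] form_mult[OF 1(2) 2(2)] UU _ b])
        (rule rep)
    also have "dderiv (\<lambda>w. F w * G' w + F' w * G w) a b = dderiv F a b * G' b + dderiv F' a b * G b"
      using z by (simp only: dderiv_add[OF FG FG'] dderiv_mult[OF 1(1) 2(2)] dderiv_mult[OF 2(1) 1(2)]) simp
    also have "l b * \<dots> / (G b * G' b) = l b * dderiv F a b / G b + l b * dderiv F' a b / G' b"
      using z by (simp add: field_simps)
    also have "\<dots> = ?\<nu> f + ?\<nu> g"
      using deriv_normal_eq[OF f x(1) l 1 b] deriv_normal_eq[OF g x(1) l 2 b] by simp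
    finally show ?thesis .
  qed
  moreover have "?\<nu> (\<lambda>y. g y * f y) = g x * ?\<nu> f"
    if f: "f \<in> local_ideal (proj s) X x" and g: "g \<in> local_functions (proj s) x" for f g
  proof -
    have "ratio_at x 0 (\<lambda>L _. f L)" "ratio_at x 0 (\<lambda>L _. g L)"
      using f g by (auto simp: local_ideal_iff local_functions_iff)
    then obtain d F G U e F' G' U' where
      1: "F \<in> forms s d" "G \<in> forms s d" "openin (zariski_proj s) U" "x \<in> U"
        "\<And>L w. L \<in> U \<Longrightarrow> w \<in> L - {0} \<Longrightarrow> G w \<noteq> 0 \<and> f L = F w / G w" and
      2: "F' \<in> forms s e" "G' \<in> forms s e" "openin (zariski_proj s) U'" "x \<in> U'"
        "\<And>L w. L \<in> U' \<Longrightarrow> w \<in> L - {0} \<Longrightarrow> G' w \<noteq> 0 \<and> g L = F' w / G' w"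
      by (elim local_function_quotient) blast
    have UU: "openin (zariski_proj s) (U' \<inter> U)" "x \<in> U' \<inter> U" using 1 2 by auto
    have rep: "G' w * G w \<noteq> 0 \<and> g L * f L = (F' w * F w) / (G' w * G w)"
      if "L \<in> U' \<inter> U" "w \<in> L - {0}" for L w
      using 1(5)[of L w] 2(5)[of L w] that by simp
    have z: "F b = 0" "G b \<noteq> 0" "G' b \<noteq> 0" "g x = F' b / G' b"
      using 1(5)[OF 1(4) b] 2(5)[OF 2(4) b] local_ideal_zero_at[OF f x(1)] by auto
    have "?\<nu> (\<lambda>y. g y * f y) = l b * dderiv (\<lambda>w. F' w * F w) a b / (G' b * G b)"
      by (rule deriv_normal_eq[OF local_ideal_mult[OF g f] x(1) l form_mult[OF 2(1) 1(1)] form_mult[OF 2(2) 1(2)] UU _ b])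
        (rule rep)
    also have "\<dots> = g x * (l b * dderiv F a b / G b)"
      using z by (simp add: dderiv_mult[OF 2(1) 1(1)] field_simps)
    also have "\<dots> = g x * ?\<nu> f"
      using deriv_normal_eq[OF f x(1) l 1 b] by simp
    finally show ?thesis .
  qed
  moreover have "?\<nu> f = 0" if "f \<notin> local_ideal (proj s) X x" for f
    using that by (simp add: deriv_normal_def)
  ultimately show ?thesis unfolding normal_space_def by blast
qed

text \<open>
  The factor \<open>l\<close> restores the degree that differentiation takes away, so \<open>l \<cdot> \<partial>\<^sub>a F / G\<close> is a
  quotient of forms of equal degrees: the constant direction \<open>a\<close> defines a section of
  \<open>\<N> \<otimes> \<O>(-1)\<close>, and multiplication by \<open>l\<close> a section of \<open>\<N>\<close>.
\<close>

lemma deriv_normal_section: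
  assumes X: "X \<subseteq> proj_points s" and l: "linear_functional s l" and W: "W \<subseteq> X"
  shows "deriv_normal X l a \<in> sections (normal_bundle (proj s) X) W"
proof -
  have "(\<lambda>x. deriv_normal X l a x f) \<in> regular (subvariety (proj s) X) (W \<inter> V)"
    if V: "openin (zariski_proj s) V" and f: "f \<in> regular (proj s) V" "\<forall>y\<in>V \<inter> X. f y = 0" for V f
  proof -
    have "\<exists>V'. \<exists>g\<in>regular (proj s) V'. openin (zariski_proj s) V' \<and> p \<in> V' \<and>
        (\<forall>q\<in>V' \<inter> (W \<inter> V). deriv_normal X l a q f = g q)" if p: "p \<in> W \<inter> V" for p
    proof -
      have "ratio_at p 0 (\<lambda>L _. f L)" using f(1) p regular_proj_iff[OF V] by blast
      then obtain d F G U where 1: "F \<in> forms s d" "G \<in> forms s d" "openin (zariski_proj s) U" "p \<in> U"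
        "\<And>L w. L \<in> U \<Longrightarrow> w \<in> L - {0} \<Longrightarrow> G w \<noteq> 0 \<and> f L = F w / G w"
        by (rule local_function_quotient) blast
      let ?g = "quotient_fn (\<lambda>b. l b * dderiv F a b) G"
      have basic: "q \<in> basic G" if "q \<in> U" for q
      proof -
        have "q \<in> proj_points s" using that 1(3) open_imp_proj_points by blast
        then obtain b where "b \<noteq> 0" "q = span {b}" by (rule proj_pointE)
        then show ?thesis using 1(5)[OF that, of b] span_in_basic[OF 1(2)] in_span_self by blast
      qed
      have g: "?g \<in> regular (proj s) U"
        unfolding regular_proj_iff[OF 1(3)]
        using ratio_at_quotient_fn[OF form_linear_times_dderiv[OF 1(1) l] 1(2)] basic by blast
      have "deriv_normal X l a q f = ?g q" if q: "q \<in> U \<inter> (W \<inter> V)" for q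
      proof -
        have qp: "q \<in> proj_points s" "q \<in> X" using q X W by auto
        then obtain b where "b \<noteq> 0" "q = span {b}" by (auto elim: proj_pointE)
        then have b: "b \<in> q - {0}" using in_span_self by blast
        have "ratio_at q 0 (\<lambda>L _. f L)" using f(1) q regular_proj_iff[OF V] by blast
        then have "f \<in> local_ideal (proj s) X q"
          unfolding local_ideal_iff using V f(2) q by blast
        from deriv_normal_eq[OF this qp(2) l 1(1-3) _ 1(5) b] q
        have "deriv_normal X l a q f = l b * dderiv F a b / G b" by blast
        also have "\<dots> = ?g q"
          using quotient_fn_eq[OF form_linear_times_dderiv[OF 1(1) l] 1(2) qp(1) b] by simp
        finally show ?thesis .
      qed
      then show ?thesis using g 1(3,4) by blast
    qed
    then show ?thesis unfolding subvariety_def variety.simps mem_Collect_eq zariski_of_proj by blast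
  qed
  moreover have "deriv_normal X l a x \<in> normal_space (proj s) X x" if "x \<in> W" for x
    using deriv_normal_in_normal_space[of x X l a] that X W l by blast
  ultimately show ?thesis
    unfolding normal_bundle_def vector_bundle.simps mem_Collect_eq zariski_of_proj by blast
qed

end

section \<open>The normal spaces of the Veronese variety\<close>

lemma sum_if_pair:
  fixes M :: "nat \<Rightarrow> nat \<Rightarrow> 'k::comm_semiring_1"
  assumes "i \<le> n" "l \<le> n"
  shows "(\<Sum>(j, k)\<in>{..n} \<times> {..n}. M j k * (if i = j \<and> l = k then x else 0)) = M i l * x"
proof -
  have "(\<Sum>(j, k)\<in>{..n} \<times> {..n}. M j k * (if i = j \<and> l = k then x else 0))
      = (\<Sum>p\<in>{..n} \<times> {..n}. if p = (i, l) then M i l * x else 0)"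
    by (intro sum.cong) (auto split: if_splits)
  then show ?thesis using assms by simp
qed

text \<open>
  The Veronese variety in coordinates: \<open>q\<close> is the quadratic map that induces the embedding, the \<open>c j\<close>
  are coordinates on \<open>V\<close> with dual vectors \<open>e j\<close>, and the \<open>z j k\<close> are the coordinates of symmetric
  matrices on the target. These span all functionals on the target, because the linear series is
  complete: a functional is determined by its composition with \<open>q\<close>, which is a quadratic form.
\<close>

locale veronese_coordinates = V: projective_space sV + S: projective_space sS
  for sV :: "'k::field_char_0 \<Rightarrow> 'v::ab_group_add \<Rightarrow> 'v"
    and sS :: "'k \<Rightarrow> 's::ab_group_add \<Rightarrow> 's" +
  fixes q :: "'v \<Rightarrow> 's" and n :: nat
    and c :: "nat \<Rightarrow> 'v \<Rightarrow> 'k" and e :: "nat \<Rightarrow> 'v"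
    and z :: "nat \<Rightarrow> nat \<Rightarrow> 's \<Rightarrow> 'k"
  assumes c_linear: "j \<le> n \<Longrightarrow> linear_functional sV (c j)"
    and c_separates: "v \<noteq> 0 \<Longrightarrow> \<exists>j\<le>n. c j v \<noteq> 0"
    and c_e: "i \<le> n \<Longrightarrow> j \<le> n \<Longrightarrow> c i (e j) = (if i = j then 1 else 0)"
    and q_form: "linear_functional sS l \<Longrightarrow> (\<lambda>v. l (q v)) \<in> forms sV 2"
    and z_linear: "j \<le> n \<Longrightarrow> k \<le> n \<Longrightarrow> linear_functional sS (z j k)"
    and z_q: "j \<le> n \<Longrightarrow> k \<le> n \<Longrightarrow> z j k (q v) = c j v * c k v"
    and z_sym: "j \<le> n \<Longrightarrow> k \<le> n \<Longrightarrow> z j k = z k j"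
    and z_span: "linear_functional sS l \<Longrightarrow>
      \<exists>\<alpha>. \<forall>x. l x = (\<Sum>(j, k)\<in>{..n} \<times> {..n}. \<alpha> j k * z j k x)"
begin

text \<open>
  The polarisation of \<open>q\<close> at \<open>e j\<close> and \<open>e k\<close>, that is, the product \<open>e\<^sub>j e\<^sub>k\<close> in the symmetric square.
\<close>

definition dir :: "nat \<Rightarrow> nat \<Rightarrow> 's" where
  "dir j k = sS (1/2) (q (e j + e k) - q (e j) - q (e k))"

definition X :: "'s set set" where
  "X = {S.span {q v} | v. v \<noteq> 0}"

text \<open>
  A \<open>2 \<times> 2\<close> minor of the generic symmetric matrix, divided by \<open>z\<^sub>o\<^sub>o\<^sup>2\<close>. The index \<open>o'\<close> selects the
  chart \<open>z\<^sub>o\<^sub>o \<noteq> 0\<close>.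
\<close>

definition eqn :: "nat \<Rightarrow> nat \<Rightarrow> nat \<Rightarrow> 's set \<Rightarrow> 'k" where
  "eqn o' j k = S.quotient_fn (\<lambda>b. z j k b * z o' o' b - z o' j b * z o' k b) (\<lambda>b. z o' o' b * z o' o' b)"

lemma z_dir:
  assumes "i \<le> n" "l \<le> n" "j \<le> n" "k \<le> n"
  shows "z i l (dir j k) = (if i = j \<and> l = k then 1/2 else 0) + (if i = k \<and> l = j then 1/2 else 0)"
proof -
  have "z i l (dir j k) = 1/2 * (z i l (q (e j + e k)) - z i l (q (e j)) - z i l (q (e k)))"
    using z_linear[OF assms(1,2)] S.linear_functional_iff[of "z i l"]
      S.linear_functional_diff[OF z_linear[OF assms(1,2)]] by (simp add: dir_def)
  also have "\<dots> = 1/2 * (c i (e j) * c l (e k) + c i (e k) * c l (e j))"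
  proof -
    have "c i (e j + e k) = c i (e j) + c i (e k)" "c l (e j + e k) = c l (e j) + c l (e k)"
      using c_linear assms(1,2) V.linear_functional_iff by blast+
    then show ?thesis by (simp only: z_q[OF assms(1,2)]) (simp add: algebra_simps)
  qed
  also have "\<dots> = (if i = j \<and> l = k then 1/2 else 0) + (if i = k \<and> l = j then 1/2 else 0)"
    unfolding c_e[OF assms(1,3)] c_e[OF assms(2,4)] c_e[OF assms(1,4)] c_e[OF assms(2,3)]
    by (cases "i = j"; cases "l = k"; cases "i = k"; cases "l = j";
        simp only: if_True if_False simp_thms mult_1_left mult_zero_left mult_zero_right mult_1_right
          add_0_left add_0_right distrib_left if_cancel)
  finally show ?thesis .
qed

lemma sum_z_dir:
  assumes "i \<le> n" "l \<le> n" and sym: "\<And>j k. j \<le> n \<Longrightarrow> k \<le> n \<Longrightarrow> M j k = M k j"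
  shows "(\<Sum>(j, k)\<in>{..n} \<times> {..n}. M j k * z i l (dir j k)) = M i l"
proof -
  have "(\<Sum>(j, k)\<in>{..n} \<times> {..n}. M j k * z i l (dir j k))
      = (\<Sum>(j, k)\<in>{..n} \<times> {..n}. M j k * (if i = j \<and> l = k then 1/2 else 0))
      + (\<Sum>(j, k)\<in>{..n} \<times> {..n}. M j k * (if l = j \<and> i = k then 1/2 else 0))"
    unfolding sum.distrib[symmetric]
  proof (rule sum.cong)
    fix p assume "p \<in> {..n} \<times> {..n}"
    then obtain j k where p: "p = (j, k)" "j \<le> n" "k \<le> n" by auto
    show "(case p of (j, k) \<Rightarrow> M j k * z i l (dir j k))
        = (case p of (j, k) \<Rightarrow> M j k * (if i = j \<and> l = k then 1/2 else 0))
        + (case p of (j, k) \<Rightarrow> M j k * (if l = j \<and> i = k then 1/2 else 0))"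
      unfolding p(1) prod.case z_dir[OF assms(1,2) p(2,3)] distrib_left by (simp only: conj_commute)
  qed simp
  also have "\<dots> = M i l * (1/2) + M l i * (1/2)"
    unfolding sum_if_pair[OF assms(1,2)] sum_if_pair[OF assms(2,1)] ..
  also have "\<dots> = M i l" using sym[OF assms(1,2)] by simp
  finally show ?thesis .
qed

lemma q_nonzero:
  assumes "v \<noteq> 0"
  shows "q v \<noteq> 0"
proof
  assume "q v = 0"
  obtain j where j: "j \<le> n" "c j v \<noteq> 0" using c_separates[OF assms] by blast
  have "c j v * c j v = 0"
    using z_q[OF j(1) j(1), of v] S.linear_functional_zero[OF z_linear[OF j(1) j(1)]] \<open>q v = 0\<close> by simp
  then show False using j by simp
qed

lemma X_points: "X \<subseteq> proj_points sS"
  unfolding X_def using S.span_proj_point q_nonzero by blast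

lemma span_q_in_X: "v \<noteq> 0 \<Longrightarrow> S.span {q v} \<in> X"
  unfolding X_def by blast

lemma q_in_span: "v \<noteq> 0 \<Longrightarrow> q v \<in> S.span {q v} - {0}"
  using S.in_span_self q_nonzero by blast

lemma form_comp_q: "F \<in> forms sS d \<Longrightarrow> (\<lambda>v. F (q v)) \<in> forms sV (d * 2)"
  by (rule form_compose[OF V.projective_space_axioms S.projective_space_axioms q_form])

lemma z_form: "j \<le> n \<Longrightarrow> k \<le> n \<Longrightarrow> z j k \<in> forms sS 1"
  using S.form_linear z_linear by blast

lemma zz_form: "i \<le> n \<Longrightarrow> j \<le> n \<Longrightarrow> k \<le> n \<Longrightarrow> l \<le> n \<Longrightarrow> (\<lambda>b. z i j b * z k l b) \<in> forms sS 2"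
  using S.form_mult[OF z_form z_form, of i j k l] by (simp add: numeral_2_eq_2)

lemma eqn_form:
  "o' \<le> n \<Longrightarrow> j \<le> n \<Longrightarrow> k \<le> n \<Longrightarrow> (\<lambda>b. z j k b * z o' o' b - z o' j b * z o' k b) \<in> forms sS 2"
  by (intro S.form_diff zz_form)

lemma chart_point:
  assumes "o' \<le> n" "v \<noteq> 0"
  shows "S.span {q v} \<in> S.basic (z o' o') \<longleftrightarrow> c o' v \<noteq> 0"
  using S.span_in_basic[OF z_form[OF assms(1,1)] q_nonzero[OF assms(2)]] z_q[OF assms(1,1)] by simp

lemma basic_zz: "o' \<le> n \<Longrightarrow> S.basic (\<lambda>b. z o' o' b * z o' o' b) = S.basic (z o' o')"
  by (auto simp: S.basic_def)

lemma open_chart: "o' \<le> n \<Longrightarrow> openin (zariski_proj sS) (S.basic (z o' o'))"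
  using S.open_basic z_form by blast

lemma eqn_eq:
  assumes "o' \<le> n" "j \<le> n" "k \<le> n" "L \<in> proj_points sS" "b \<in> L - {0}"
  shows "eqn o' j k L = (z j k b * z o' o' b - z o' j b * z o' k b) / (z o' o' b * z o' o' b)"
  unfolding eqn_def using assms by (intro S.quotient_fn_eq[OF eqn_form zz_form])

lemma eqn_regular:
  assumes "o' \<le> n" "j \<le> n" "k \<le> n"
  shows "eqn o' j k \<in> regular (proj sS) (S.basic (z o' o'))"
  unfolding S.regular_proj_iff[OF open_chart[OF assms(1)]] eqn_def
  using S.ratio_at_quotient_fn[OF eqn_form[OF assms] zz_form[OF assms(1,1,1,1)]] basic_zz[OF assms(1)]
  by blast

lemma eqn_vanishes:
  assumes "o' \<le> n" "j \<le> n" "k \<le> n" "y \<in> X"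
  shows "eqn o' j k y = 0"
proof -
  obtain v where v: "v \<noteq> 0" "y = S.span {q v}" using assms(4) by (auto simp: X_def)
  have "eqn o' j k y = (z j k (q v) * z o' o' (q v) - z o' j (q v) * z o' k (q v)) / (z o' o' (q v) * z o' o' (q v))"
    by (rule eqn_eq[OF assms(1-3)]) (use assms X_points v q_in_span in auto)
  then show ?thesis using assms by (simp add: z_q)
qed

lemma eqn_local_ideal:
  assumes "o' \<le> n" "j \<le> n" "k \<le> n" "v \<noteq> 0" "c o' v \<noteq> 0"
  shows "eqn o' j k \<in> local_ideal (proj sS) X (S.span {q v})"
  unfolding local_ideal_def S.zariski_of_proj
  using open_chart[OF assms(1)] chart_point[OF assms(1,4)] assms(5) eqn_regular[OF assms(1-3)]
    eqn_vanishes[OF assms(1-3)] by blast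

lemma eqn_sym: "j \<le> n \<Longrightarrow> k \<le> n \<Longrightarrow> eqn o' j k = eqn o' k j"
  unfolding eqn_def using z_sym[of j k] by (simp add: mult.commute)

lemma eqn_chart_index: "o' \<le> n \<Longrightarrow> k \<le> n \<Longrightarrow> eqn o' o' k = (\<lambda>_. 0)"
  by (auto simp: eqn_def S.quotient_fn_def fun_eq_iff mult.commute)

text \<open>
  On the chart \<open>z\<^sub>o\<^sub>o \<noteq> 0\<close> the map \<open>b \<mapsto> q (lift o' b) / z\<^sub>o\<^sub>o b\<close> retracts the ambient space onto \<open>X\<close>: it
  is the identity on \<open>X\<close>, where \<open>z\<^sub>o\<^sub>j (q v) = c\<^sub>o v \<cdot> c\<^sub>j v\<close>.
\<close>

definition lift :: "nat \<Rightarrow> 's \<Rightarrow> 'v" where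
  "lift o' b = (\<Sum>j\<le>n. sV (z o' j b) (e j))"

lemma c_lift: "o' \<le> n \<Longrightarrow> j \<le> n \<Longrightarrow> c j (lift o' b) = z o' j b"
proof -
  assume *: "o' \<le> n" "j \<le> n"
  have "c j (lift o' b) = (\<Sum>i\<le>n. z o' i b * c j (e i))"
    unfolding lift_def by (rule V.linear_functional_combination[OF c_linear[OF *(2)]])
  also have "\<dots> = (\<Sum>i\<le>n. if i = j then z o' i b else 0)"
    using * c_e by (intro sum.cong) auto
  finally show ?thesis using * by simp
qed

lemma lift_form:
  assumes "o' \<le> n" "F \<in> forms sV d"
  shows "(\<lambda>b. F (lift o' b)) \<in> forms sS d"
proof -
  have "(\<lambda>b. l (lift o' b)) \<in> forms sS 1" if l: "linear_functional sV l" for l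
  proof -
    have "l (lift o' b) = (\<Sum>i\<le>n. l (e i) * z o' i b)" for b
      unfolding lift_def V.linear_functional_combination[OF l] by (simp add: mult.commute)
    then show ?thesis
      using S.form_linear[OF S.linear_functional_lincomb[of "{..n}" "z o'" "\<lambda>i. l (e i)"]] z_linear assms(1)
      by simp
  qed
  from form_compose[OF S.projective_space_axioms V.projective_space_axioms this assms(2)]
  show ?thesis by simp
qed

text \<open>
  The difference between a form \<open>F\<close> of degree \<open>d\<close> and its composition with the retraction, divided by
  \<open>z\<^sub>o\<^sub>o\<^sup>d\<close> to obtain a function of points.
\<close>

definition lift_diff :: "nat \<Rightarrow> ('s \<Rightarrow> 'k) \<Rightarrow> nat \<Rightarrow> 's set \<Rightarrow> 'k" where
  "lift_diff o' F d = S.quotient_fn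
    (\<lambda>b. F b * z o' o' b ^ d - F (q (lift o' b))) (\<lambda>b. z o' o' b ^ (2 * d))"

lemma form_q_lift:
  assumes "o' \<le> n" "F \<in> forms sS d"
  shows "(\<lambda>b. F (q (lift o' b))) \<in> forms sS (2 * d)"
  using lift_form[OF assms(1) form_comp_q[OF assms(2)]] by (simp add: mult.commute)

lemma z_power_form: "o' \<le> n \<Longrightarrow> (\<lambda>b. z o' o' b ^ d) \<in> forms sS d"
  using S.form_power[OF z_form, of o' o' d] by simp

lemma lift_diff_eq:
  assumes "o' \<le> n" "F \<in> forms sS d" "L \<in> proj_points sS" "b \<in> L - {0}"
  shows "lift_diff o' F d L = (F b * z o' o' b ^ d - F (q (lift o' b))) / z o' o' b ^ (2 * d)"
proof -
  have "(\<lambda>b. F b * z o' o' b ^ d) \<in> forms sS (2 * d)"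
    using S.form_mult[OF assms(2) z_power_form[OF assms(1), of d]] by (simp add: mult_2)
  from S.form_diff[OF this form_q_lift[OF assms(1,2)]]
  show ?thesis unfolding lift_diff_def
    by (intro S.quotient_fn_eq[OF _ z_power_form[OF assms(1)]] assms)
qed

text \<open>
  The functions \<open>eqn o' j k\<close> generate the ideal of \<open>X\<close> on the chart. For a form \<open>F\<close>, the function
  \<open>lift_diff o' F d\<close> is a combination of them: if \<open>F\<close> is linear this is the definition of the \<open>eqn\<close>,
  and for products it follows from \<open>A C - B D = A (C - D) + (A - B) D\<close>. If \<open>F\<close> vanishes on \<open>X\<close> near
  \<open>x\<close>, then \<open>F \<circ> q\<close> is a form that vanishes on a nonempty open set, hence everywhere, and
  \<open>lift_diff o' F d\<close> is \<open>F\<close> up to a unit. Instead of combinations, the proof tracks the property of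
  being killed by \<open>\<nu>\<close>.
\<close>

lemma normal_vector_eqI:
  assumes o': "o' \<le> n" and v: "v \<noteq> 0" "c o' v \<noteq> 0"
    and nu: "\<nu> \<in> normal_space (proj sS) X (S.span {q v})"
    and vanish: "\<And>j k. j \<le> n \<Longrightarrow> k \<le> n \<Longrightarrow> \<nu> (eqn o' j k) = 0"
  shows "\<nu> f = 0"
proof -
  define x where "x = S.span {q v}"
  have xX: "x \<in> X" and xp: "x \<in> proj_points sS"
    using span_q_in_X[OF v(1)] X_points by (auto simp: x_def)
  have nu: "\<nu> \<in> normal_space (proj sS) X x" using nu by (simp add: x_def)
  let ?Z = "z o' o'" and ?U = "S.basic (z o' o')"
  have U: "openin (zariski_proj sS) ?U" "x \<in> ?U"
    using open_chart[OF o'] chart_point[OF o' v(1)] v(2) by (auto simp: x_def)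
  have Z0: "?Z b \<noteq> 0" "L \<in> proj_points sS" if "L \<in> ?U" "b \<in> L - {0}" for L b
    using S.form_nonzero_on_basic[OF z_form[OF o' o'] that] that by (auto simp: S.basic_def)
  \<comment> \<open>The part of the local ideal that \<open>\<nu>\<close> kills, a submodule over the local ring.\<close>
  define K where "K f \<longleftrightarrow> f \<in> local_ideal (proj sS) X x \<and> \<nu> f = 0" for f
  have K_add: "K (\<lambda>y. f y + g y)" if "K f" "K g" for f g
    using that S.local_ideal_add S.normal_space_add[OF nu] by (auto simp: K_def)
  have K_mult: "K (\<lambda>y. g y * f y)" if "K f" "g \<in> local_functions (proj sS) x" for f g
    using that S.local_ideal_mult S.normal_space_mult[OF nu] by (auto simp: K_def)
  have K_sum: "K (\<lambda>y. \<Sum>i\<in>A. f i y)" if "\<And>i. i \<in> A \<Longrightarrow> K (f i)" for A and f :: "'i \<Rightarrow> 's set \<Rightarrow> 'k"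
    using that S.local_ideal_sum[OF xp, of A f X] S.normal_space_sum[OF nu xp, of A f]
    by (simp add: K_def)
  have K_cong: "K g" if f: "K f" and W: "openin (zariski_proj sS) W" "x \<in> W"
    and eq: "\<And>L b. L \<in> W \<Longrightarrow> b \<in> L - {0} \<Longrightarrow> g L = f L" for f g W
  proof -
    have eq': "g L = f L" if "L \<in> W" for L
    proof -
      have "L \<in> proj_points sS" using that W S.open_imp_proj_points by blast
      then obtain b where "b \<noteq> 0" "L = S.span {b}" by (rule S.proj_pointE)
      then show ?thesis using eq that S.in_span_self by blast
    qed
    from f have f': "S.ratio_at x 0 (\<lambda>L _. f L)" and
      "\<exists>V. openin (zariski_proj sS) V \<and> x \<in> V \<and> (\<forall>y\<in>V \<inter> X. f y = 0)"
      by (auto simp: K_def S.local_ideal_iff)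
    then obtain V where V: "openin (zariski_proj sS) V" "x \<in> V" "\<forall>y\<in>V \<inter> X. f y = 0" by blast
    have "openin (zariski_proj sS) (V \<inter> W) \<and> x \<in> V \<inter> W \<and> (\<forall>y\<in>(V \<inter> W) \<inter> X. g y = 0)"
      using V W eq' by auto
    moreover have "S.ratio_at x 0 (\<lambda>L _. g L)"
      by (rule S.ratio_at_cong[OF f' W]) (use eq' in auto)
    ultimately have "g \<in> local_ideal (proj sS) X x" unfolding S.local_ideal_iff by blast
    moreover from this have "\<nu> g = \<nu> f"
      using S.normal_space_germ[OF nu _ _ W] eq' f K_def by blast
    ultimately show ?thesis using f by (simp add: K_def)
  qed
  have K_eqn: "K (eqn o' j k)" if "j \<le> n" "k \<le> n" for j k
    using eqn_local_ideal[OF o' that v] vanish[OF that] by (simp add: K_def x_def)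
  have K_scale: "K (\<lambda>y. r * f y)" if "K f" for r f
    using K_mult[OF that, of "\<lambda>_. r"] S.ratio_at_one[OF xp] S.local_functions_iff by blast
  have K_linear: "K (lift_diff o' l 1)" if l: "linear_functional sS l" for l
  proof -
    obtain \<alpha> where \<alpha>: "\<And>b. l b = (\<Sum>(j, k)\<in>{..n} \<times> {..n}. \<alpha> j k * z j k b)"
      using z_span[OF l] by blast
    have "K (\<lambda>y. \<Sum>p\<in>{..n} \<times> {..n}. \<alpha> (fst p) (snd p) * eqn o' (fst p) (snd p) y)"
      by (intro K_sum K_scale K_eqn) auto
    then show ?thesis
    proof (rule K_cong[OF _ U])
      fix L b assume L: "L \<in> ?U" "b \<in> L - {0}"
      have "lift_diff o' l 1 L = (l b * ?Z b - l (q (lift o' b))) / (?Z b * ?Z b)"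
        using lift_diff_eq[OF o' S.form_linear[OF l] Z0(2)[OF L] L(2)] by (simp add: power2_eq_square)
      also have "l b * ?Z b - l (q (lift o' b))
          = (\<Sum>p\<in>{..n} \<times> {..n}. \<alpha> (fst p) (snd p) * (z (fst p) (snd p) b * ?Z b - z o' (fst p) b * z o' (snd p) b))"
        unfolding \<alpha> sum_distrib_right sum_subtractf[symmetric]
        by (intro sum.cong) (auto simp: z_q c_lift[OF o'] algebra_simps)
      also have "\<dots> / (?Z b * ?Z b) = (\<Sum>p\<in>{..n} \<times> {..n}. \<alpha> (fst p) (snd p) * eqn o' (fst p) (snd p) L)"
        unfolding sum_divide_distrib
        by (intro sum.cong) (auto simp: eqn_eq[OF o' _ _ Z0(2)[OF L] L(2)])
      finally show "lift_diff o' l 1 L = (\<Sum>p\<in>{..n} \<times> {..n}. \<alpha> (fst p) (snd p) * eqn o' (fst p) (snd p) L)" .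
    qed
  qed
  have K_product: "K (lift_diff o' (\<lambda>b. r * (\<Prod>i<d. l i b)) d)"
    if "\<And>i. i < d \<Longrightarrow> linear_functional sS (l i)" for r d and l :: "nat \<Rightarrow> 's \<Rightarrow> 'k"
    using that
  proof (induction d)
    case 0
    have "lift_diff o' (\<lambda>b. r * (\<Prod>i<0. l i b)) 0 = (\<lambda>_. 0)"
      by (auto simp: lift_diff_def S.quotient_fn_def)
    then show ?case using S.local_ideal_zero[OF xp] S.normal_space_zero[OF nu xp] by (simp add: K_def)
  next
    case (Suc d)
    let ?F = "\<lambda>b. r * (\<Prod>i<d. l i b)"
    have l: "linear_functional sS (l d)" using Suc(2) by simp
    have F: "?F \<in> forms sS d" using forms.product[where s = sS and d = d and l = l] Suc(2) by simp
    have F': "(\<lambda>b. r * (\<Prod>i<Suc d. l i b)) \<in> forms sS (Suc d)"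
      using forms.product[where s = sS and d = "Suc d" and l = l] Suc(2) by simp
    have 1: "S.quotient_fn (l d) ?Z \<in> local_functions (proj sS) x"
      unfolding S.local_functions_iff
      by (rule S.ratio_at_quotient_fn[OF S.form_linear[OF l] z_form[OF o' o'] U(2)])
    have U': "x \<in> S.basic (\<lambda>b. ?Z b ^ (2 * d))"
      using S.span_in_basic[OF z_power_form[OF o'] q_nonzero[OF v(1)]] z_q[OF o' o'] v(2) by (simp add: x_def)
    have 2: "S.quotient_fn (\<lambda>b. ?F (q (lift o' b))) (\<lambda>b. ?Z b ^ (2 * d)) \<in> local_functions (proj sS) x"
      unfolding S.local_functions_iff
      by (rule S.ratio_at_quotient_fn[OF form_q_lift[OF o' F] z_power_form[OF o'] U'])
    have "K (\<lambda>y. S.quotient_fn (l d) ?Z y * lift_diff o' ?F d y +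
        S.quotient_fn (\<lambda>b. ?F (q (lift o' b))) (\<lambda>b. ?Z b ^ (2 * d)) y * lift_diff o' (l d) 1 y)"
      using Suc by (intro K_add K_mult 1 2 K_linear l) auto
    then show ?case
    proof (rule K_cong[OF _ U])
      fix L b assume L: "L \<in> ?U" "b \<in> L - {0}"
      note Lp = Z0[OF L]
      \<comment> \<open>Below, \<open>A\<close> and \<open>C\<close> are the values of \<open>l d\<close> and of the product of the other factors
        at \<open>b\<close>, and \<open>B\<close>, \<open>D\<close> those at the lift.\<close>
      define A B C D where "A = l d b" and "B = l d (q (lift o' b))" and "C = ?F b" and "D = ?F (q (lift o' b))"
      have "lift_diff o' (\<lambda>b. r * (\<Prod>i<Suc d. l i b)) (Suc d) L
          = (C * A * ?Z b ^ Suc d - D * B) / ?Z b ^ (2 * Suc d)"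
        using lift_diff_eq[OF o' F' Lp(2) L(2)] by (simp add: A_def B_def C_def D_def mult_ac)
      also have "\<dots> = A / ?Z b * ((C * ?Z b ^ d - D) / ?Z b ^ (2 * d))
          + D / ?Z b ^ (2 * d) * ((A * ?Z b - B) / (?Z b ^ 2))"
        using Lp(1) by (simp add: field_simps power2_eq_square)
      also have "\<dots> = S.quotient_fn (l d) ?Z L * lift_diff o' ?F d L +
        S.quotient_fn (\<lambda>b. ?F (q (lift o' b))) (\<lambda>b. ?Z b ^ (2 * d)) L * lift_diff o' (l d) 1 L"
        using lift_diff_eq[OF o' F Lp(2) L(2)] lift_diff_eq[OF o' S.form_linear[OF l] Lp(2) L(2)]
          S.quotient_fn_eq[OF S.form_linear[OF l] z_form[OF o' o'] Lp(2) L(2)]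
          S.quotient_fn_eq[OF form_q_lift[OF o' F] z_power_form[OF o'] Lp(2) L(2)]
        by (simp add: A_def B_def C_def D_def)
      finally show "lift_diff o' (\<lambda>b. r * (\<Prod>i<Suc d. l i b)) (Suc d) L =
        S.quotient_fn (l d) ?Z L * lift_diff o' ?F d L +
        S.quotient_fn (\<lambda>b. ?F (q (lift o' b))) (\<lambda>b. ?Z b ^ (2 * d)) L * lift_diff o' (l d) 1 L" .
    qed
  qed
  have K_form: "K (lift_diff o' F d)" if "F \<in> forms sS d" for F d
    using that
  proof (induction F rule: forms.induct)
    case (product l r)
    then show ?case by (rule K_product)
  next
    case (add F G)
    have "lift_diff o' (\<lambda>v. F v + G v) d = (\<lambda>y. lift_diff o' F d y + lift_diff o' G d y)"
      by (auto simp: lift_diff_def S.quotient_fn_def Let_def add_divide_distrib[symmetric] algebra_simps)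
    then show ?case using K_add[OF add(3,4)] by simp
  qed
  show ?thesis
  proof (cases "f \<in> local_ideal (proj sS) X x")
    case False
    then show ?thesis using nu unfolding normal_space_def by blast
  next
    case True
    then have "S.ratio_at x 0 (\<lambda>L _. f L)" by (simp add: S.local_ideal_iff)
    then obtain d F G W where 1: "F \<in> forms sS d" "G \<in> forms sS d" "openin (zariski_proj sS) W" "x \<in> W"
      "\<And>L w. L \<in> W \<Longrightarrow> w \<in> L - {0} \<Longrightarrow> G w \<noteq> 0 \<and> f L = F w / G w"
      by (rule S.local_function_quotient) blast
    from True obtain W' where W': "openin (zariski_proj sS) W'" "x \<in> W'" "\<forall>y\<in>W' \<inter> X. f y = 0"
      by (auto simp: S.local_ideal_iff)
    have "openin (zariski_proj sS) (W \<inter> W')" "x \<in> W \<inter> W'" using 1 W' by auto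
    then obtain H d' where H: "H \<in> forms sS d'" "x \<in> S.basic H" "S.basic H \<subseteq> W \<inter> W'"
      using S.basic_neighbourhood by blast
    have Fq: "F (q w) = 0" for w
    proof (rule V.form_vanishes_if_vanishes_on_basic[OF form_comp_q[OF 1(1)] form_comp_q[OF H(1)] v(1)])
      show "H (q v) \<noteq> 0" using S.span_in_basic[OF H(1) q_nonzero[OF v(1)]] H(2) by (simp add: x_def)
      show "F (q w) = 0" if w: "w \<noteq> 0" "H (q w) \<noteq> 0" for w
      proof -
        have "S.span {q w} \<in> W \<inter> W'"
          using S.span_in_basic[OF H(1) q_nonzero[OF w(1)]] w(2) H(3) by blast
        then have "G (q w) \<noteq> 0" "f (S.span {q w}) = F (q w) / G (q w)" "f (S.span {q w}) = 0"
          using 1(5)[of "S.span {q w}" "q w"] W'(3) span_q_in_X[OF w(1)] q_in_span[OF w(1)] by auto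
        then show ?thesis by simp
      qed
    qed
    have G: "x \<in> S.basic G"
      using S.span_in_basic[OF 1(2) q_nonzero[OF v(1)]] 1(5)[OF 1(4)] q_in_span[OF v(1)]
      by (simp add: x_def)
    have "S.quotient_fn (\<lambda>b. ?Z b ^ d) G \<in> local_functions (proj sS) x"
      unfolding S.local_functions_iff by (rule S.ratio_at_quotient_fn[OF z_power_form[OF o'] 1(2) G])
    then have "K (\<lambda>y. S.quotient_fn (\<lambda>b. ?Z b ^ d) G y * lift_diff o' F d y)"
      by (intro K_mult K_form 1)
    then have "K f"
    proof (rule K_cong)
      show "openin (zariski_proj sS) (W \<inter> ?U)" "x \<in> W \<inter> ?U" using 1 U by auto
      fix L b assume "L \<in> W \<inter> ?U" and b: "b \<in> L - {0}"
      then have L: "L \<in> W" "L \<in> ?U" by auto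
      note Lp = Z0[OF L(2) b]
      have "S.quotient_fn (\<lambda>b. ?Z b ^ d) G L * lift_diff o' F d L
          = ?Z b ^ d / G b * (F b * ?Z b ^ d / ?Z b ^ (2 * d))"
        using S.quotient_fn_eq[OF z_power_form[OF o'] 1(2) Lp(2) b] lift_diff_eq[OF o' 1(1) Lp(2) b] Fq by simp
      also have "\<dots> = F b / G b" using Lp(1) by (simp add: field_simps power_mult power2_eq_square power_mult_distrib)
      finally show "f L = S.quotient_fn (\<lambda>b. ?Z b ^ d) G L * lift_diff o' F d L"
        using 1(5)[OF L(1) b] by simp
    qed
    then show ?thesis by (simp add: K_def)
  qed
qed

end

context veronese_coordinates
begin

text \<open>
  Here \<open>o1\<close> is the chart used to normalise the derivative and \<open>o2\<close> the chart of the equation; comparing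
  two charts needs both.
\<close>

lemma deriv_normal_eqn:
  assumes "o1 \<le> n" "o2 \<le> n" "i \<le> n" "l \<le> n" "v \<noteq> 0" "c o2 v \<noteq> 0"
  shows "S.deriv_normal X (z o1 o1) d (S.span {q v}) (eqn o2 i l) =
    c o1 v ^ 2 * (z i l d * c o2 v ^ 2 + c i v * c l v * z o2 o2 d
      - c o2 v * c l v * z o2 i d - c o2 v * c i v * z o2 l d) / c o2 v ^ 4"
proof -
  let ?F = "\<lambda>b. z i l b * z o2 o2 b - z o2 i b * z o2 l b"
  let ?x = "S.span {q v}"
  have x: "?x \<in> S.basic (z o2 o2)" using chart_point assms by blast
  have "S.deriv_normal X (z o1 o1) d ?x (eqn o2 i l)
      = z o1 o1 (q v) * S.dderiv ?F d (q v) / (z o2 o2 (q v) * z o2 o2 (q v))"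
  proof (rule S.deriv_normal_eq[OF eqn_local_ideal span_q_in_X z_linear eqn_form zz_form open_chart x _ q_in_span])
    show "z o2 o2 w * z o2 o2 w \<noteq> 0 \<and> eqn o2 i l L = ?F w / (z o2 o2 w * z o2 o2 w)"
      if L: "L \<in> S.basic (z o2 o2)" "w \<in> L - {0}" for L w
    proof -
      have "L \<in> proj_points sS" using L by (simp add: S.basic_def)
      then show ?thesis
        using S.form_nonzero_on_basic[OF z_form L] eqn_eq[of o2 i l L w] assms L by simp
    qed
  qed (use assms in auto)
  also have "S.dderiv ?F d (q v) = z i l d * z o2 o2 (q v) + z i l (q v) * z o2 o2 d
      - (z o2 i d * z o2 l (q v) + z o2 i (q v) * z o2 l d)"
    using assms
    by (simp add: S.dderiv_diff[OF zz_form zz_form] S.dderiv_mult[OF z_form z_form] S.dderiv_linear[OF z_linear])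
  finally show ?thesis
    using assms by (simp add: z_q power2_eq_square power4_eq_xxxx mult_ac diff_diff_eq algebra_simps)
qed

definition combination :: "nat \<Rightarrow> (nat \<Rightarrow> nat \<Rightarrow> 'k) \<Rightarrow> 's set \<Rightarrow> ('s set \<Rightarrow> 'k) \<Rightarrow> 'k" where
  "combination o' M x f = (\<Sum>(j, k)\<in>{..n} \<times> {..n}. M j k * S.deriv_normal X (z o' o') (dir j k) x f)"

lemma combination_in_normal_space:
  assumes "o' \<le> n" "v \<noteq> 0"
  shows "combination o' M (S.span {q v}) \<in> normal_space (proj sS) X (S.span {q v})"
proof -
  let ?x = "S.span {q v}"
  have x: "?x \<in> X" "?x \<in> proj_points sS" using span_q_in_X[OF assms(2)] X_points by auto
  have "(\<lambda>f. \<Sum>p\<in>{..n} \<times> {..n}. M (fst p) (snd p) * S.deriv_normal X (z o' o') (dir (fst p) (snd p)) ?x f)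
      \<in> normal_space (proj sS) X ?x"
    by (intro S.normal_space_lincomb S.deriv_normal_in_normal_space x z_linear assms(1))
  then show ?thesis by (simp add: combination_def[abs_def] case_prod_unfold)
qed

text \<open>
  The normal vectors in the directions \<open>dir j k\<close> are dual to the functions \<open>eqn o' j k\<close>. The condition
  that \<open>M\<close> vanish in the row \<open>o'\<close> is forced, since \<open>eqn o' o' k\<close> is zero. The directions \<open>dir j k\<close>
  with \<open>j\<close> and \<open>k\<close> different from \<open>o'\<close> span a complement of the tangent space \<open>v \<cdot> V\<close>.
\<close>

lemma combination_eqn:
  assumes "o' \<le> n" "v \<noteq> 0" "c o' v \<noteq> 0" "i \<le> n" "l \<le> n"
    and sym: "\<And>j k. j \<le> n \<Longrightarrow> k \<le> n \<Longrightarrow> M j k = M k j"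
    and zero: "\<And>k. k \<le> n \<Longrightarrow> M o' k = 0"
  shows "combination o' M (S.span {q v}) (eqn o' i l) = M i l"
proof -
  have s: "(\<Sum>(j, k)\<in>{..n} \<times> {..n}. M j k * z i l (dir j k)) = M i l" if "i \<le> n" "l \<le> n" for i l
    using sum_z_dir[OF that] sym by blast
  let ?c = "c o' v"
  have "combination o' M (S.span {q v}) (eqn o' i l) =
    (\<Sum>p\<in>{..n} \<times> {..n}. M (fst p) (snd p) * z i l (dir (fst p) (snd p)))
    + c i v * c l v / ?c ^ 2 * (\<Sum>p\<in>{..n} \<times> {..n}. M (fst p) (snd p) * z o' o' (dir (fst p) (snd p)))
    - c l v / ?c * (\<Sum>p\<in>{..n} \<times> {..n}. M (fst p) (snd p) * z o' i (dir (fst p) (snd p)))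
    - c i v / ?c * (\<Sum>p\<in>{..n} \<times> {..n}. M (fst p) (snd p) * z o' l (dir (fst p) (snd p)))"
    unfolding combination_def sum_distrib_left sum.distrib[symmetric] sum_subtractf[symmetric] case_prod_unfold
  proof (intro sum.cong refl)
    fix p assume "p \<in> {..n} \<times> {..n}"
    show "M (fst p) (snd p) * S.deriv_normal X (z o' o') (dir (fst p) (snd p)) (S.span {q v}) (eqn o' i l) =
      M (fst p) (snd p) * z i l (dir (fst p) (snd p))
      + c i v * c l v / ?c ^ 2 * (M (fst p) (snd p) * z o' o' (dir (fst p) (snd p)))
      - c l v / ?c * (M (fst p) (snd p) * z o' i (dir (fst p) (snd p)))
      - c i v / ?c * (M (fst p) (snd p) * z o' l (dir (fst p) (snd p)))"
      unfolding deriv_normal_eqn[OF assms(1,1,4,5,2,3)]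
      using assms(3) by (simp add: field_simps power2_eq_square power4_eq_xxxx)
  qed
  also have "\<dots> = M i l + c i v * c l v / ?c ^ 2 * M o' o' - c l v / ?c * M o' i - c i v / ?c * M o' l"
    using s[OF assms(4,5)] s[OF assms(1,1)] s[OF assms(1,4)] s[OF assms(1,5)] by (simp add: case_prod_unfold)
  also have "\<dots> = M i l" using zero assms by simp
  finally show ?thesis .
qed

lemma eqn_value_sym:
  assumes "j \<le> n" "k \<le> n" shows "\<nu> (eqn o' j k) = \<nu> (eqn o' k j)"
  using eqn_sym[OF assms] by simp

lemma eqn_value_chart_index:
  assumes "\<nu> \<in> normal_space (proj sS) X (S.span {q v})" "v \<noteq> 0" "o' \<le> n" "k \<le> n"
  shows "\<nu> (eqn o' o' k) = 0"
  unfolding eqn_chart_index[OF assms(3,4)]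
  using S.normal_space_zero[OF assms(1)] span_q_in_X[OF assms(2)] X_points by blast

lemma normal_vector_expansion:
  assumes o': "o' \<le> n" and v: "v \<noteq> 0" "c o' v \<noteq> 0"
    and nu: "\<nu> \<in> normal_space (proj sS) X (S.span {q v})"
  shows "\<nu> = combination o' (\<lambda>j k. \<nu> (eqn o' j k)) (S.span {q v})"
proof
  fix f
  let ?x = "S.span {q v}"
  define \<nu>' where "\<nu>' = combination o' (\<lambda>j k. \<nu> (eqn o' j k)) ?x"
  have nu': "\<nu>' \<in> normal_space (proj sS) X ?x"
    unfolding \<nu>'_def by (rule combination_in_normal_space[OF o' v(1)])
  have "(\<lambda>f. \<Sum>b\<in>{True, False}. (if b then 1 else -1) * (if b then \<nu> else \<nu>') f) \<in> normal_space (proj sS) X ?x"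
    by (rule S.normal_space_lincomb) (use nu nu' in auto)
  then have "(\<lambda>f. \<nu> f - \<nu>' f) \<in> normal_space (proj sS) X ?x" by simp
  moreover have "\<nu> (eqn o' j k) - \<nu>' (eqn o' j k) = 0" if "j \<le> n" "k \<le> n" for j k
    unfolding \<nu>'_def
    using combination_eqn[OF o' v that, of "\<lambda>j k. \<nu> (eqn o' j k)",
        OF eqn_value_sym eqn_value_chart_index[OF nu v(1) o']] by simp
  ultimately have "\<nu> f - \<nu>' f = 0"
    using normal_vector_eqI[OF o' v, of "\<lambda>f. \<nu> f - \<nu>' f" f] by blast
  then show "\<nu> f = combination o' (\<lambda>j k. \<nu> (eqn o' j k)) ?x f" by (simp add: \<nu>'_def)
qed

text \<open>
  The linear functionals \<open>\<Sum>\<^sub>j \<mu>\<^sub>j c\<^sub>j\<close> and \<open>\<Sum>\<^sub>j \<eta>\<^sub>j c\<^sub>j\<close> vanish at \<open>v\<close>, so their product is a quadric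
  that is singular at \<open>v\<close>, that is, an element of the conormal space twisted by \<open>\<O>(2)\<close>. The
  pairing does not depend on the chart because all other terms of the transition formula contain one
  of the two vanishing sums as a factor.
\<close>

lemma pairing_chart_independent:
  assumes o1: "o1 \<le> n" "c o1 v \<noteq> 0" and o2: "o2 \<le> n" "c o2 v \<noteq> 0" and v: "v \<noteq> 0"
    and nu: "\<nu> \<in> normal_space (proj sS) X (S.span {q v})"
    and \<mu>: "(\<Sum>j\<le>n. \<mu> j * c j v) = 0" and \<eta>: "(\<Sum>j\<le>n. \<eta> j * c j v) = 0"
  shows "c o2 v ^ 2 * (\<Sum>i\<le>n. \<Sum>l\<le>n. \<mu> i * \<eta> l * \<nu> (eqn o2 i l))
    = c o1 v ^ 2 * (\<Sum>i\<le>n. \<Sum>l\<le>n. \<mu> i * \<eta> l * \<nu> (eqn o1 i l))"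
proof -
  define M where "M j k = \<nu> (eqn o1 j k)" for j k
  let ?C = "{..n} \<times> {..n}"
  define Z where "Z i l = (\<Sum>p\<in>?C. M (fst p) (snd p) * z i l (dir (fst p) (snd p)))" for i l
  have Z: "Z i l = M i l" if "i \<le> n" "l \<le> n" for i l
    using sum_z_dir[OF that, of M] eqn_value_sym[of _ _ \<nu> o1] unfolding Z_def M_def case_prod_unfold by blast
  let ?c = "c o2 v"
  have nuM: "c o2 v ^ 2 * \<nu> (eqn o2 i l) =
      c o1 v ^ 2 * (M i l + c i v * c l v / ?c ^ 2 * M o2 o2 - c l v / ?c * M o2 i - c i v / ?c * M o2 l)"
    if "i \<le> n" "l \<le> n" for i l
  proof -
    have "\<nu> (eqn o2 i l) = combination o1 M (S.span {q v}) (eqn o2 i l)"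
      using normal_vector_expansion[OF o1(1) v o1(2) nu] unfolding M_def by metis
    also have "?c ^ 2 * \<dots> = c o1 v ^ 2 * (Z i l + c i v * c l v / ?c ^ 2 * Z o2 o2
        - c l v / ?c * Z o2 i - c i v / ?c * Z o2 l)"
      unfolding combination_def Z_def sum_distrib_left sum.distrib[symmetric] sum_subtractf[symmetric] case_prod_unfold
    proof (intro sum.cong refl)
      fix p assume "p \<in> {..n} \<times> {..n}"
      show "?c ^ 2 * (M (fst p) (snd p) * S.deriv_normal X (z o1 o1) (dir (fst p) (snd p)) (S.span {q v}) (eqn o2 i l)) =
        c o1 v ^ 2 * (M (fst p) (snd p) * z i l (dir (fst p) (snd p))
        + c i v * c l v / ?c ^ 2 * (M (fst p) (snd p) * z o2 o2 (dir (fst p) (snd p)))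
        - c l v / ?c * (M (fst p) (snd p) * z o2 i (dir (fst p) (snd p)))
        - c i v / ?c * (M (fst p) (snd p) * z o2 l (dir (fst p) (snd p))))"
        unfolding deriv_normal_eqn[OF o1(1) o2(1) that v o2(2)]
        using o2(2) by (simp add: field_simps power2_eq_square power4_eq_xxxx)
    qed
    also have "\<dots> = c o1 v ^ 2 * (M i l + c i v * c l v / ?c ^ 2 * M o2 o2 - c l v / ?c * M o2 i - c i v / ?c * M o2 l)"
      using Z that o2(1) by simp
    finally show ?thesis .
  qed
  have "c o2 v ^ 2 * (\<Sum>i\<le>n. \<Sum>l\<le>n. \<mu> i * \<eta> l * \<nu> (eqn o2 i l))
      = (\<Sum>i\<le>n. \<Sum>l\<le>n. \<mu> i * \<eta> l * (c o1 v ^ 2 * (M i l + c i v * c l v / ?c ^ 2 * M o2 o2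
          - c l v / ?c * M o2 i - c i v / ?c * M o2 l)))"
    unfolding sum_distrib_left
  proof (intro sum.cong refl)
    fix i l assume "i \<in> {..n}" "l \<in> {..n}"
    then have *: "i \<le> n" "l \<le> n" by auto
    have "?c ^ 2 * (\<mu> i * \<eta> l * \<nu> (eqn o2 i l)) = \<mu> i * \<eta> l * (?c ^ 2 * \<nu> (eqn o2 i l))"
      by (simp only: mult_ac)
    then show "?c ^ 2 * (\<mu> i * \<eta> l * \<nu> (eqn o2 i l)) = \<mu> i * \<eta> l * (c o1 v ^ 2 *
        (M i l + c i v * c l v / ?c ^ 2 * M o2 o2 - c l v / ?c * M o2 i - c i v / ?c * M o2 l))"
      unfolding nuM[OF *] .
  qed
  also have "\<dots> = c o1 v ^ 2 * (\<Sum>i\<le>n. \<Sum>l\<le>n. \<mu> i * \<eta> l * M i l)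
      + c o1 v ^ 2 / ?c ^ 2 * M o2 o2 * ((\<Sum>i\<le>n. \<mu> i * c i v) * (\<Sum>l\<le>n. \<eta> l * c l v))
      - c o1 v ^ 2 / ?c * ((\<Sum>i\<le>n. \<mu> i * M o2 i) * (\<Sum>l\<le>n. \<eta> l * c l v))
      - c o1 v ^ 2 / ?c * ((\<Sum>i\<le>n. \<mu> i * c i v) * (\<Sum>l\<le>n. \<eta> l * M o2 l))"
  proof -
    have prod: "(\<Sum>i\<le>n. f i) * (\<Sum>l\<le>n. g l) = (\<Sum>i\<le>n. \<Sum>l\<le>n. f i * g l)" for f g :: "nat \<Rightarrow> 'k"
      by (rule sum_product)
    show ?thesis
      unfolding prod
      unfolding sum_distrib_left sum.distrib[symmetric] sum_subtractf[symmetric]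
      by (intro sum.cong refl) (simp add: algebra_simps)
  qed
  finally show ?thesis by (simp add: \<mu> \<eta> M_def)
qed

end


section \<open>Pulling back sections\<close>

context projective_space
begin

text \<open>
  Pulling back along \<open>h\<close> is well behaved near \<open>p\<close>: continuity at \<open>p\<close>, and regular functions near \<open>h p\<close>
  become regular at \<open>p\<close>.
\<close>

definition morph_at :: "('v set \<Rightarrow> 'q) \<Rightarrow> ('q, 'k) variety \<Rightarrow> 'v set \<Rightarrow> bool" where
  "morph_at h Y p \<longleftrightarrow>
    (\<forall>V. openin (zariski Y) V \<and> h p \<in> V \<longrightarrow> (\<exists>U. openin (zariski_proj s) U \<and> p \<in> U \<and> h ` U \<subseteq> V)) \<and>
    (\<forall>V g. openin (zariski Y) V \<and> h p \<in> V \<and> g \<in> regular Y V \<longrightarrow> ratio_at p 0 (\<lambda>L _. g (h L)))"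

lemma morph_atD:
  assumes "morph_at h Y p" "openin (zariski Y) V" "h p \<in> V"
  shows "\<exists>U. openin (zariski_proj s) U \<and> p \<in> U \<and> h ` U \<subseteq> V"
    and "g \<in> regular Y V \<Longrightarrow> ratio_at p 0 (\<lambda>L _. g (h L))"
  using assms unfolding morph_at_def by blast+

lemma morph_at_id: "morph_at (\<lambda>L. L) (proj s) p"
  unfolding morph_at_def zariski_of_proj using regular_proj_iff by auto

lemma morph_at_proj:
  assumes W: "projective_space sW"
    and form: "\<And>F d. F \<in> forms sW d \<Longrightarrow> (\<lambda>v. F (g v)) \<in> forms s (d * e)"
    and nz: "\<And>v. v \<noteq> 0 \<Longrightarrow> g v \<noteq> 0"
    and h: "\<And>v. v \<noteq> 0 \<Longrightarrow> h (span {v}) = module.span sW {g v}"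
    and p: "p \<in> proj_points s"
  shows "morph_at h (proj sW) p"
proof -
  interpret W: projective_space sW by (rule W)
  obtain v where v: "v \<noteq> 0" "p = span {v}" using p by (rule proj_pointE)
  have basic: "h L \<in> W.basic F" if F: "F \<in> forms sW d" and L: "L \<in> basic (\<lambda>v. F (g v))" for F d L
  proof -
    have "L \<in> proj_points s" using L by (simp add: basic_def)
    then obtain w where w: "w \<noteq> 0" "L = span {w}" by (rule proj_pointE)
    then show ?thesis
      using span_in_basic[OF form[OF F] w(1)] W.span_in_basic[OF F nz[OF w(1)]] L h by simp
  qed
  have open_: "\<exists>U. openin (zariski_proj s) U \<and> p \<in> U \<and> h ` U \<subseteq> V"
    if V: "openin (zariski_proj sW) V" "h p \<in> V" for V
  proof -
    obtain F d where F: "F \<in> forms sW d" "h p \<in> W.basic F" "W.basic F \<subseteq> V"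
      using W.basic_neighbourhood[OF V] by blast
    have "p \<in> basic (\<lambda>v. F (g v))"
      using F(2) span_in_basic[OF form[OF F(1)] v(1)] W.span_in_basic[OF F(1) nz[OF v(1)]] v h by simp
    then show ?thesis
      using open_basic[OF form[OF F(1)]] basic[OF F(1)] F(3) by (intro exI[of _ "basic (\<lambda>v. F (g v))"]) blast
  qed
  have reg: "ratio_at p 0 (\<lambda>L _. f (h L))"
    if V: "openin (zariski_proj sW) V" "h p \<in> V" "f \<in> regular (proj sW) V" for V f
  proof -
    have "W.ratio_at (h p) 0 (\<lambda>L _. f L)" using V W.regular_proj_iff by blast
    then obtain d F G U where 1: "F \<in> forms sW d" "G \<in> forms sW d" "openin (zariski_proj sW) U" "h p \<in> U"
      "\<And>L w. L \<in> U \<Longrightarrow> w \<in> L - {0} \<Longrightarrow> G w \<noteq> 0 \<and> f L = F w / G w"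
      by (rule W.local_function_quotient) blast
    obtain U' where U': "openin (zariski_proj s) U'" "p \<in> U'" "h ` U' \<subseteq> U" using open_[OF 1(3,4)] by blast
    have *: "G (g w) \<noteq> 0 \<and> f (h L) = F (g w) / G (g w)" if L: "L \<in> U'" "w \<in> L - {0}" for L w
    proof -
      have "L = span {w}" "w \<noteq> 0"
        using proj_point_eq_span[OF open_imp_proj_points[OF U'(1) L(1)] L(2)] L(2) by auto
      then have "g w \<in> h L - {0}" using h nz W.in_span_self by simp
      moreover have "h L \<in> U" using U'(3) L(1) by blast
      ultimately show ?thesis using 1(5) by blast
    qed
    show ?thesis
      by (rule ratio_atI[OF form[OF 1(1)] form[OF 1(2)] _ U'(1,2)]) (use * in auto)
  qed
  show ?thesis unfolding morph_at_def W.zariski_of_proj using open_ reg by blast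
qed

lemma morph_at_subvariety:
  assumes "morph_at h P p" "p \<in> proj_points s" "\<And>L. L \<in> proj_points s \<Longrightarrow> h L \<in> X"
  shows "morph_at h (subvariety P X) p"
proof -
  have z: "zariski (subvariety P X) = subtopology (zariski P) X" by (simp add: subvariety_def)
  have open_: "\<exists>U. openin (zariski_proj s) U \<and> p \<in> U \<and> h ` U \<subseteq> V"
    if V: "openin (subtopology (zariski P) X) V" "h p \<in> V" for V
  proof -
    obtain T where T: "openin (zariski P) T" "V = T \<inter> X" using V(1) by (auto simp: openin_subtopology)
    then obtain U where U: "openin (zariski_proj s) U" "p \<in> U" "h ` U \<subseteq> T"
      using morph_atD(1)[OF assms(1) T(1)] V(2) by blast
    then have "h ` U \<subseteq> V" using T(2) assms(3) open_imp_proj_points by blast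
    then show ?thesis using U by blast
  qed
  have reg: "ratio_at p 0 (\<lambda>L _. f (h L))"
    if V: "openin (subtopology (zariski P) X) V" "h p \<in> V" "f \<in> regular (subvariety P X) V" for V f
  proof -
    have "\<forall>p\<in>V. \<exists>W. \<exists>g\<in>regular P W. openin (zariski P) W \<and> p \<in> W \<and> (\<forall>q\<in>W \<inter> V. f q = g q)"
      using V(3) unfolding subvariety_def variety.simps mem_Collect_eq .
    then obtain W g where W: "g \<in> regular P W" "openin (zariski P) W" "h p \<in> W" "\<forall>q\<in>W \<inter> V. f q = g q"
      using V(2) by blast
    obtain U where U: "openin (zariski_proj s) U" "p \<in> U" "h ` U \<subseteq> V" using open_ V by blast
    obtain U' where U': "openin (zariski_proj s) U'" "p \<in> U'" "h ` U' \<subseteq> W"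
      using morph_atD(1)[OF assms(1) W(2,3)] by blast
    have 1: "openin (zariski_proj s) (U \<inter> U')" "p \<in> U \<inter> U'" using U U' by auto
    have "f (h L) = g (h L)" if "L \<in> U \<inter> U'" for L using W(4) U(3) U'(3) that by blast
    then show ?thesis
      by (intro ratio_at_cong[OF morph_atD(2)[OF assms(1) W(2,3,1)] 1]) auto
  qed
  show ?thesis unfolding morph_at_def z using open_ reg by blast
qed

text \<open>
  A component of a section of \<open>f\<^sup>*E\<close> is regular along \<open>h\<close> as soon as that component of each section of
  \<open>E\<close> is regular along \<open>f \<circ> h\<close>. In this form the statement can be iterated over successive pullbacks.
\<close>

lemma pullback_section_ratio:
  assumes h: "morph_at h Y p" and p: "p \<in> proj_points s"
    and E: "\<And>V \<tau>. openin (zariski (base E)) V \<Longrightarrow> f (h p) \<in> V \<Longrightarrow> \<tau> \<in> sections E V \<Longrightarrow>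
      ratio_at p 0 (\<lambda>L _. \<tau> (f (h L)) \<alpha>)"
    and W: "openin (zariski Y) W" "h p \<in> W" and \<sigma>: "\<sigma> \<in> sections (pullback Y f E) W"
  shows "ratio_at p 0 (\<lambda>L _. \<sigma> (h L) \<alpha>)"
proof -
  have "\<forall>q\<in>W. \<exists>U' V. \<exists>m::nat. \<exists>g \<tau>.
        openin (zariski Y) U' \<and> q \<in> U' \<and> U' \<subseteq> W \<and>
        openin (zariski (base E)) V \<and> f ` U' \<subseteq> V \<and>
        (\<forall>i<m. g i \<in> regular Y U' \<and> \<tau> i \<in> sections E V) \<and>
        (\<forall>r\<in>U'. \<sigma> r = (\<lambda>a. \<Sum>i<m. g i r * \<tau> i (f r) a))"
    using \<sigma> unfolding pullback_def vector_bundle.simps mem_Collect_eq .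
  from bspec[OF this W(2)] obtain U' V g \<tau> and m :: nat where
    1: "openin (zariski Y) U'" "h p \<in> U'" "openin (zariski (base E)) V" "f ` U' \<subseteq> V"
    "\<forall>i<m. g i \<in> regular Y U' \<and> \<tau> i \<in> sections E V" "\<forall>r\<in>U'. \<sigma> r = (\<lambda>a. \<Sum>i<m. g i r * \<tau> i (f r) a)"
    by (elim exE conjE)
  obtain U where U: "openin (zariski_proj s) U" "p \<in> U" "h ` U \<subseteq> U'"
    using morph_atD(1)[OF h 1(1,2)] by blast
  have fp: "f (h p) \<in> V" using 1(2,4) by blast
  have "ratio_at p (0 + 0) (\<lambda>L _. g i (h L) * \<tau> i (f (h L)) \<alpha>)" if "i < m" for i
    using 1(5) that by (intro ratio_at_mult morph_atD(2)[OF h 1(1,2)] E[OF 1(3) fp]) auto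
  then have "ratio_at p 0 (\<lambda>L w. \<Sum>i\<in>{..<m}. g i (h L) * \<tau> i (f (h L)) \<alpha>)"
    by (intro ratio_at_sum p) auto
  then show ?thesis
    by (rule ratio_at_cong[OF _ U(1,2)]) (use 1(6) U(3) in auto)
qed

end

lemma pullback_sectionI:
  assumes "\<And>q. q \<in> W \<Longrightarrow> \<exists>U V. \<exists>A::'i set. \<exists>g \<tau>. finite A \<and>
    openin (zariski Y) U \<and> q \<in> U \<and> U \<subseteq> W \<and> openin (zariski (base E)) V \<and> f ` U \<subseteq> V \<and>
    (\<forall>i\<in>A. g i \<in> regular Y U \<and> \<tau> i \<in> sections E V) \<and>
    (\<forall>r\<in>U. \<sigma> r = (\<lambda>a. \<Sum>i\<in>A. g i r * \<tau> i (f r) a))"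
  shows "\<sigma> \<in> sections (pullback Y f E) W"
proof -
  have "\<exists>U' V. \<exists>m::nat. \<exists>g \<tau>.
        openin (zariski Y) U' \<and> q \<in> U' \<and> U' \<subseteq> W \<and>
        openin (zariski (base E)) V \<and> f ` U' \<subseteq> V \<and>
        (\<forall>i<m. g i \<in> regular Y U' \<and> \<tau> i \<in> sections E V) \<and>
        (\<forall>r\<in>U'. \<sigma> r = (\<lambda>a. \<Sum>i<m. g i r * \<tau> i (f r) a))" if "q \<in> W" for q
  proof -
    from assms[OF that] obtain U V g \<tau> and A :: "'i set" where
      1: "finite A" "openin (zariski Y) U" "q \<in> U" "U \<subseteq> W" "openin (zariski (base E)) V" "f ` U \<subseteq> V"
      "\<forall>i\<in>A. g i \<in> regular Y U \<and> \<tau> i \<in> sections E V"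
      "\<forall>r\<in>U. \<sigma> r = (\<lambda>a. \<Sum>i\<in>A. g i r * \<tau> i (f r) a)" by (elim exE conjE)
    obtain h where h: "bij_betw h {0..<card A} A" using ex_bij_betw_nat_finite[OF 1(1)] by blast
    have "(\<Sum>i<card A. g (h i) r * \<tau> (h i) (f r) a) = (\<Sum>i\<in>A. g i r * \<tau> i (f r) a)" for r a
      using sum.reindex_bij_betw[OF h, of "\<lambda>i. g i r * \<tau> i (f r) a"] by (simp add: atLeast0LessThan)
    moreover have "h i \<in> A" if "i < card A" for i using h that by (auto simp: bij_betw_def)
    ultimately show ?thesis
      using 1(2-8) by (intro exI[of _ U] exI[of _ V] exI[of _ "card A"] exI[of _ "\<lambda>i. g (h i)"] exI[of _ "\<lambda>i. \<tau> (h i)"]) simp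
  qed
  then show ?thesis unfolding pullback_def vector_bundle.simps mem_Collect_eq by blast
qed

lemma pullback_section_comp:
  assumes "openin (zariski Y) U" "openin (zariski (base E)) V" "f ` U \<subseteq> V" "\<tau> \<in> sections E V"
    "(\<lambda>_. 1) \<in> regular Y U"
  shows "(\<lambda>q. \<tau> (f q)) \<in> sections (pullback Y f E) U"
proof (rule pullback_sectionI)
  fix q assume "q \<in> U"
  then show "\<exists>U' V. \<exists>A::unit set. \<exists>g \<tau>'. finite A \<and>
    openin (zariski Y) U' \<and> q \<in> U' \<and> U' \<subseteq> U \<and> openin (zariski (base E)) V \<and> f ` U' \<subseteq> V \<and>
    (\<forall>i\<in>A. g i \<in> regular Y U' \<and> \<tau>' i \<in> sections E V) \<and>
    (\<forall>r\<in>U'. \<tau> (f r) = (\<lambda>a. \<Sum>i\<in>A. g i r * \<tau>' i (f r) a))"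
    using assms
    by (intro exI[of _ U] exI[of _ V] exI[of _ "{()}"] exI[of _ "\<lambda>_ _. 1"] exI[of _ "\<lambda>_. \<tau>"]) simp
qed

section \<open>The normal bundle along a rational normal curve\<close>

lemma projective_space_plane: "projective_space (plane_scale :: 'k::field_char_0 \<Rightarrow> 'k \<times> 'k \<Rightarrow> 'k \<times> 'k)"
  by unfold_locales (auto simp: plane_scale_def algebra_simps prod_eq_iff)

interpretation P: projective_space "plane_scale :: 'k::field_char_0 \<Rightarrow> 'k \<times> 'k \<Rightarrow> 'k \<times> 'k"
  by (rule projective_space_plane)

lemma plane_functionals:
  "linear_functional plane_scale (fst :: 'k::field_char_0 \<times> 'k \<Rightarrow> 'k)"
  "linear_functional plane_scale (snd :: 'k \<times> 'k \<Rightarrow> 'k)"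
  unfolding P.linear_functional_iff by (auto simp: plane_scale_def)

text \<open>
  The coefficients, with respect to \<open>c\<^sub>0, \<dots>, c\<^sub>n\<close>, of the functional \<open>s c\<^sub>i - t c\<^bsub>i+1\<^esub>\<close>, which vanishes at
  \<open>r (s, t)\<close>. It corresponds to the form \<open>(s y - t x) x\<^sup>i y\<^bsup>n-1-i\<^esup>\<close>.
\<close>

definition annihilator :: "'k::field_char_0 \<times> 'k \<Rightarrow> nat \<Rightarrow> nat \<Rightarrow> 'k" where
  "annihilator w i j = (if j = i then fst w else if j = Suc i then - snd w else 0)"

lemma annihilator_form: "(\<lambda>w. annihilator w i j) \<in> forms plane_scale 1"
proof -
  have "(\<lambda>w. - snd w :: 'a) \<in> forms plane_scale 1"
    using P.form_scale[OF P.form_linear[OF plane_functionals(2)], of "-1"] by simp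
  then show ?thesis
    using P.form_linear[OF plane_functionals(1)] P.form_zero by (cases "j = i"; cases "j = Suc i") (auto simp: annihilator_def)
qed

lemma annihilator_sum:
  assumes "i < n"
  shows "(\<Sum>j\<le>n. annihilator w i j * x j) = fst w * x i - snd w * x (Suc i)"
proof -
  have "(\<Sum>j\<le>n. annihilator w i j * x j) = (\<Sum>j\<in>{i, Suc i}. annihilator w i j * x j)"
    using assms by (intro sum.mono_neutral_right) (auto simp: annihilator_def)
  then show ?thesis by (simp add: annihilator_def)
qed

lemma annihilator_scale: "annihilator (plane_scale c w) i j = c * annihilator w i j"
  by (simp add: annihilator_def plane_scale_def)

text \<open>
  The projective line is covered by the charts \<open>s \<noteq> 0\<close> (for \<open>True\<close>) and \<open>t \<noteq> 0\<close> (for \<open>False\<close>). On the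
  first, \<open>c\<^sub>n (r w) = s\<^sup>n\<close> does not vanish, and on the second \<open>c\<^sub>0 (r w) = t\<^sup>n\<close>, which explains the indices
  chosen in \<open>chart\<close> below.
\<close>

definition line_coord :: "bool \<Rightarrow> 'k::field_char_0 \<times> 'k \<Rightarrow> 'k" where
  "line_coord b w = (if b then fst w else snd w)"

lemma line_coord_form: "line_coord b \<in> forms plane_scale 1"
  using P.form_linear plane_functionals by (cases b) (auto simp: line_coord_def[abs_def])

lemma line_coord_nonzero: "w \<noteq> 0 \<Longrightarrow> line_coord (fst w \<noteq> 0) w \<noteq> 0"
  by (auto simp: line_coord_def prod_eq_iff)

lemma line_coord_scale: "line_coord b (plane_scale c w) = c * line_coord b w"
  by (simp add: line_coord_def plane_scale_def)

text \<open>
  The solution of the recurrence \<open>s x\<^sub>j - t x\<^bsub>j+1\<^esub> = y\<^sub>j\<close> is \<open>x\<^sub>j = \<Sum>\<^sub>k ann_inverse j k \<cdot> y\<^sub>k\<close>: it is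
  obtained downwards from \<open>x\<^sub>n = 0\<close> if \<open>s \<noteq> 0\<close>, and upwards from \<open>x\<^sub>0 = 0\<close> if \<open>t \<noteq> 0\<close>.
\<close>

definition ann_inverse :: "bool \<Rightarrow> 'k::field_char_0 \<times> 'k \<Rightarrow> nat \<Rightarrow> nat \<Rightarrow> 'k" where
  "ann_inverse b w j k = (if b
     then (if j \<le> k then snd w ^ (k - j) * (1 / fst w ^ (k - j + 1)) else 0)
     else (if k < j then - (fst w ^ (j - 1 - k) * (1 / snd w ^ (j - 1 - k + 1))) else 0))"

definition chart :: "bool \<Rightarrow> nat \<Rightarrow> nat" where
  "chart b n = (if b then n else 0)"

lemma ann_inverse_right:
  assumes "line_coord b w \<noteq> 0"
  shows "fst w * ann_inverse b w j k - snd w * ann_inverse b w (Suc j) k = (if j = k then 1 else 0)"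
proof (cases b)
  case True
  then have s: "fst w \<noteq> 0" using assms by (simp add: line_coord_def)
  consider "j < k" | "j = k" | "k < j" by linarith
  then show ?thesis
  proof cases
    case 1
    then obtain m where "k = Suc (j + m)" using less_iff_Suc_add by blast
    then show ?thesis using True s by (simp add: ann_inverse_def field_simps)
  qed (use True s in \<open>auto simp: ann_inverse_def\<close>)
next
  case False
  then have t: "snd w \<noteq> 0" using assms by (simp add: line_coord_def)
  consider "j < k" | "j = k" | "k < j" by linarith
  then show ?thesis
  proof cases
    case 3
    then obtain m where "j = Suc (k + m)" using less_iff_Suc_add by blast
    then show ?thesis using False t by (simp add: ann_inverse_def field_simps)
  qed (use False t in \<open>auto simp: ann_inverse_def\<close>)
qed

lemma ann_inverse_chart: "k < n \<Longrightarrow> ann_inverse b w (chart b n) k = 0"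
  by (simp add: ann_inverse_def chart_def)

lemma recurrence_zero:
  assumes "line_coord b w \<noteq> 0" "x (chart b n) = 0"
    and rec: "\<And>k. k < n \<Longrightarrow> fst w * x k - snd w * x (Suc k) = 0" and "j \<le> n"
  shows "x j = 0"
proof (cases b)
  case True
  have "x (n - m) = 0" if "m \<le> n" for m
    using that
  proof (induction m)
    case 0 then show ?case using assms(2) True by (simp add: chart_def)
  next
    case (Suc m)
    then have "Suc (n - Suc m) = n - m" by simp
    then show ?case using Suc rec[of "n - Suc m"] assms(1) True by (simp add: line_coord_def)
  qed
  from this[of "n - j"] show ?thesis using \<open>j \<le> n\<close> by simp
next
  case False
  show ?thesis using \<open>j \<le> n\<close>
  proof (induction j)
    case 0 then show ?case using assms(2) False by (simp add: chart_def)
  next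
    case (Suc j)
    then show ?case using rec[of j] assms(1) False by (simp add: line_coord_def)
  qed
qed

text \<open>
  Both sides solve the same recurrence with the same value at the end, and a solution is unique by
  \<open>recurrence_zero\<close>.
\<close>

lemma ann_inverse_left:
  assumes "line_coord b w \<noteq> 0" "x (chart b n) = 0" "j \<le> n"
  shows "x j = (\<Sum>k<n. ann_inverse b w j k * (fst w * x k - snd w * x (Suc k)))"
proof -
  define y where "y k = fst w * x k - snd w * x (Suc k)" for k
  define d where "d j = x j - (\<Sum>k<n. ann_inverse b w j k * y k)" for j
  have "d j = 0"
  proof (rule recurrence_zero[where n = n and b = b and w = w and x = d, OF assms(1) _ _ assms(3)])
    show "d (chart b n) = 0" using assms(2) by (simp add: d_def ann_inverse_chart)
    fix i assume i: "i < n"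
    have "fst w * d i - snd w * d (Suc i)
        = y i - (\<Sum>k<n. (fst w * ann_inverse b w i k - snd w * ann_inverse b w (Suc i) k) * y k)"
      by (simp add: d_def y_def left_diff_distrib sum_subtractf right_diff_distrib sum_distrib_left mult.assoc)
    also have "\<dots> = y i - (\<Sum>k<n. if k = i then y k else 0)"
      unfolding ann_inverse_right[OF assms(1)] by (intro arg_cong2[of _ _ _ _ "(-)"] refl sum.cong) auto
    finally show "fst w * d i - snd w * d (Suc i) = 0" using i by simp
  qed
  then show ?thesis by (simp add: d_def y_def)
qed

lemma ann_inverse_ratio:
  fixes w0 :: "'k::field_char_0 \<times> 'k"
  assumes "w0 \<noteq> 0" "line_coord b w0 \<noteq> 0"
  shows "P.ratio_at (P.span {w0}) (-1) (\<lambda>_ w. ann_inverse b w j k)"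
proof -
  let ?p = "P.span {w0}"
  have p: "?p \<in> proj_points plane_scale" using P.span_proj_point[OF assms(1)] .
  have pw: "(\<lambda>w. line_coord b' w ^ m) \<in> forms plane_scale m" for b' m
    using P.form_power[OF line_coord_form, of b' m] by simp
  have "P.ratio_at ?p (int m + - int (m + 1)) (\<lambda>_ w. line_coord (\<not> b) w ^ m * (1 / line_coord b w ^ (m + 1)))" for m
    by (intro P.ratio_at_mult P.ratio_at_form[OF pw p] P.ratio_at_inverse_form[OF pw assms(1)])
      (use assms(2) in auto)
  then have *: "P.ratio_at ?p (-1) (\<lambda>_ w. line_coord (\<not> b) w ^ m * (1 / line_coord b w ^ (m + 1)))" for m
    by simp
  show ?thesis
  proof (cases b)
    case True
    then show ?thesis
      using *[of "k - j"] P.ratio_at_zero[OF p, of "-1"]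
      by (cases "j \<le> k") (simp_all add: ann_inverse_def line_coord_def)
  next
    case False
    then show ?thesis
      using P.ratio_at_minus[OF *[of "j - 1 - k"]] P.ratio_at_zero[OF p, of "-1"]
      by (cases "k < j") (simp_all add: ann_inverse_def line_coord_def)
  qed
qed

text \<open>
  The coordinates are now adapted to the curve \<open>r\<close>, on which they are the monomials of degree \<open>n\<close>.
\<close>

locale rnc_coordinates = veronese_coordinates sV sS q n c e z
  for sV :: "'k::field_char_0 \<Rightarrow> 'v::ab_group_add \<Rightarrow> 'v"
    and sS :: "'k \<Rightarrow> 's::ab_group_add \<Rightarrow> 's" and q n c e z +
  fixes r :: "'k \<times> 'k \<Rightarrow> 'v" and rnc :: "('k \<times> 'k) set \<Rightarrow> 'v set" and veronese :: "'v set \<Rightarrow> 's set"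
  assumes r_form: "linear_functional sV l \<Longrightarrow> (\<lambda>w. l (r w)) \<in> forms plane_scale n"
    and c_r: "j \<le> n \<Longrightarrow> c j (r w) = fst w ^ j * snd w ^ (n - j)"
    and rnc_span: "w \<noteq> 0 \<Longrightarrow> rnc (P.span {w}) = V.span {r w}"
    and veronese_span: "v \<noteq> 0 \<Longrightarrow> veronese (V.span {v}) = S.span {q v}"
begin

abbreviation "ch b \<equiv> chart b n"

lemma ch_le: "ch b \<le> n" by (simp add: chart_def)

lemma c_ch_r: "c (ch b) (r w) = line_coord b w ^ n"
  by (simp add: c_r chart_def line_coord_def)

lemma r_nonzero: "w \<noteq> 0 \<Longrightarrow> r w \<noteq> 0"
  using c_ch_r[of "fst w \<noteq> 0" w] line_coord_nonzero[of w] V.linear_functional_zero[OF c_linear[OF ch_le]]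
  by (metis power_not_zero)

lemma point: "w \<noteq> 0 \<Longrightarrow> veronese (rnc (P.span {w})) = S.span {q (r w)}"
  by (simp add: rnc_span veronese_span r_nonzero)

lemma annihilator_c_r: "i < n \<Longrightarrow> (\<Sum>j\<le>n. annihilator w i j * c j (r w)) = 0"
proof -
  assume i: "i < n"
  then have "n - i = Suc (n - Suc i)" by simp
  then show ?thesis using i by (simp add: annihilator_sum c_r)
qed

definition pairing :: "bool \<Rightarrow> (('s set \<Rightarrow> 'k) \<Rightarrow> 'k) \<Rightarrow> 'k \<times> 'k \<Rightarrow> nat \<Rightarrow> nat \<Rightarrow> 'k" where
  "pairing b \<nu> w i k = (\<Sum>j\<le>n. \<Sum>l\<le>n. annihilator w i j * annihilator w k l * \<nu> (eqn (ch b) j l))"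

text \<open>
  The pairing of a normal vector at \<open>r w\<close>, twisted by \<open>c\<^sub>o (r w)\<^sup>2\<close> so that it becomes independent of the
  chart. The chart chosen here depends on the line spanned by \<open>w\<close> only.
\<close>

definition coeff_at :: "(('s set \<Rightarrow> 'k) \<Rightarrow> 'k) \<Rightarrow> 'k \<times> 'k \<Rightarrow> nat \<Rightarrow> nat \<Rightarrow> 'k" where
  "coeff_at \<nu> w i k = line_coord (fst w \<noteq> 0) w ^ (2 * n) * pairing (fst w \<noteq> 0) \<nu> w i k"

abbreviation nspace :: "'k \<times> 'k \<Rightarrow> (('s set \<Rightarrow> 'k) \<Rightarrow> 'k) set" where
  "nspace w \<equiv> normal_space (proj sS) X (S.span {q (r w)})"

lemma coeff_at_eq:
  assumes "w \<noteq> 0" "line_coord b w \<noteq> 0" "\<nu> \<in> nspace w" "i < n" "k < n"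
  shows "coeff_at \<nu> w i k = line_coord b w ^ (2 * n) * pairing b \<nu> w i k"
proof -
  have "c (ch (fst w \<noteq> 0)) (r w) \<noteq> 0" "c (ch b) (r w) \<noteq> 0"
    using c_ch_r line_coord_nonzero[OF assms(1)] assms(2) by (metis power_not_zero)+
  from pairing_chart_independent[OF ch_le this(2) ch_le this(1) r_nonzero[OF assms(1)] assms(3)
      annihilator_c_r[OF assms(4)] annihilator_c_r[OF assms(5)]]
  show ?thesis
    unfolding coeff_at_def pairing_def c_ch_r power_mult[symmetric] mult.commute[of n 2] .
qed

lemma pairing_sym: "pairing b \<nu> w i k = pairing b \<nu> w k i"
proof -
  have "pairing b \<nu> w i k = (\<Sum>l\<le>n. \<Sum>j\<le>n. annihilator w i j * annihilator w k l * \<nu> (eqn (ch b) j l))"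
    unfolding pairing_def by (rule sum.swap)
  also have "\<dots> = pairing b \<nu> w k i"
    unfolding pairing_def by (intro sum.cong refl) (simp add: eqn_value_sym mult_ac)
  finally show ?thesis .
qed

lemma coeff_at_sym: "coeff_at \<nu> w i k = coeff_at \<nu> w k i"
  unfolding coeff_at_def using pairing_sym by metis

lemma coeff_at_scale:
  assumes "t \<noteq> 0"
  shows "coeff_at \<nu> (plane_scale t w) i k = t ^ (2 * n + 2) * coeff_at \<nu> w i k"
proof -
  have "(fst (plane_scale t w) \<noteq> 0) = (fst w \<noteq> 0)" using assms by (simp add: plane_scale_def)
  moreover have "pairing b \<nu> (plane_scale t w) i k = t ^ 2 * pairing b \<nu> w i k" for b
    unfolding pairing_def sum_distrib_left annihilator_scale by (simp add: power2_eq_square mult_ac)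
  ultimately show ?thesis
    unfolding coeff_at_def line_coord_scale by (simp add: power_mult_distrib power_add power2_eq_square mult_ac)
qed

lemma pairing_expand:
  assumes "i < n" "k < n"
  shows "pairing b \<nu> w i k = fst w * (fst w * \<nu> (eqn (ch b) i k) - snd w * \<nu> (eqn (ch b) i (Suc k)))
    - snd w * (fst w * \<nu> (eqn (ch b) (Suc i) k) - snd w * \<nu> (eqn (ch b) (Suc i) (Suc k)))"
proof -
  have "pairing b \<nu> w i k = (\<Sum>j\<le>n. annihilator w i j * (\<Sum>l\<le>n. annihilator w k l * \<nu> (eqn (ch b) j l)))"
    unfolding pairing_def sum_distrib_left by (simp add: mult.assoc)
  then show ?thesis by (simp add: annihilator_sum[OF assms(1)] annihilator_sum[OF assms(2)])
qed

text \<open>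
  Solving the recurrence in rows and columns: the products of two of the functionals
  \<open>s c\<^sub>i - t c\<^bsub>i+1\<^esub>\<close> span the conormal space.
\<close>

lemma eqn_value_from_pairing:
  assumes w: "w \<noteq> 0" "line_coord b w \<noteq> 0" and nu: "\<nu> \<in> nspace w" and "j \<le> n" "l \<le> n"
  shows "\<nu> (eqn (ch b) j l) = (\<Sum>i<n. \<Sum>k<n. ann_inverse b w j i * ann_inverse b w l k * pairing b \<nu> w i k)"
proof -
  have z1: "\<nu> (eqn (ch b) (ch b) l) = 0" if "l \<le> n" for l
    using eqn_value_chart_index[OF nu r_nonzero[OF w(1)] ch_le that] .
  then have z2: "\<nu> (eqn (ch b) l (ch b)) = 0" if "l \<le> n" for l
    using eqn_value_sym[OF that ch_le] that by metis
  have "\<nu> (eqn (ch b) j l) = (\<Sum>i<n. ann_inverse b w j i *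
      (fst w * \<nu> (eqn (ch b) i l) - snd w * \<nu> (eqn (ch b) (Suc i) l)))"
    by (rule ann_inverse_left[where x = "\<lambda>j. \<nu> (eqn (ch b) j l)", OF w(2) z1[OF assms(5)] assms(4)])
  also have "\<dots> = (\<Sum>i<n. ann_inverse b w j i * (\<Sum>k<n. ann_inverse b w l k * pairing b \<nu> w i k))"
  proof (intro sum.cong refl arg_cong[of _ _ "(*) _"])
    fix i assume "i \<in> {..<n}"
    then have i: "i < n" "i \<le> n" "Suc i \<le> n" by auto
    let ?x = "\<lambda>l. fst w * \<nu> (eqn (ch b) i l) - snd w * \<nu> (eqn (ch b) (Suc i) l)"
    have "?x l = (\<Sum>k<n. ann_inverse b w l k * (fst w * ?x k - snd w * ?x (Suc k)))"
      by (rule ann_inverse_left[where x = ?x, OF w(2) _ assms(5)]) (simp add: z2 i)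
    also have "\<dots> = (\<Sum>k<n. ann_inverse b w l k * pairing b \<nu> w i k)"
      by (intro sum.cong refl) (simp add: pairing_expand[OF i(1)] algebra_simps)
    finally show "?x l = (\<Sum>k<n. ann_inverse b w l k * pairing b \<nu> w i k)" .
  qed
  finally show ?thesis by (simp add: sum_distrib_left mult.assoc)
qed

lemma eqn_value_from_coeff:
  assumes w: "w \<noteq> 0" "line_coord b w \<noteq> 0" and nu: "\<nu> \<in> nspace w" and "j \<le> n" "l \<le> n"
  shows "\<nu> (eqn (ch b) j l)
    = (\<Sum>i<n. \<Sum>k<n. ann_inverse b w j i * ann_inverse b w l k * (coeff_at \<nu> w i k * (1 / line_coord b w ^ (2 * n))))"
proof -
  have "coeff_at \<nu> w i k * (1 / line_coord b w ^ (2 * n)) = pairing b \<nu> w i k" if "i < n" "k < n" for i k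
    using coeff_at_eq[OF w nu that] w(2) by simp
  then show ?thesis unfolding eqn_value_from_pairing[OF assms] by simp
qed

lemma coeff_at_injective:
  assumes w: "w \<noteq> 0" and nu: "\<nu> \<in> nspace w" "\<nu>' \<in> nspace w"
    and eq: "\<And>i k. i < n \<Longrightarrow> k < n \<Longrightarrow> coeff_at \<nu> w i k = coeff_at \<nu>' w i k"
  shows "\<nu> = \<nu>'"
proof -
  let ?b = "fst w \<noteq> 0"
  have h: "line_coord ?b w \<noteq> 0" using line_coord_nonzero[OF w] .
  then have c: "c (ch ?b) (r w) \<noteq> 0" using c_ch_r by (metis power_not_zero)
  have "\<nu> (eqn (ch ?b) j l) = \<nu>' (eqn (ch ?b) j l)" if "j \<le> n" "l \<le> n" for j l
    unfolding eqn_value_from_coeff[OF w h nu(1) that] eqn_value_from_coeff[OF w h nu(2) that]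
    using eq by simp
  then have "combination (ch ?b) (\<lambda>j k. \<nu> (eqn (ch ?b) j k)) (S.span {q (r w)})
      = combination (ch ?b) (\<lambda>j k. \<nu>' (eqn (ch ?b) j k)) (S.span {q (r w)})"
    unfolding combination_def by (intro ext sum.cong refl) auto
  then show ?thesis
    using normal_vector_expansion[OF ch_le r_nonzero[OF w] c nu(1)]
      normal_vector_expansion[OF ch_le r_nonzero[OF w] c nu(2)] by metis
qed

text \<open>
  The matrix of values \<open>M\<close> is obtained from \<open>T\<close> by solving the recurrence in rows and columns. It
  vanishes in the row of the chart by construction, so it is realised by a normal vector.
\<close>

lemma coeff_at_surjective:
  assumes w: "w \<noteq> 0" and sym: "\<And>i k. i < n \<Longrightarrow> k < n \<Longrightarrow> T i k = T k i"
  shows "\<exists>\<nu>\<in>nspace w. \<forall>i<n. \<forall>k<n. coeff_at \<nu> w i k = T i k"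
proof -
  let ?b = "fst w \<noteq> 0"
  have h: "line_coord ?b w \<noteq> 0" using line_coord_nonzero[OF w] .
  then have c: "c (ch ?b) (r w) \<noteq> 0" using c_ch_r by (metis power_not_zero)
  define M where "M j l = (\<Sum>i<n. ann_inverse ?b w j i * (\<Sum>k<n. ann_inverse ?b w l k * T i k)) / line_coord ?b w ^ (2 * n)" for j l
  have M_sym: "M j l = M l j" for j l
  proof -
    have "(\<Sum>i<n. ann_inverse ?b w j i * (\<Sum>k<n. ann_inverse ?b w l k * T i k))
        = (\<Sum>k<n. \<Sum>i<n. ann_inverse ?b w j i * (ann_inverse ?b w l k * T i k))"
      unfolding sum_distrib_left by (rule sum.swap)
    also have "\<dots> = (\<Sum>k<n. ann_inverse ?b w l k * (\<Sum>i<n. ann_inverse ?b w j i * T k i))"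
      unfolding sum_distrib_left using sym by (intro sum.cong refl) (simp add: mult_ac)
    finally show ?thesis by (simp add: M_def)
  qed
  have M_zero: "M (ch ?b) k = 0" for k unfolding M_def by (simp add: ann_inverse_chart)
  define \<nu> where "\<nu> = combination (ch ?b) M (S.span {q (r w)})"
  have nu: "\<nu> \<in> nspace w"
    unfolding \<nu>_def by (rule combination_in_normal_space[OF ch_le r_nonzero[OF w]])
  have val: "\<nu> (eqn (ch ?b) j l) = M j l" if "j \<le> n" "l \<le> n" for j l
    unfolding \<nu>_def
    by (rule combination_eqn[where M = M, OF ch_le r_nonzero[OF w] c that M_sym M_zero])
  have inv: "fst w * (\<Sum>i<n. ann_inverse ?b w j i * f i) - snd w * (\<Sum>i<n. ann_inverse ?b w (Suc j) i * f i) = f j"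
    if "j < n" for j f
  proof -
    have "fst w * (\<Sum>i<n. ann_inverse ?b w j i * f i) - snd w * (\<Sum>i<n. ann_inverse ?b w (Suc j) i * f i)
        = (\<Sum>i<n. (fst w * ann_inverse ?b w j i - snd w * ann_inverse ?b w (Suc j) i) * f i)"
      by (simp add: left_diff_distrib sum_subtractf sum_distrib_left mult.assoc)
    also have "\<dots> = (\<Sum>i<n. if i = j then f i else 0)"
      unfolding ann_inverse_right[OF h] by (intro sum.cong) auto
    finally show ?thesis using that by simp
  qed
  have "coeff_at \<nu> w i k = T i k" if "i < n" "k < n" for i k
  proof -
    let ?h = "line_coord ?b w ^ (2 * n)"
    have l: "fst w * M j l - snd w * M j (Suc l) = M' j l"
      if "M' = (\<lambda>j l. (\<Sum>i<n. ann_inverse ?b w j i * T i l) / ?h)" "l < n" for j l M'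
    proof -
      have "fst w * M j l - snd w * M j (Suc l) = (\<Sum>i<n. ann_inverse ?b w j i *
          (fst w * (\<Sum>k<n. ann_inverse ?b w l k * T i k) - snd w * (\<Sum>k<n. ann_inverse ?b w (Suc l) k * T i k))) / ?h"
        unfolding M_def
        by (simp add: right_diff_distrib sum_subtractf sum_distrib_left diff_divide_distrib mult_ac)
      then show ?thesis unfolding inv[OF that(2)] that(1) .
    qed
    have "pairing ?b \<nu> w i k = fst w * (fst w * M i k - snd w * M i (Suc k))
        - snd w * (fst w * M (Suc i) k - snd w * M (Suc i) (Suc k))"
      unfolding pairing_expand[OF that] using val that by simp
    also have "\<dots> = (fst w * (\<Sum>j<n. ann_inverse ?b w i j * T j k) - snd w * (\<Sum>j<n. ann_inverse ?b w (Suc i) j * T j k)) / ?h"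
      unfolding l[OF refl that(2)] by (simp add: diff_divide_distrib)
    also have "\<dots> = T i k / ?h" unfolding inv[OF that(1)] ..
    finally show ?thesis unfolding coeff_at_def using h by simp
  qed
  then show ?thesis using nu by blast
qed

end

context rnc_coordinates
begin

abbreviation restricted_normal_bundle :: "(('k \<times> 'k) set, 's set \<Rightarrow> 'k, 'k) vector_bundle" where
  "restricted_normal_bundle \<equiv> pullback proj_line rnc
    (restrict_bundle (pullback (proj sV) veronese (normal_bundle (proj sS) X)) (rnc ` proj_points plane_scale))"

lemma image_veronese: "veronese ` proj_points sV = X"
proof
  show "veronese ` proj_points sV \<subseteq> X"
    by (auto elim!: V.proj_pointE simp: veronese_span span_q_in_X)
  show "X \<subseteq> veronese ` proj_points sV"
    unfolding X_def using veronese_span V.span_proj_point by blast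
qed

lemma rnc_point: "p \<in> proj_points plane_scale \<Longrightarrow> rnc p \<in> proj_points sV"
  by (auto elim!: P.proj_pointE simp: rnc_span r_nonzero intro!: V.span_proj_point)

lemma fibre_restricted:
  "fibre restricted_normal_bundle p = normal_space (proj sS) X (veronese (rnc p))"
  by (simp add: pullback_def restrict_bundle_def normal_bundle_def)

lemma base_restricted: "base restricted_normal_bundle = proj plane_scale"
  by (simp add: pullback_def)

lemma morph_rnc:
  assumes "p \<in> proj_points plane_scale"
  shows "P.morph_at rnc (proj sV) p"
proof (rule P.morph_at_proj[where g = r and e = n, OF V.projective_space_axioms _ r_nonzero rnc_span assms])
  show "(\<lambda>w. F (r w)) \<in> forms plane_scale (d * n)" if "F \<in> forms sV d" for F d
    by (rule form_compose[OF P.projective_space_axioms V.projective_space_axioms r_form that])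
qed

lemma morph_veronese_rnc:
  assumes "p \<in> proj_points plane_scale"
  shows "P.morph_at (\<lambda>p. veronese (rnc p)) (proj sS) p"
proof (rule P.morph_at_proj[where g = "\<lambda>w. q (r w)" and e = "2 * n", OF S.projective_space_axioms _ _ point assms])
  fix F d assume F: "F \<in> forms sS d"
  have "(\<lambda>w. F (q (r w))) \<in> forms plane_scale (d * 2 * n)"
    by (rule form_compose[OF P.projective_space_axioms V.projective_space_axioms r_form form_comp_q[OF F]])
  then show "(\<lambda>w. F (q (r w))) \<in> forms plane_scale (d * (2 * n))" by (simp add: mult.assoc)
qed (use r_nonzero q_nonzero in auto)

text \<open>
  By definition of the normal bundle, a section maps the function \<open>eqn\<close>, which is fixed as long as the
  chart is, to a regular function on \<open>X\<close>. This survives the three pullbacks.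
\<close>

lemma section_eqn_ratio:
  assumes w: "w0 \<noteq> 0" "line_coord b w0 \<noteq> 0" and jk: "j \<le> n" "k \<le> n"
    and U: "openin (zariski_proj plane_scale) U" "P.span {w0} \<in> U"
    and \<sigma>: "\<sigma> \<in> sections restricted_normal_bundle U"
  shows "P.ratio_at (P.span {w0}) 0 (\<lambda>L _. \<sigma> L (eqn (ch b) j k))"
proof -
  let ?p = "P.span {w0}" and ?f = "eqn (ch b) j k" and ?D = "S.basic (z (ch b) (ch b))"
  have p: "?p \<in> proj_points plane_scale" using P.span_proj_point[OF w(1)] .
  have x: "veronese (rnc ?p) \<in> ?D"
    using chart_point[OF ch_le r_nonzero[OF w(1)]] w(2) by (simp add: point[OF w(1)] c_ch_r)
  have sub: "P.morph_at (\<lambda>p. veronese (rnc p)) (subvariety (proj sS) X) ?p"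
  proof (rule P.morph_at_subvariety[OF morph_veronese_rnc[OF p] p])
    show "veronese (rnc L) \<in> X" if "L \<in> proj_points plane_scale" for L
      using rnc_point[OF that] image_veronese by blast
  qed
  have zb: "zariski (base (normal_bundle (proj sS) X)) = subtopology (zariski_proj sS) X"
    by (simp add: normal_bundle_def subvariety_def)
  have level0: "P.ratio_at ?p 0 (\<lambda>L _. \<tau> (veronese (rnc L)) ?f)"
    if V: "openin (subtopology (zariski_proj sS) X) V" "veronese (rnc ?p) \<in> V"
      and \<tau>: "\<tau> \<in> sections (normal_bundle (proj sS) X) V" for V \<tau>
  proof -
    have reg: "(\<lambda>x. \<tau> x ?f) \<in> regular (subvariety (proj sS) X) (V \<inter> ?D)"
      using \<tau> open_chart[OF ch_le] eqn_regular[OF ch_le jk] eqn_vanishes[OF ch_le jk]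
      unfolding normal_bundle_def vector_bundle.simps mem_Collect_eq S.zariski_of_proj by blast
    have "openin (zariski (subvariety (proj sS) X)) (V \<inter> ?D)"
      using V(1) open_chart[OF ch_le] by (auto simp: subvariety_def openin_subtopology)
    from P.morph_atD(2)[OF sub this _ reg] V(2) x show ?thesis by simp
  qed
  let ?E1 = "pullback (proj sV) veronese (normal_bundle (proj sS) X)"
  have zb1: "zariski (base ?E1) = zariski_proj sV" by (simp add: pullback_def)
  have level1: "P.ratio_at ?p 0 (\<lambda>L _. \<tau> (rnc L) ?f)"
    if V: "openin (zariski_proj sV) V" "rnc ?p \<in> V" and \<tau>: "\<tau> \<in> sections ?E1 V" for V \<tau>
    by (rule P.pullback_section_ratio[OF morph_rnc[OF p] p _ _ V(2) \<tau>])
      (use level0 V zb in auto)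
  let ?R = "rnc ` proj_points plane_scale"
  let ?E2 = "restrict_bundle ?E1 ?R"
  have subR: "P.morph_at rnc (subvariety (proj sV) ?R) ?p"
    by (rule P.morph_at_subvariety[OF morph_rnc[OF p] p]) auto
  have b1: "base ?E1 = proj sV" by (simp add: pullback_def)
  have level2: "P.ratio_at ?p 0 (\<lambda>L _. \<tau> (rnc L) ?f)"
    if V: "openin (zariski (base ?E2)) V" "rnc ?p \<in> V" and \<tau>: "\<tau> \<in> sections ?E2 V" for V \<tau>
  proof -
    have "openin (zariski (subvariety (proj sV) ?R)) V"
      using V(1) unfolding restrict_bundle_def b1 by (simp add: pullback_def)
    from P.pullback_section_ratio[where f = "\<lambda>p. p" and h = rnc, OF subR p _ this V(2) \<tau>[unfolded restrict_bundle_def b1]]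
    show ?thesis using level1 unfolding zb1 by blast
  qed
  show ?thesis
    using P.pullback_section_ratio[where f = rnc and h = "\<lambda>L. L" and \<alpha> = ?f, OF P.morph_at_id p _ _ U(2) \<sigma>] level2 U(1)
    by simp
qed

text \<open>
  The expansion of \<open>\<sigma>\<close> in the sections \<open>deriv_normal\<close>, which are pulled back from \<open>X\<close>, has the values on
  the \<open>eqn\<close> as coefficients.
\<close>

lemma section_if_eqn_ratio:
  assumes U: "openin (zariski_proj plane_scale) U"
    and fib: "\<And>p. p \<in> U \<Longrightarrow> \<sigma> p \<in> normal_space (proj sS) X (veronese (rnc p))"
    and ratio: "\<And>w b j k. w \<noteq> 0 \<Longrightarrow> P.span {w} \<in> U \<Longrightarrow> line_coord b w \<noteq> 0 \<Longrightarrow> j \<le> n \<Longrightarrow> k \<le> n \<Longrightarrow>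
      P.ratio_at (P.span {w}) 0 (\<lambda>L _. \<sigma> L (eqn (ch b) j k))"
  shows "\<sigma> \<in> sections restricted_normal_bundle U"
proof (rule pullback_sectionI)
  fix p assume p: "p \<in> U"
  then obtain w0 where w0: "w0 \<noteq> 0" "p = P.span {w0}"
    using P.open_imp_proj_points[OF U] P.proj_pointE by blast
  define b where "b = (fst w0 \<noteq> 0)"
  have h0: "line_coord b w0 \<noteq> 0" unfolding b_def by (rule line_coord_nonzero[OF w0(1)])
  define U' where "U' = U \<inter> P.basic (line_coord b)"
  let ?R = "rnc ` proj_points plane_scale"
  let ?N = "normal_bundle (proj sS) X"
  let ?E1 = "pullback (proj sV) veronese ?N"
  let ?E2 = "restrict_bundle ?E1 ?R"
  define \<tau> where "\<tau> i = S.deriv_normal X (z (ch b) (ch b)) (dir (fst i) (snd i))" for i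
  define g where "g i L = \<sigma> L (eqn (ch b) (fst i) (snd i))" for i L
  have U': "openin (zariski_proj plane_scale) U'" "p \<in> U'" "U' \<subseteq> U"
    using U P.open_basic[OF line_coord_form] p P.span_in_basic[OF line_coord_form w0(1)] h0 w0(2)
    by (auto simp: U'_def)
  have w: "\<exists>w. w \<noteq> 0 \<and> L = P.span {w} \<and> line_coord b w \<noteq> 0 \<and> L \<in> U" if "L \<in> U'" for L
  proof -
    have "L \<in> proj_points plane_scale" by (rule P.open_imp_proj_points[OF U'(1) that])
    then obtain w where "w \<noteq> 0" "L = P.span {w}" by (rule P.proj_pointE)
    then show ?thesis using that P.span_in_basic[OF line_coord_form] U'_def by blast
  qed
  have XX: "openin (subtopology (zariski_proj sS) X) X"
    using X_points by (auto simp: openin_subtopology_refl S.topspace_zariski)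
  have VV: "openin (zariski_proj sV) (proj_points sV)"
    using openin_topspace[of "zariski_proj sV"] by (simp add: V.topspace_zariski)
  have s0: "\<tau> i \<in> sections ?N X" for i
    unfolding \<tau>_def by (rule S.deriv_normal_section[OF X_points z_linear[OF ch_le ch_le] subset_refl])
  have one: "(\<lambda>_. 1) \<in> regular (proj sV) (proj_points sV)"
    unfolding V.regular_proj_iff[OF VV] using V.ratio_at_one by blast
  have s1: "(\<lambda>y. \<tau> i (veronese y)) \<in> sections ?E1 (proj_points sV)" for i
    by (rule pullback_section_comp[OF _ _ _ s0 one])
      (use VV XX image_veronese in \<open>auto simp: normal_bundle_def subvariety_def\<close>)
  have b1: "base ?E1 = proj sV" by (simp add: pullback_def)
  have RR: "openin (subtopology (zariski_proj sV) ?R) ?R"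
    using rnc_point by (auto simp: openin_subtopology_refl V.topspace_zariski)
  have oneR: "(\<lambda>_. 1) \<in> regular (subvariety (proj sV) ?R) ?R"
  proof -
    have "\<exists>W. \<exists>g\<in>regular (proj sV) W. openin (zariski_proj sV) W \<and> y \<in> W \<and> (\<forall>q\<in>W \<inter> ?R. 1 = g q)"
      if "y \<in> ?R" for y
      using that rnc_point VV one by (intro exI[of _ "proj_points sV"] bexI[of _ "\<lambda>_. 1"]) auto
    then show ?thesis unfolding subvariety_def variety.simps mem_Collect_eq V.zariski_of_proj by blast
  qed
  have s2: "(\<lambda>y. \<tau> i (veronese y)) \<in> sections ?E2 ?R" for i
    unfolding restrict_bundle_def b1
    by (rule pullback_section_comp[where f = "\<lambda>y. y", OF _ _ _ s1 oneR])
      (use RR VV rnc_point in \<open>auto simp: subvariety_def b1\<close>)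
  have b2: "zariski (base ?E2) = subtopology (zariski_proj sV) ?R"
    unfolding restrict_bundle_def b1 by (simp add: pullback_def subvariety_def)
  have reg: "g i \<in> regular proj_line U'" if "i \<in> {..n} \<times> {..n}" for i
    unfolding P.regular_proj_iff[OF U'(1)]
  proof
    fix L assume "L \<in> U'"
    then obtain w where "w \<noteq> 0" "L = P.span {w}" "line_coord b w \<noteq> 0" "L \<in> U" using w by blast
    then show "P.ratio_at L 0 (\<lambda>L _. g i L)"
      unfolding g_def using ratio that by (metis SigmaE atMost_iff fst_conv snd_conv)
  qed
  have exp: "\<sigma> L = (\<lambda>f. \<Sum>i\<in>{..n} \<times> {..n}. g i L * \<tau> i (veronese (rnc L)) f)" if L: "L \<in> U'" for L
  proof -
    obtain w where w: "w \<noteq> 0" "L = P.span {w}" "line_coord b w \<noteq> 0" "L \<in> U" using w[OF L] by blast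
    have "c (ch b) (r w) \<noteq> 0" using w(3) by (simp add: c_ch_r)
    from normal_vector_expansion[OF ch_le r_nonzero[OF w(1)] this, of "\<sigma> L"] fib[OF w(4)]
    have "\<sigma> L = combination (ch b) (\<lambda>j k. \<sigma> L (eqn (ch b) j k)) (veronese (rnc L))"
      unfolding w(2) point[OF w(1)] by blast
    also have "\<dots> = (\<lambda>f. \<Sum>i\<in>{..n} \<times> {..n}. g i L * \<tau> i (veronese (rnc L)) f)"
      by (rule ext) (simp add: combination_def g_def \<tau>_def case_prod_unfold)
    finally show ?thesis .
  qed
  show "\<exists>U' V. \<exists>A::(nat \<times> nat) set. \<exists>g \<tau>. finite A \<and>
    openin (zariski proj_line) U' \<and> p \<in> U' \<and> U' \<subseteq> U \<and> openin (zariski (base ?E2)) V \<and> rnc ` U' \<subseteq> V \<and>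
    (\<forall>i\<in>A. g i \<in> regular proj_line U' \<and> \<tau> i \<in> sections ?E2 V) \<and>
    (\<forall>L\<in>U'. \<sigma> L = (\<lambda>f. \<Sum>i\<in>A. g i L * \<tau> i (rnc L) f))"
  proof (intro exI conjI)
    show "finite ({..n} \<times> {..n})" by simp
    show "openin (zariski proj_line) U'" using U'(1) by simp
    show "openin (zariski (base ?E2)) ?R" unfolding b2 by (rule RR)
    show "rnc ` U' \<subseteq> ?R" using P.open_imp_proj_points[OF U'(1)] by blast
    show "\<forall>i\<in>{..n} \<times> {..n}. g i \<in> regular proj_line U' \<and> (\<lambda>y. \<tau> i (veronese y)) \<in> sections ?E2 ?R"
      using reg s2 by blast
    show "\<forall>L\<in>U'. \<sigma> L = (\<lambda>f. \<Sum>i\<in>{..n} \<times> {..n}. g i L * \<tau> i (veronese (rnc L)) f)" using exp by blast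
  qed (rule U')+
qed

text \<open>
  The isomorphism on fibres. The function \<open>\<pi>\<close> enumerates the unordered pairs of indices of the
  functionals \<open>s c\<^sub>i - t c\<^bsub>i+1\<^esub>\<close>.
\<close>

definition frame_map :: "(nat \<Rightarrow> nat \<times> nat) \<Rightarrow> nat set \<Rightarrow> ('k \<times> 'k) set \<Rightarrow> (('s set \<Rightarrow> 'k) \<Rightarrow> 'k) \<Rightarrow> nat \<times> 'k \<times> 'k \<Rightarrow> 'k" where
  "frame_map \<pi> I p \<nu> = (\<lambda>(i, w). if i \<in> I \<and> w \<in> p - {0} then coeff_at \<nu> w (fst (\<pi> i)) (snd (\<pi> i)) else 0)"

lemma fibre_twist_sum:
  fixes p :: "('k \<times> 'k) set"
  shows "fibre (direct_sum proj_line I (\<lambda>i. twist plane_scale (2 * int n + 2))) p =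
    {x. \<forall>i w. (i \<notin> I \<or> w \<notin> p - {0} \<longrightarrow> x (i, w) = 0) \<and>
      (i \<in> I \<and> w \<in> p - {0} \<longrightarrow> (\<forall>t. t \<noteq> 0 \<longrightarrow> x (i, plane_scale t w) = t ^ (2 * n + 2) * x (i, w)))}"
proof -
  have "t powi (2 * int n + 2) = t ^ (2 * n + 2)" for t :: 'k
  proof -
    have "2 * int n + 2 = int (2 * n + 2)" by simp
    then show ?thesis by (metis power_int_of_nat)
  qed
  note powi = this
  show ?thesis
    unfolding direct_sum_def twist_def Let_def vector_bundle.simps powi by (auto 4 4)
qed

lemma coeff_at_add: "coeff_at (\<lambda>f. \<nu> f + \<nu>' f) w i k = coeff_at \<nu> w i k + coeff_at \<nu>' w i k"
  by (simp add: coeff_at_def pairing_def distrib_left sum.distrib)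

lemma coeff_at_mult: "coeff_at (\<lambda>f. t * \<nu> f) w i k = t * coeff_at \<nu> w i k"
  by (simp add: coeff_at_def pairing_def sum_distrib_left mult_ac)

text \<open>
  Near \<open>w0\<close> the chart can be fixed. Then the factor \<open>c\<^sub>o (r w)\<^sup>2\<close> contributes degree \<open>2n\<close>, and each of the
  two functionals contributes degree \<open>1\<close>.
\<close>

lemma coeff_ratio:
  assumes w: "w0 \<noteq> 0" "line_coord b w0 \<noteq> 0"
    and U: "openin (zariski_proj plane_scale) U" "P.span {w0} \<in> U"
    and fib: "\<And>p. p \<in> U \<Longrightarrow> \<sigma> p \<in> normal_space (proj sS) X (veronese (rnc p))"
    and ratio: "\<And>j k. j \<le> n \<Longrightarrow> k \<le> n \<Longrightarrow> P.ratio_at (P.span {w0}) 0 (\<lambda>L _. \<sigma> L (eqn (ch b) j k))"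
    and ik: "i < n" "k < n"
  shows "P.ratio_at (P.span {w0}) (2 * int n + 2) (\<lambda>L w. coeff_at (\<sigma> L) w i k)"
proof -
  let ?p = "P.span {w0}"
  have p: "?p \<in> proj_points plane_scale" using P.span_proj_point[OF w(1)] .
  have pw: "(\<lambda>w. line_coord b w ^ (2 * n)) \<in> forms plane_scale (2 * n)"
    using P.form_power[OF line_coord_form, of b "2 * n"] by simp
  have "P.ratio_at ?p (int 1 + int 1 + 0) (\<lambda>L w. annihilator w i j * annihilator w k l * \<sigma> L (eqn (ch b) j l))"
    if "j \<in> {..n}" "l \<in> {..n}" for j l
    using ratio that by (intro P.ratio_at_mult P.ratio_at_form annihilator_form p) auto
  then have "P.ratio_at ?p (int 1 + int 1 + 0) (\<lambda>L w. pairing b (\<sigma> L) w i k)"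
    unfolding pairing_def by (intro P.ratio_at_sum p)
  then have "P.ratio_at ?p (int (2 * n) + (int 1 + int 1 + 0)) (\<lambda>L w. line_coord b w ^ (2 * n) * pairing b (\<sigma> L) w i k)"
    by (intro P.ratio_at_mult P.ratio_at_form pw p)
  then have "P.ratio_at ?p (2 * int n + 2) (\<lambda>L w. line_coord b w ^ (2 * n) * pairing b (\<sigma> L) w i k)"
    by simp
  moreover have "openin (zariski_proj plane_scale) (U \<inter> P.basic (line_coord b))" "?p \<in> U \<inter> P.basic (line_coord b)"
    using U P.open_basic[OF line_coord_form] P.span_in_basic[OF line_coord_form w(1)] w(2) by auto
  ultimately show ?thesis
  proof (rule P.ratio_at_cong)
    fix L w assume L: "L \<in> U \<inter> P.basic (line_coord b)" "w \<in> L - {0}"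
    have Lw: "L = P.span {w}" "w \<noteq> 0"
      using P.proj_point_eq_span[of L w] L by (auto simp: P.basic_def)
    have "line_coord b w \<noteq> 0" using P.form_nonzero_on_basic[OF line_coord_form] L by blast
    moreover have "\<sigma> L \<in> nspace w" using fib[of L] L point[OF Lw(2)] Lw(1) by simp
    ultimately show "coeff_at (\<sigma> L) w i k = line_coord b w ^ (2 * n) * pairing b (\<sigma> L) w i k"
      using coeff_at_eq[OF Lw(2)] ik by blast
  qed
qed

text \<open>
  The degrees cancel: \<open>ann_inverse\<close> has degree \<open>-1\<close> and occurs twice, \<open>coeff_at\<close> has degree \<open>2n + 2\<close>, and
  it is divided by \<open>c\<^sub>o (r w)\<^sup>2\<close>.
\<close>

lemma eqn_ratio_from_coeff:
  assumes w: "w0 \<noteq> 0" "line_coord b w0 \<noteq> 0"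
    and U: "openin (zariski_proj plane_scale) U" "P.span {w0} \<in> U"
    and fib: "\<And>p. p \<in> U \<Longrightarrow> \<sigma> p \<in> normal_space (proj sS) X (veronese (rnc p))"
    and ratio: "\<And>i k. i < n \<Longrightarrow> k < n \<Longrightarrow>
      P.ratio_at (P.span {w0}) (2 * int n + 2) (\<lambda>L w. coeff_at (\<sigma> L) w i k)"
    and jl: "j \<le> n" "l \<le> n"
  shows "P.ratio_at (P.span {w0}) 0 (\<lambda>L _. \<sigma> L (eqn (ch b) j l))"
proof -
  let ?p = "P.span {w0}"
  have p: "?p \<in> proj_points plane_scale" using P.span_proj_point[OF w(1)] .
  have pw: "(\<lambda>w. line_coord b w ^ (2 * n)) \<in> forms plane_scale (2 * n)"
    using P.form_power[OF line_coord_form, of b "2 * n"] by simp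
  let ?e = "(-1) + (-1) + ((2 * int n + 2) + - int (2 * n))"
  have "P.ratio_at ?p ?e (\<lambda>L w. ann_inverse b w j i * ann_inverse b w l k * (coeff_at (\<sigma> L) w i k * (1 / line_coord b w ^ (2 * n))))"
    if "i \<in> {..<n}" "k \<in> {..<n}" for i k
    using ratio that w(2)
    by (intro P.ratio_at_mult ann_inverse_ratio[OF w] P.ratio_at_inverse_form[OF pw w(1)]) auto
  then have "P.ratio_at ?p ?e (\<lambda>L w. \<Sum>i<n. \<Sum>k<n. ann_inverse b w j i * ann_inverse b w l k *
      (coeff_at (\<sigma> L) w i k * (1 / line_coord b w ^ (2 * n))))"
    by (intro P.ratio_at_sum p)
  then have "P.ratio_at ?p 0 (\<lambda>L w. \<Sum>i<n. \<Sum>k<n. ann_inverse b w j i * ann_inverse b w l k *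
      (coeff_at (\<sigma> L) w i k * (1 / line_coord b w ^ (2 * n))))"
    by simp
  moreover have "openin (zariski_proj plane_scale) (U \<inter> P.basic (line_coord b))" "?p \<in> U \<inter> P.basic (line_coord b)"
    using U P.open_basic[OF line_coord_form] P.span_in_basic[OF line_coord_form w(1)] w(2) by auto
  ultimately show ?thesis
  proof (rule P.ratio_at_cong)
    fix L w assume L: "L \<in> U \<inter> P.basic (line_coord b)" "w \<in> L - {0}"
    have Lw: "L = P.span {w}" "w \<noteq> 0"
      using P.proj_point_eq_span[of L w] L by (auto simp: P.basic_def)
    have h: "line_coord b w \<noteq> 0" using P.form_nonzero_on_basic[OF line_coord_form] L by blast
    have "\<sigma> L \<in> nspace w" using fib[of L] L point[OF Lw(2)] Lw(1) by simp
    from eqn_value_from_coeff[OF Lw(2) h this jl]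
    show "\<sigma> L (eqn (ch b) j l) = (\<Sum>i<n. \<Sum>k<n. ann_inverse b w j i * ann_inverse b w l k *
      (coeff_at (\<sigma> L) w i k * (1 / line_coord b w ^ (2 * n))))" .
  qed
qed

theorem bundle_iso_twist_sum:
  "bundle_iso restricted_normal_bundle
    (direct_sum proj_line {1..n * (n + 1) div 2} (\<lambda>i. twist plane_scale (2 * int n + 2)))"
proof -
  let ?I = "{1..n * (n + 1) div 2}" and ?T = "twist plane_scale (2 * int n + 2) :: (('k \<times> 'k) set, 'k \<times> 'k, 'k) vector_bundle"
  let ?F = "direct_sum proj_line ?I (\<lambda>i. ?T)"
  let ?J = "SIGMA i:{..<n}. {..i}"
  have "(\<Sum>i<m. Suc i) = m * (m + 1) div 2" for m by (induction m) auto
  then have "card ?J = card ?I" by simp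
  then obtain \<pi> where \<pi>: "bij_betw \<pi> ?I ?J" using finite_same_card_bij[of ?I ?J] by auto
  have \<pi>_less: "fst (\<pi> i) < n" "snd (\<pi> i) < n" if "i \<in> ?I" for i
  proof -
    have "\<pi> i \<in> ?J" using bij_betwE[OF \<pi>] that by blast
    then show "fst (\<pi> i) < n" "snd (\<pi> i) < n" by auto
  qed
  have \<pi>_surj: "\<exists>m\<in>?I. \<pi> m = (i, k) \<or> \<pi> m = (k, i)" if "i < n" "k < n" for i k
  proof -
    have "(i, k) \<in> ?J \<or> (k, i) \<in> ?J" using that by auto
    then show ?thesis using \<pi> unfolding bij_betw_def by (metis (no_types, lifting) imageE)
  qed
  define \<phi> where "\<phi> = frame_map \<pi> ?I"
  have \<phi>_val: "\<phi> p \<nu> (i, w) = coeff_at \<nu> w (fst (\<pi> i)) (snd (\<pi> i))" if "i \<in> ?I" "w \<in> p - {0}" for p \<nu> i w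
    using that by (simp add: \<phi>_def frame_map_def)
  have \<phi>_zero: "\<phi> p \<nu> (i, w) = 0" if "i \<notin> ?I \<or> w \<notin> p - {0}" for p \<nu> i w
    using that by (auto simp: \<phi>_def frame_map_def)
  have coeff_from_\<phi>: "\<exists>m\<in>?I. \<forall>p \<nu> w. w \<in> p - {0} \<longrightarrow> \<phi> p \<nu> (m, w) = coeff_at \<nu> w i k"
    if "i < n" "k < n" for i k
  proof -
    have "\<exists>m\<in>?I. \<pi> m = (i, k) \<or> \<pi> m = (k, i)" by (rule \<pi>_surj[OF that])
    then obtain m where m: "m \<in> ?I" "\<pi> m = (i, k) \<or> \<pi> m = (k, i)" by blast
    then have "\<phi> p \<nu> (m, w) = coeff_at \<nu> w i k" if "w \<in> p - {0}" for p \<nu> w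
      using \<phi>_val[OF m(1) that] coeff_at_sym[of \<nu> w i k] by auto
    then show ?thesis using m(1) by blast
  qed
  have scale_in: "plane_scale t w \<in> P.span {w0} - {0}" if "w \<in> P.span {w0} - {0}" "t \<noteq> 0"
    for t :: 'k and w w0
    using P.span_scale[of w "{w0}" t] that by simp
  have \<phi>_fibre: "\<phi> p \<nu> \<in> fibre ?F p" if p: "p \<in> proj_points plane_scale" for p \<nu>
  proof -
    obtain w0 where "p = P.span {w0}" using p by (rule P.proj_pointE)
    then have hom: "\<phi> p \<nu> (i, plane_scale t w) = t ^ (2 * n + 2) * \<phi> p \<nu> (i, w)"
      if "i \<in> ?I" "w \<in> p - {0}" "t \<noteq> 0" for i w t
      using \<phi>_val[OF that(1,2)] \<phi>_val[OF that(1), of "plane_scale t w" p] that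
        scale_in[of w w0 t] coeff_at_scale[OF that(3)] by metis
    show ?thesis
      unfolding fibre_twist_sum
    proof (intro CollectI allI conjI impI)
      show "\<phi> p \<nu> (i, w) = 0" if "i \<notin> ?I \<or> w \<notin> p - {0}" for i w by (rule \<phi>_zero[OF that])
      show "\<phi> p \<nu> (i, plane_scale t w) = t ^ (2 * n + 2) * \<phi> p \<nu> (i, w)"
        if "i \<in> ?I \<and> w \<in> p - {0}" "t \<noteq> 0" for i w t
        by (rule hom[OF conjunct1[OF that(1)] conjunct2[OF that(1)] that(2)])
    qed
  qed
  have fibre_hom: "x (m, plane_scale t w) = t ^ (2 * n + 2) * x (m, w)"
    if "x \<in> fibre ?F p" "m \<in> ?I" "w \<in> p - {0}" "t \<noteq> 0" for x m p w t
    using that unfolding fibre_twist_sum mem_Collect_eq by blast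
  have fibre_zero: "x (m, w) = 0" if "x \<in> fibre ?F p" "m \<notin> ?I \<or> w \<notin> p - {0}" for x m p w
    using that unfolding fibre_twist_sum mem_Collect_eq by blast
  have bij: "bij_betw (\<phi> p) (normal_space (proj sS) X (veronese (rnc p))) (fibre ?F p)"
    if p: "p \<in> proj_points plane_scale" for p
  proof -
    obtain w where w: "w \<noteq> 0" "p = P.span {w}" using p by (rule P.proj_pointE)
    then have wp: "w \<in> p - {0}" using P.in_span_self by blast
    have N: "normal_space (proj sS) X (veronese (rnc p)) = nspace w" using w point by simp
    show ?thesis unfolding N
    proof (intro bij_betw_imageI inj_onI subset_antisym)
      fix \<nu> \<nu>' assume nu: "\<nu> \<in> nspace w" "\<nu>' \<in> nspace w" and eq: "\<phi> p \<nu> = \<phi> p \<nu>'"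
      show "\<nu> = \<nu>'"
      proof (rule coeff_at_injective[OF w(1) nu])
        show "coeff_at \<nu> w i k = coeff_at \<nu>' w i k" if "i < n" "k < n" for i k
          using coeff_from_\<phi>[OF that] wp eq by metis
      qed
    next
      show "\<phi> p ` nspace w \<subseteq> fibre ?F p" using \<phi>_fibre[OF p] by blast
    next
      show "fibre ?F p \<subseteq> \<phi> p ` nspace w"
      proof
        fix x assume x: "x \<in> fibre ?F p"
        \<comment> \<open>The image of \<open>\<pi>\<close> contains one ordering of each pair; the other is filled in by symmetry.\<close>
        define T where "T i k = (if k \<le> i then x (inv_into ?I \<pi> (i, k), w) else x (inv_into ?I \<pi> (k, i), w))" for i k
        have "T i k = T k i" for i k by (cases "i = k") (auto simp: T_def)
        from coeff_at_surjective[OF w(1), of T, OF this]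
        obtain \<nu> where nu: "\<nu> \<in> nspace w" "\<And>i k. i < n \<Longrightarrow> k < n \<Longrightarrow> coeff_at \<nu> w i k = T i k"
          by blast
        have at_w: "\<phi> p \<nu> (m, w) = x (m, w)" if m: "m \<in> ?I" for m
        proof -
          obtain i k where ik: "\<pi> m = (i, k)" by (cases "\<pi> m")
          have "\<pi> m \<in> ?J" using bij_betwE[OF \<pi>] m by blast
          then have "k \<le> i" "i < n" unfolding ik by auto
          moreover have "inv_into ?I \<pi> (i, k) = m"
            using bij_betw_inv_into_left[OF \<pi> m] ik by simp
          ultimately show ?thesis using \<phi>_val[OF m wp, of \<nu>] nu(2)[of i k] ik by (simp add: T_def)
        qed
        have "\<phi> p \<nu> (m, w') = x (m, w')" for m w'
        proof (cases "m \<in> ?I \<and> w' \<in> p - {0}")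
          case True
          then obtain t where t: "t \<noteq> 0" "w' = plane_scale t w" using w(2) P.nonzero_in_span by metis
          have "x (m, w') = t ^ (2 * n + 2) * x (m, w)" "\<phi> p \<nu> (m, w') = t ^ (2 * n + 2) * \<phi> p \<nu> (m, w)"
            using fibre_hom[OF x] fibre_hom[OF \<phi>_fibre[OF p]] True wp t by auto
          then show ?thesis using at_w True by simp
        next
          case False
          then have out: "m \<notin> ?I \<or> w' \<notin> p - {0}" by blast
          show ?thesis unfolding fibre_zero[OF x out] \<phi>_zero[OF out] ..
        qed
        then have "\<phi> p \<nu> = x" by auto
        then show "x \<in> \<phi> p ` nspace w" using nu(1) by blast
      qed
    qed
  qed
  have linear: "\<phi> p (\<lambda>f. \<nu> f + \<nu>' f) = (\<lambda>y. \<phi> p \<nu> y + \<phi> p \<nu>' y)"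
    "\<phi> p (\<lambda>f. t * \<nu> f) = (\<lambda>y. t * \<phi> p \<nu> y)" for p \<nu> \<nu>' t
    by (auto simp: \<phi>_def frame_map_def coeff_at_add coeff_at_mult)
  have sec: "\<sigma> \<in> sections restricted_normal_bundle U \<longleftrightarrow> (\<lambda>p. \<phi> p (\<sigma> p)) \<in> sections ?F U"
    if U: "openin (zariski_proj plane_scale) U"
      and fib: "\<And>p. p \<in> U \<Longrightarrow> \<sigma> p \<in> normal_space (proj sS) X (veronese (rnc p))" for U \<sigma>
  proof -
    have Up: "p \<in> proj_points plane_scale" if "p \<in> U" for p using P.open_imp_proj_points[OF U that] .
    have F_iff: "(\<lambda>p. \<phi> p (\<sigma> p)) \<in> sections ?F U \<longleftrightarrow>
      (\<forall>i\<in>?I. \<forall>p\<in>U. P.ratio_at p (2 * int n + 2) (\<lambda>L w. \<phi> L (\<sigma> L) (i, w)))"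
    proof -
      have "(\<lambda>p. \<phi> p (\<sigma> p)) \<in> sections ?F U \<longleftrightarrow> (\<forall>i\<in>?I. (\<lambda>p w. \<phi> p (\<sigma> p) (i, w)) \<in> sections ?T U)"
        using \<phi>_zero by (auto simp: direct_sum_def)
      moreover have "(\<lambda>w. \<phi> p (\<sigma> p) (i, w)) \<in> fibre ?T p" if "i \<in> ?I" "p \<in> U" for i p
        using \<phi>_fibre[OF Up[OF that(2)], of "\<sigma> p"] that(1) by (auto simp: direct_sum_def)
      ultimately show ?thesis using P.sections_twist_iff[OF U] by simp
    qed
    show ?thesis
    proof
      assume \<sigma>: "\<sigma> \<in> sections restricted_normal_bundle U"
      show "(\<lambda>p. \<phi> p (\<sigma> p)) \<in> sections ?F U"
        unfolding F_iff
      proof (intro ballI)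
        fix i p assume i: "i \<in> ?I" and p: "p \<in> U"
        obtain w where w: "w \<noteq> 0" "p = P.span {w}" using Up[OF p] by (rule P.proj_pointE)
        have "P.ratio_at p (2 * int n + 2) (\<lambda>L w. coeff_at (\<sigma> L) w (fst (\<pi> i)) (snd (\<pi> i)))"
          unfolding w(2)
          by (rule coeff_ratio[OF w(1) line_coord_nonzero[OF w(1)] U _ fib section_eqn_ratio[OF w(1) line_coord_nonzero[OF w(1)] _ _ U _ \<sigma>] \<pi>_less[OF i]])
            (use p w in auto)
        then show "P.ratio_at p (2 * int n + 2) (\<lambda>L w. \<phi> L (\<sigma> L) (i, w))"
          by (rule P.ratio_at_cong[OF _ U p]) (use \<phi>_val i in auto)
      qed
    next
      assume "(\<lambda>p. \<phi> p (\<sigma> p)) \<in> sections ?F U"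
      then have ratio: "P.ratio_at p (2 * int n + 2) (\<lambda>L w. \<phi> L (\<sigma> L) (i, w))" if "i \<in> ?I" "p \<in> U" for i p
        using that unfolding F_iff by blast
      show "\<sigma> \<in> sections restricted_normal_bundle U"
      proof (rule section_if_eqn_ratio[OF U fib])
        fix w :: "'k \<times> 'k" and b j l
        assume w: "w \<noteq> 0" "P.span {w} \<in> U" "line_coord b w \<noteq> 0" and jl: "j \<le> n" "l \<le> n"
        have coeff: "P.ratio_at (P.span {w}) (2 * int n + 2) (\<lambda>L w. coeff_at (\<sigma> L) w i k)"
          if ik: "i < n" "k < n" for i k
        proof -
          obtain m where m: "m \<in> ?I" "\<forall>p \<nu> w. w \<in> p - {0} \<longrightarrow> \<phi> p \<nu> (m, w) = coeff_at \<nu> w i k"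
            using coeff_from_\<phi>[OF ik] by blast
          show ?thesis
            by (rule P.ratio_at_cong[OF ratio[OF m(1) w(2)] U w(2)]) (use m(2) in auto)
        qed
        show "P.ratio_at (P.span {w}) 0 (\<lambda>L _. \<sigma> L (eqn (ch b) j l))"
          by (rule eqn_ratio_from_coeff[where \<sigma> = \<sigma>, OF w(1,3) U w(2) fib coeff jl])
      qed
    qed
  qed
  have top: "topspace (zariski proj_line) = (proj_points plane_scale :: ('k \<times> 'k) set set)"
    by (simp add: P.topspace_zariski)
  show ?thesis
    unfolding bundle_iso_def base_restricted fibre_restricted top
  proof (intro conjI exI[of _ \<phi>] ballI allI impI)
    show "proj_line = base ?F" by (simp add: direct_sum_def)
    show "bij_betw (\<phi> p) (normal_space (proj sS) X (veronese (rnc p))) (fibre ?F p)"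
      if "p \<in> proj_points plane_scale" for p by (rule bij[OF that])
    show "\<sigma> \<in> sections restricted_normal_bundle U \<longleftrightarrow> (\<lambda>p. \<phi> p (\<sigma> p)) \<in> sections ?F U"
      if "openin (zariski proj_line) U \<and> (\<forall>p\<in>U. \<sigma> p \<in> normal_space (proj sS) X (veronese (rnc p)))" for U \<sigma>
      using that by (intro sec) auto
  qed (rule linear)+
qed

end

section \<open>Coordinates adapted to a rational normal curve\<close>

text \<open>
  Lagrange interpolation: a coefficient of a polynomial of degree at most \<open>n\<close> is a linear combination
  of its values at \<open>n + 1\<close> points. Since \<open>c\<^sub>j (r (m, 1)) = m\<^sup>j\<close>, the vectors dual to the \<open>c\<^sub>j\<close> are then
  combinations of points of the curve.
\<close>

lemma coefficient_from_values:
  fixes x :: "nat \<Rightarrow> 'k::field_char_0"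
  assumes "inj x"
  shows "\<exists>\<omega>. \<forall>j\<le>n. (\<Sum>m\<le>n. \<omega> m * x m ^ j) = (if j = k then 1 else 0)"
proof -
  define L where "L m = (\<Prod>i\<in>{..n} - {m}. smult (1 / (x m - x i)) [:- x i, 1:])" for m
  have L: "poly (L m) (x i) = (if i = m then 1 else 0)" if "i \<le> n" "m \<le> n" for i m
  proof (cases "i = m")
    case True
    have "poly (L m) (x m) = (\<Prod>i\<in>{..n} - {m}. 1)"
      unfolding L_def poly_prod using assms by (intro prod.cong) (auto simp: inj_eq diff_divide_distrib[symmetric])
    then show ?thesis using True by simp
  next
    case False
    then show ?thesis using that unfolding L_def poly_prod by (auto intro!: prod_zero bexI[of _ i])
  qed
  have deg: "degree (L m) \<le> n" if "m \<le> n" for m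
  proof -
    have "degree (L m) \<le> (\<Sum>i\<in>{..n} - {m}. degree (smult (1 / (x m - x i)) [:- x i, 1:]))"
      using degree_prod_sum_le[of "{..n} - {m}" "\<lambda>i. smult (1 / (x m - x i)) [:- x i, 1:]"]
      unfolding L_def o_def by blast
    also have "\<dots> \<le> (\<Sum>i\<in>{..n} - {m}. 1)" by (intro sum_mono) (auto intro: order_trans[OF degree_smult_le])
    finally show ?thesis using that by simp
  qed
  have "(\<Sum>m\<le>n. coeff (L m) k * x m ^ j) = (if j = k then 1 else 0)" if j: "j \<le> n" for j
  proof -
    have "monom 1 j = (\<Sum>m\<le>n. smult (x m ^ j) (L m))"
    proof (rule poly_eqI_degree[of "x ` {..n}"])
      have card: "card (x ` {..n}) = Suc n" using assms by (simp add: card_image inj_on_subset)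
      show "degree (monom (1::'k) j) < card (x ` {..n})" using j by (simp add: card degree_monom_eq)
      have "degree (\<Sum>m\<le>n. smult (x m ^ j) (L m)) \<le> n"
        by (intro degree_sum_le) (auto intro: order_trans[OF degree_smult_le] deg)
      then show "degree (\<Sum>m\<le>n. smult (x m ^ j) (L m)) < card (x ` {..n})" by (simp add: card)
      fix y assume "y \<in> x ` {..n}"
      then obtain i where i: "i \<le> n" "y = x i" by auto
      have "poly (\<Sum>m\<le>n. smult (x m ^ j) (L m)) y = (\<Sum>m\<le>n. if m = i then x m ^ j else 0)"
        unfolding poly_sum i(2) using L[OF i(1)] by (intro sum.cong) auto
      then show "poly (monom 1 j) y = poly (\<Sum>m\<le>n. smult (x m ^ j) (L m)) y"
        using i(1) unfolding i(2) by (simp add: poly_monom)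
    qed
    then have "coeff (monom 1 j) k = (\<Sum>m\<le>n. coeff (smult (x m ^ j) (L m)) k)"
      by (simp only: coeff_sum)
    also have "\<dots> = (\<Sum>m\<le>n. coeff (L m) k * x m ^ j)" by (simp only: coeff_smult mult.commute)
    finally show ?thesis by (simp only: coeff_monom)
  qed
  then show ?thesis by (intro exI[of _ "\<lambda>m. coeff (L m) k"] allI impI)
qed

lemma plane_form_monomials:
  fixes F :: "'k::field_char_0 \<times> 'k \<Rightarrow> 'k"
  assumes "F \<in> forms plane_scale d"
  shows "\<exists>\<alpha>. \<forall>w. F w = (\<Sum>j\<le>d. \<alpha> j * (fst w ^ j * snd w ^ (d - j)))"
  using assms
proof (induction F rule: forms.induct)
  case (product l c)
  then have "\<exists>\<alpha>. \<forall>w. (\<Prod>i<d. l i w) = (\<Sum>j\<le>d. \<alpha> j * (fst w ^ j * snd w ^ (d - j)))"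
  proof (induction d)
    case 0 show ?case by (rule exI[of _ "\<lambda>_. 1"]) simp
  next
    case (Suc d)
    then obtain \<alpha> where \<alpha>: "\<And>w. (\<Prod>i<d. l i w) = (\<Sum>j\<le>d. \<alpha> j * (fst w ^ j * snd w ^ (d - j)))" by auto
    define A B where "A = l d (1, 0)" and "B = l d (0, 1)"
    have l: "l d w = fst w * A + snd w * B" for w
    proof -
      have "w = plane_scale (fst w) (1, 0) + plane_scale (snd w) (0, 1)"
        by (simp add: plane_scale_def prod_eq_iff)
      moreover have "linear_functional plane_scale (l d)" using Suc(2) by simp
      ultimately show ?thesis unfolding P.linear_functional_iff A_def B_def by metis
    qed
    define \<beta> where "\<beta> j = (case j of 0 \<Rightarrow> 0 | Suc i \<Rightarrow> A * \<alpha> i) + (if j \<le> d then B * \<alpha> j else 0)" for j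
    have "(\<Prod>i<Suc d. l i w) = (\<Sum>j\<le>Suc d. \<beta> j * (fst w ^ j * snd w ^ (Suc d - j)))" for w
    proof -
      have "(\<Sum>j\<le>Suc d. \<beta> j * (fst w ^ j * snd w ^ (Suc d - j))) =
        (\<Sum>j\<le>Suc d. (case j of 0 \<Rightarrow> 0 | Suc i \<Rightarrow> A * \<alpha> i) * (fst w ^ j * snd w ^ (Suc d - j)))
        + (\<Sum>j\<le>Suc d. (if j \<le> d then B * \<alpha> j else 0) * (fst w ^ j * snd w ^ (Suc d - j)))"
        by (simp only: \<beta>_def distrib_right sum.distrib)
      also have "(\<Sum>j\<le>Suc d. (case j of 0 \<Rightarrow> 0 | Suc i \<Rightarrow> A * \<alpha> i) * (fst w ^ j * snd w ^ (Suc d - j)))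
        = fst w * A * (\<Sum>j\<le>d. \<alpha> j * (fst w ^ j * snd w ^ (d - j)))"
        by (simp only: sum.atMost_Suc_shift sum_distrib_left) (simp add: mult_ac)
      also have "(\<Sum>j\<le>Suc d. (if j \<le> d then B * \<alpha> j else 0) * (fst w ^ j * snd w ^ (Suc d - j)))
        = snd w * B * (\<Sum>j\<le>d. \<alpha> j * (fst w ^ j * snd w ^ (d - j)))"
        by (simp only: sum.atMost_Suc sum_distrib_left) (auto simp: Suc_diff_le mult_ac intro!: sum.cong)
      finally show ?thesis by (simp add: \<alpha> l algebra_simps)
    qed
    then show ?case by blast
  qed
  then obtain \<alpha> where "\<And>w. (\<Prod>i<d. l i w) = (\<Sum>j\<le>d. \<alpha> j * (fst w ^ j * snd w ^ (d - j)))" by blast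
  then show ?case by (intro exI[of _ "\<lambda>j. c * \<alpha> j"]) (simp add: sum_distrib_left mult.assoc)
next
  case (add F G)
  then obtain \<alpha> \<beta> where "\<And>w. F w = (\<Sum>j\<le>d. \<alpha> j * (fst w ^ j * snd w ^ (d - j)))"
    "\<And>w. G w = (\<Sum>j\<le>d. \<beta> j * (fst w ^ j * snd w ^ (d - j)))" by blast
  then show ?case by (intro exI[of _ "\<lambda>j. \<alpha> j + \<beta> j"]) (simp add: distrib_right sum.distrib)
qed

lemma (in projective_space) quadratic_form_monomials:
  assumes span: "\<And>l. linear_functional s l \<Longrightarrow> \<exists>\<alpha>. \<forall>v. l v = (\<Sum>j\<le>n. \<alpha> j * c j v)"
    and F: "F \<in> forms s 2"
  shows "\<exists>\<alpha>. \<forall>v. F v = (\<Sum>(j, k)\<in>{..n} \<times> {..n}. \<alpha> j k * (c j v * c k v))"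
  using F
proof (induction F rule: forms.induct)
  case (product l r)
  obtain \<alpha> \<beta> where l: "\<And>v. l 0 v = (\<Sum>j\<le>n. \<alpha> j * c j v)" "\<And>v. l 1 v = (\<Sum>j\<le>n. \<beta> j * c j v)"
    using span[OF product[of 0]] span[OF product[of 1]] by auto
  have "r * (\<Prod>i<2. l i v) = (\<Sum>(j, k)\<in>{..n} \<times> {..n}. (r * \<alpha> j * \<beta> k) * (c j v * c k v))" for v
  proof -
    have "r * (\<Prod>i<2. l i v) = r * (l 0 v * l 1 v)" by (simp add: numeral_2_eq_2)
    also have "\<dots> = (\<Sum>j\<le>n. \<Sum>k\<le>n. (r * \<alpha> j * \<beta> k) * (c j v * c k v))"
    proof -
      have "l 0 v * l 1 v = (\<Sum>j\<le>n. \<Sum>k\<le>n. (\<alpha> j * c j v) * (\<beta> k * c k v))"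
        unfolding l by (rule sum_product)
      then show ?thesis by (simp only: sum_distrib_left mult_ac)
    qed
    finally show ?thesis by (simp add: sum.cartesian_product)
  qed
  then show ?case by (intro exI[of _ "\<lambda>j k. r * \<alpha> j * \<beta> k"]) blast
next
  case (add F G)
  then obtain \<alpha> \<beta> where "\<And>v. F v = (\<Sum>(j, k)\<in>{..n} \<times> {..n}. \<alpha> j k * (c j v * c k v))"
    "\<And>v. G v = (\<Sum>(j, k)\<in>{..n} \<times> {..n}. \<beta> j k * (c j v * c k v))" by blast
  then show ?case
    by (intro exI[of _ "\<lambda>j k. \<alpha> j k + \<beta> j k"]) (simp add: case_prod_unfold distrib_right sum.distrib)
qed

theorem theorem1p3:
  fixes scaleV :: "'k::{alg_closed_field, field_char_0} \<Rightarrow> 'v::ab_group_add \<Rightarrow> 'v"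
    and scaleS :: "'k \<Rightarrow> 's::ab_group_add \<Rightarrow> 's"
    and mult :: "'v \<Rightarrow> 'v \<Rightarrow> 's"
    and n :: nat
    and veronese :: "'v set \<Rightarrow> 's set"
    and rnc :: "('k \<times> 'k) set \<Rightarrow> 'v set"
    and X :: "'s set set" and R :: "'v set set"
  assumes "vector_space scaleV"
    and "vector_space.dim scaleV UNIV = n + 1"
    and "n \<ge> 1"
    and "vector_space scaleS"
    and "symmetric_square scaleV scaleS mult"
    and "complete_series_map scaleV 2 scaleS veronese"
    and "X = veronese ` proj_points scaleV"
    and "complete_series_map plane_scale n scaleV rnc"
    and "R = rnc ` proj_points plane_scale"
  shows "bundle_iso
    (pullback proj_line rnc
      (restrict_bundle (pullback (proj scaleV) veronese (normal_bundle (proj scaleS) X)) R))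
    (direct_sum proj_line {1..n * (n + 1) div 2} (\<lambda>i. twist plane_scale (2 * int n + 2)))"
proof -
  interpret V: projective_space scaleV using assms(1) by (simp add: projective_space_def)
  interpret S: projective_space scaleS using assms(4) by (simp add: projective_space_def)
  obtain q where q: "bij_betw (\<lambda>l. l \<circ> q) {l. linear_functional scaleS l} (forms scaleV 2)"
    "\<And>v. v \<noteq> 0 \<Longrightarrow> veronese (V.span {v}) = S.span {q v}"
    using assms(6) unfolding complete_series_map_def by blast
  obtain r where r: "bij_betw (\<lambda>l. l \<circ> r) {l. linear_functional scaleV l} (forms plane_scale n)"
    "\<And>w. w \<noteq> 0 \<Longrightarrow> rnc (P.span {w}) = V.span {r w}"
    using assms(8) unfolding complete_series_map_def by blast
  have q_form: "(\<lambda>v. l (q v)) \<in> forms scaleV 2" if "linear_functional scaleS l" for l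
    using bij_betwE[OF q(1)] that by (auto simp: o_def)
  have r_form: "(\<lambda>w. l (r w)) \<in> forms plane_scale n" if "linear_functional scaleV l" for l
    using bij_betwE[OF r(1)] that by (auto simp: o_def)
  have q_inj: "l = l'" if "linear_functional scaleS l" "linear_functional scaleS l'" "\<And>v. l (q v) = l' (q v)" for l l'
    using bij_betw_imp_inj_on[OF q(1)] that unfolding inj_on_def by (auto simp: o_def)
  have r_inj: "l = l'" if "linear_functional scaleV l" "linear_functional scaleV l'" "\<And>w. l (r w) = l' (r w)" for l l'
    using bij_betw_imp_inj_on[OF r(1)] that unfolding inj_on_def by (auto simp: o_def)
  \<comment> \<open>Completeness of the series of degree \<open>n\<close> provides the functionals that restrict to the
    monomials, and shows that they span the dual of \<open>V\<close>.\<close>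
  define c where "c j = inv_into {l. linear_functional scaleV l} (\<lambda>l. l \<circ> r) (\<lambda>w. fst w ^ j * snd w ^ (n - j))" for j
  have c: "linear_functional scaleV (c j)" "c j (r w) = fst w ^ j * snd w ^ (n - j)" if "j \<le> n" for j w
  proof -
    have "(\<lambda>w::'k \<times> 'k. fst w ^ j * snd w ^ (n - j)) \<in> forms plane_scale (j * 1 + (n - j) * 1)"
      by (intro P.form_mult P.form_power P.form_linear plane_functionals)
    then have "(\<lambda>w::'k \<times> 'k. fst w ^ j * snd w ^ (n - j)) \<in> (\<lambda>l. l \<circ> r) ` {l. linear_functional scaleV l}"
      using that bij_betw_imp_surj_on[OF r(1)] by simp
    from inv_into_into[OF this] fun_cong[OF f_inv_into_f[OF this], of w]
    show "linear_functional scaleV (c j)" "c j (r w) = fst w ^ j * snd w ^ (n - j)"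
      unfolding c_def by (simp_all add: o_def)
  qed
  have c_span: "\<exists>\<alpha>. \<forall>v. l v = (\<Sum>j\<le>n. \<alpha> j * c j v)" if l: "linear_functional scaleV l" for l
  proof -
    obtain \<alpha> where \<alpha>: "\<And>w. l (r w) = (\<Sum>j\<le>n. \<alpha> j * (fst w ^ j * snd w ^ (n - j)))"
      using plane_form_monomials[OF r_form[OF l]] by blast
    have "l = (\<lambda>v. \<Sum>j\<le>n. \<alpha> j * c j v)"
      by (rule r_inj[OF l V.linear_functional_lincomb]) (use c \<alpha> in auto)
    then show ?thesis by metis
  qed
  have c_separates: "\<exists>j\<le>n. c j v \<noteq> 0" if "v \<noteq> 0" for v
  proof (rule ccontr)
    assume "\<not> (\<exists>j\<le>n. c j v \<noteq> 0)"
    then have "l v = 0" if "linear_functional scaleV l" for l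
      using c_span[OF that] by fastforce
    then show False using V.exists_functional_nonzero[OF that] by blast
  qed
  have "inj (of_nat :: nat \<Rightarrow> 'k)" by (rule inj_of_nat)
  then have "\<exists>\<omega>. \<forall>j\<le>n. (\<Sum>m\<le>n. \<omega> m * (of_nat m :: 'k) ^ j) = (if j = k then 1 else 0)" for k
    by (rule coefficient_from_values)
  then obtain \<omega> where \<omega>: "\<And>j k. j \<le> n \<Longrightarrow> (\<Sum>m\<le>n. \<omega> k m * (of_nat m :: 'k) ^ j) = (if j = k then 1 else 0)"
    by metis
  define e where "e k = (\<Sum>m\<le>n. scaleV (\<omega> k m) (r (of_nat m, 1)))" for k
  have c_e: "c i (e j) = (if i = j then 1 else 0)" if "i \<le> n" "j \<le> n" for i j
    unfolding e_def V.linear_functional_combination[OF c(1)[OF that(1)]]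
    using c(2)[OF that(1)] \<omega>[OF that(1)] by simp
  define z where "z j k = inv_into {l. linear_functional scaleS l} (\<lambda>l. l \<circ> q) (\<lambda>v. c j v * c k v)" for j k
  have z: "linear_functional scaleS (z j k)" "z j k (q v) = c j v * c k v" if "j \<le> n" "k \<le> n" for j k v
  proof -
    have "(\<lambda>v. c j v * c k v) \<in> forms scaleV (1 + 1)"
      by (intro V.form_mult V.form_linear c(1) that)
    then have "(\<lambda>v. c j v * c k v) \<in> (\<lambda>l. l \<circ> q) ` {l. linear_functional scaleS l}"
      using bij_betw_imp_surj_on[OF q(1)] by (simp add: numeral_2_eq_2)
    from inv_into_into[OF this] fun_cong[OF f_inv_into_f[OF this], of v]
    show "linear_functional scaleS (z j k)" "z j k (q v) = c j v * c k v"
      unfolding z_def by (simp_all add: o_def)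
  qed
  have z_sym: "z j k = z k j" if "j \<le> n" "k \<le> n" for j k by (simp add: z_def mult.commute)
  have z_span: "\<exists>\<alpha>. \<forall>x. l x = (\<Sum>(j, k)\<in>{..n} \<times> {..n}. \<alpha> j k * z j k x)"
    if l: "linear_functional scaleS l" for l
  proof -
    obtain \<alpha> where \<alpha>: "\<And>v. l (q v) = (\<Sum>(j, k)\<in>{..n} \<times> {..n}. \<alpha> j k * (c j v * c k v))"
      using V.quadratic_form_monomials[OF c_span q_form[OF l]] by blast
    have "l = (\<lambda>x. \<Sum>p\<in>{..n} \<times> {..n}. \<alpha> (fst p) (snd p) * z (fst p) (snd p) x)"
      by (rule q_inj[OF l S.linear_functional_lincomb])
        (use z \<alpha> in \<open>auto simp: case_prod_unfold intro!: sum.cong\<close>)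
    then show ?thesis by (intro exI[of _ \<alpha>]) (simp add: case_prod_unfold)
  qed
  interpret rnc_coordinates scaleV scaleS q n c e z r rnc veronese
    by unfold_locales (fact c c_separates c_e q_form z z_sym z_span r_form r(2) q(2))+
  show ?thesis
    using bundle_iso_twist_sum unfolding image_veronese[symmetric] assms(7,9) .
qed

end
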